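(* Let $\gamma$ be a strict partition and $n\ge1$. Then $$P_\gamma(x_1,\dots,x_n)=\sum_{T\in \mathrm{Yam}(\gamma)} s_{\mathrm{wt}(T)}(x_1,\dots,x_n).$$ In particular, the Schur $P$-polynomial $P_\gamma(x_1,\dots,x_n)$ is Schur positive, i.e. a nonnegative integer combination of Schur polynomials.
   Context: **Shifted tableaux.** A strict partition is $\gamma=(\gamma_1>\gamma_2>\cdots>\gamma_\ell>0)$. Its shifted diagram has $\gamma_i$ cells in row $i$, with rows indexed from bottom to top, and row $i$ occupying columns $i,\dots,i+\gamma_i-1$; the main diagonal consists of the cells in row $i$ and column $i$. Marked and unmarked positive integers are ordered $1'<1<2'<2<\cdots$. $\mathrm{SSHT}(\gamma)$ is the set of fillings of the shifted diagram with marked or unmarked positive integers such that entries weakly increase along rows (left to right) and along columns (bottom to top), for each $i$ each column has at most one unmarked $i$ and each row has at most one marked $i'$, and no entry on the main diagonal is marked. $\mathrm{SSHT}_n(\gamma)$ is the subset with entries in $\{1',1,\dots,n',n\}$. $\mathrm{wt}(T)_i$ is the number of entries of $T$ equal to $i$ or $i'$. The Schur $P$-polynomial is $$P_\gamma(x_1,\dots,x_n)=\sum_{T\in\mathrm{SSHT}_n(\gamma)}x_1^{\mathrm{wt}(T)_1}\cdots x_n^{\mathrm{wt}(T)_n}.$$ **Hook reading word.** For $T\in\mathrm{SSHT}(\gamma)$, $w(T)=w_1\cdots w_k$ is the word obtained, for $i$ from $\max(\gamma_1,\ell)$ down to $1$, by reading the marked entries of column $i$ from bottom to top, and then the unmarked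 entries of row $i$ from left to right. **$\mathrm{Yam}(\gamma)$** is the set of $T\in \mathrm{SSHT}(\gamma)$ such that for every $i\ge1$, every suffix $w_{r+1}\cdots w_k$ ($0\le r\le k$) of $w(T)$ contains at least as many letters in $\{i,i'\}$ as letters in $\{i+1,(i+1)'\}$. (These are the highest weight elements of the crystal on shifted tableaux; $\mathrm{wt}(T)$ is then a partition.) $s_\lambda(x_1,\dots,x_n)$ is the usual Schur polynomial, with $s_\lambda(x_1,\dots,x_n)=0$ if $\lambda$ has more than $n$ parts. *)

theory Defs
  imports "HOL-Library.FuncSet" "HOL-Library.Poly_Mapping"
begin

section \<open>Polynomials\<close>

text \<open>Integer polynomials in variables indexed by the natural numbers; a monomial is a finitely
  supported exponent vector. Polynomials in x_1, ..., x_n are those that only involve the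
  variables with index in \<open>{1..n}\<close>.\<close>

type_synonym mpolynomial = "(nat \<Rightarrow>\<^sub>0 nat) \<Rightarrow>\<^sub>0 int"

definition Var :: "nat \<Rightarrow> mpolynomial" where
  "Var i = Poly_Mapping.single (Poly_Mapping.single i 1) 1"

definition monomial_pow :: "nat \<Rightarrow> (nat \<Rightarrow> nat) \<Rightarrow> mpolynomial" where
  "monomial_pow n \<alpha> = (\<Prod>i=1..n. Var i ^ \<alpha> i)"


section \<open>Partitions and Schur polynomials\<close>

text \<open>The parts of a partition are indexed from 1, followed by infinitely many zeros. The value
  at index 0 carries no information and is fixed to be 0.\<close>

definition is_partition :: "(nat \<Rightarrow> nat) \<Rightarrow> bool" where
  "is_partition p \<longleftrightarrow> p 0 = 0 \<and> finite {i. p i > 0} \<and> (\<forall>i\<ge>1. p (Suc i) \<le> p i)"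

definition strict_partition :: "(nat \<Rightarrow> nat) \<Rightarrow> bool" where
  "strict_partition p \<longleftrightarrow> is_partition p \<and> (\<forall>i\<ge>1. p i > 0 \<longrightarrow> p (Suc i) < p i)"

definition num_parts :: "(nat \<Rightarrow> nat) \<Rightarrow> nat" where
  "num_parts p = card {i. p i > 0}"

text \<open>Cells are pairs (row, column), both counted from 1, rows from bottom to top.\<close>

definition young_diagram :: "(nat \<Rightarrow> nat) \<Rightarrow> (nat \<times> nat) set" where
  "young_diagram p = {(r, c). 1 \<le> r \<and> 1 \<le> c \<and> c \<le> p r}"

text \<open>Fillings are extensional functions, so that the values outside of the diagram do not
  distinguish fillings.\<close>

definition SSYT :: "nat \<Rightarrow> (nat \<Rightarrow> nat) \<Rightarrow> (nat \<times> nat \<Rightarrow> nat) set" where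
  "SSYT n p = {T \<in> young_diagram p \<rightarrow>\<^sub>E {1..n}.
     (\<forall>r c c'. (r, c) \<in> young_diagram p \<and> (r, c') \<in> young_diagram p \<and> c < c' \<longrightarrow>
        T (r, c) \<le> T (r, c')) \<and>
     (\<forall>r r' c. (r, c) \<in> young_diagram p \<and> (r', c) \<in> young_diagram p \<and> r < r' \<longrightarrow>
        T (r, c) < T (r', c))}"

text \<open>If \<open>p\<close> has more than \<open>n\<close> parts, then its first column cannot be filled and the sum is
  empty.\<close>

definition schur :: "nat \<Rightarrow> (nat \<Rightarrow> nat) \<Rightarrow> mpolynomial" where
  "schur n p =
     (\<Sum>T\<in>SSYT n p. monomial_pow n (\<lambda>i. card {b \<in> young_diagram p. T b = i}))"

definition schur_positive :: "nat \<Rightarrow> mpolynomial \<Rightarrow> bool" where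
  "schur_positive n f \<longleftrightarrow> (\<exists>P (m :: (nat \<Rightarrow> nat) \<Rightarrow> nat).
     finite P \<and> (\<forall>p\<in>P. is_partition p) \<and> f = (\<Sum>p\<in>P. of_nat (m p) * schur n p))"


section \<open>Shifted tableaux and Schur P-polynomials\<close>

datatype letter = Marked (num: nat) | Unmarked (num: nat)

fun is_marked :: "letter \<Rightarrow> bool" where
  "is_marked (Marked i) = True"
| "is_marked (Unmarked i) = False"

text \<open>The rank realises the order 1' < 1 < 2' < 2 < ...\<close>

fun rank :: "letter \<Rightarrow> nat" where
  "rank (Marked i) = 2 * i"
| "rank (Unmarked i) = 2 * i + 1"

lemma rank_inject: "rank x = rank y \<longleftrightarrow> x = y"
  by (cases x; cases y; simp; presburger)

instantiation letter :: linorder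
begin

definition less_eq_letter :: "letter \<Rightarrow> letter \<Rightarrow> bool" where
  "x \<le> y \<longleftrightarrow> rank x \<le> rank y"

definition less_letter :: "letter \<Rightarrow> letter \<Rightarrow> bool" where
  "x < y \<longleftrightarrow> rank x < rank y"

instance
  by standard (auto simp: less_eq_letter_def less_letter_def rank_inject)

end

definition shifted_diagram :: "(nat \<Rightarrow> nat) \<Rightarrow> (nat \<times> nat) set" where
  "shifted_diagram g = {(r, c). 1 \<le> r \<and> r \<le> c \<and> c < r + g r}"

definition SSHT :: "(nat \<Rightarrow> nat) \<Rightarrow> (nat \<times> nat \<Rightarrow> letter) set" where
  "SSHT g = {T \<in> shifted_diagram g \<rightarrow>\<^sub>E {x. num x \<ge> 1}.
     (\<forall>r c c'. (r, c) \<in> shifted_diagram g \<and> (r, c') \<in> shifted_diagram g \<and> c < c' \<longrightarrow>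
        T (r, c) \<le> T (r, c')) \<and>
     (\<forall>r r' c. (r, c) \<in> shifted_diagram g \<and> (r', c) \<in> shifted_diagram g \<and> r < r' \<longrightarrow>
        T (r, c) \<le> T (r', c)) \<and>
     (\<forall>i c. card {r. (r, c) \<in> shifted_diagram g \<and> T (r, c) = Unmarked i} \<le> 1) \<and>
     (\<forall>i r. card {c. (r, c) \<in> shifted_diagram g \<and> T (r, c) = Marked i} \<le> 1) \<and>
     (\<forall>i. (i, i) \<in> shifted_diagram g \<longrightarrow> \<not> is_marked (T (i, i)))}"

definition SSHT_upto :: "nat \<Rightarrow> (nat \<Rightarrow> nat) \<Rightarrow> (nat \<times> nat \<Rightarrow> letter) set" where
  "SSHT_upto n g = {T \<in> SSHT g. \<forall>b\<in>shifted_diagram g. num (T b) \<le> n}"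

definition wt :: "(nat \<Rightarrow> nat) \<Rightarrow> (nat \<times> nat \<Rightarrow> letter) \<Rightarrow> nat \<Rightarrow> nat" where
  "wt g T i = card {b \<in> shifted_diagram g. num (T b) = i}"

definition schurP :: "nat \<Rightarrow> (nat \<Rightarrow> nat) \<Rightarrow> mpolynomial" where
  "schurP n g = (\<Sum>T\<in>SSHT_upto n g. monomial_pow n (wt g T))"


section \<open>Hook reading word and Yamanouchi tableaux\<close>

definition marked_column :: "(nat \<Rightarrow> nat) \<Rightarrow> (nat \<times> nat \<Rightarrow> letter) \<Rightarrow> nat \<Rightarrow> letter list" where
  "marked_column g T i = filter is_marked
     (map (\<lambda>r. T (r, i)) (filter (\<lambda>r. (r, i) \<in> shifted_diagram g) [1..<Suc (num_parts g)]))"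

definition unmarked_row :: "(nat \<Rightarrow> nat) \<Rightarrow> (nat \<times> nat \<Rightarrow> letter) \<Rightarrow> nat \<Rightarrow> letter list" where
  "unmarked_row g T i = filter (\<lambda>x. \<not> is_marked x) (map (\<lambda>c. T (i, c)) [i..<i + g i])"

definition hook_word :: "(nat \<Rightarrow> nat) \<Rightarrow> (nat \<times> nat \<Rightarrow> letter) \<Rightarrow> letter list" where
  "hook_word g T = concat (map (\<lambda>i. marked_column g T i @ unmarked_row g T i)
     (rev [1..<Suc (max (g 1) (num_parts g))]))"

definition num_count :: "nat \<Rightarrow> letter list \<Rightarrow> nat" where
  "num_count i w = length (filter (\<lambda>x. num x = i) w)"

definition Yam :: "(nat \<Rightarrow> nat) \<Rightarrow> (nat \<times> nat \<Rightarrow> letter) set" where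
  "Yam g = {T \<in> SSHT g. \<forall>i\<ge>1. \<forall>r\<le>length (hook_word g T).
     num_count (Suc i) (drop r (hook_word g T)) \<le> num_count i (drop r (hook_word g T))}"


section \<open>Finiteness of the index sets\<close>

text \<open>For partitions, all sums over sets of tableaux range over finite sets, so none of them
  is 0 by convention.\<close>

lemma partition_antimono:
  assumes "is_partition p" "1 \<le> i" "i \<le> j"
  shows "p j \<le> p i"
  using assms(3)
proof (induction rule: dec_induct)
  case (step k)
  then show ?case using assms unfolding is_partition_def by (meson le_trans)
qed simp

lemma partition_parts:
  assumes "is_partition p"
  shows "{i. p i > 0} = {1..num_parts p}"
proof -
  let ?S = "{i. p i > 0}"
  have fin: "finite ?S" and z: "p 0 = 0" using assms by (auto simp: is_partition_def)
  show ?thesis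
  proof (cases "?S = {}")
    case True
    then show ?thesis unfolding num_parts_def by simp
  next
    case False
    define M where "M = Max ?S"
    have M: "M \<in> ?S" using Max_in[OF fin False] by (simp add: M_def)
    have "?S \<subseteq> {1..M}"
    proof
      fix i assume i: "i \<in> ?S"
      then have "i \<noteq> 0" using z by (cases i) auto
      then show "i \<in> {1..M}" using Max_ge[OF fin i] by (auto simp: M_def)
    qed
    moreover have "{1..M} \<subseteq> ?S"
    proof
      fix i assume "i \<in> {1..M}"
      then have "p M \<le> p i" by (intro partition_antimono[OF assms]) auto
      then show "i \<in> ?S" using M by auto
    qed
    ultimately have "?S = {1..M}" by blast
    then show ?thesis by (simp add: num_parts_def)
  qed
qed

lemma finite_young_diagram:
  assumes "is_partition p"
  shows "finite (young_diagram p)"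
proof (rule finite_subset)
  show "young_diagram p \<subseteq> {1..num_parts p} \<times> {1..p 1}"
  proof safe
    fix r c assume "(r, c) \<in> young_diagram p"
    then have rc: "1 \<le> r" "1 \<le> c" "c \<le> p r" by (auto simp: young_diagram_def)
    then have "r \<in> {i. p i > 0}" by auto
    then show "r \<in> {1..num_parts p}" using partition_parts[OF assms] by blast
    show "c \<in> {1..p 1}" using rc partition_antimono[OF assms order_refl rc(1)] by auto
  qed
qed simp

lemma shifted_diagram_bounds:
  assumes "strict_partition g" "(r, c) \<in> shifted_diagram g"
  shows "1 \<le> r" "r \<le> num_parts g" "r \<le> c" "c \<le> g 1"
proof -
  have p: "is_partition g" and s: "\<And>i. i \<ge> 1 \<Longrightarrow> g i > 0 \<Longrightarrow> g (Suc i) < g i"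
    using assms(1) by (auto simp: strict_partition_def)
  have rc: "1 \<le> r" "r \<le> c" "c < r + g r" using assms(2) by (auto simp: shifted_diagram_def)
  have pos: "g r > 0" using rc by simp
  then show "1 \<le> r" "r \<le> c" "r \<le> num_parts g" using rc partition_parts[OF p] by auto
  have "g r > 0 \<longrightarrow> r + g r \<le> 1 + g 1"
    using rc(1)
  proof (induction rule: dec_induct)
    case (step k)
    show ?case
    proof
      assume k: "g (Suc k) > 0"
      then have "g k > 0" using partition_antimono[OF p step(1), of "Suc k"] by simp
      then show "Suc k + g (Suc k) \<le> 1 + g 1" using s[OF step(1)] step.IH by simp
    qed
  qed simp
  then show "c \<le> g 1" using pos rc by simp
qed

lemma finite_shifted_diagram:
  assumes "strict_partition g"
  shows "finite (shifted_diagram g)"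
proof (rule finite_subset)
  show "shifted_diagram g \<subseteq> {1..num_parts g} \<times> {1..g 1}"
  proof
    fix b assume "b \<in> shifted_diagram g"
    then show "b \<in> {1..num_parts g} \<times> {1..g 1}"
      using shifted_diagram_bounds[OF assms, of "fst b" "snd b"] by (cases b) auto
  qed
qed simp

lemma finite_SSYT:
  assumes "is_partition p"
  shows "finite (SSYT n p)"
proof (rule finite_subset)
  show "SSYT n p \<subseteq> young_diagram p \<rightarrow>\<^sub>E {1..n}" by (auto simp: SSYT_def)
qed (intro finite_PiE finite_young_diagram assms finite_atLeastAtMost)

lemma finite_num_le: "finite {x. num x \<le> n}"
proof (rule finite_subset)
  show "{x. num x \<le> n} \<subseteq> Marked ` {..n} \<union> Unmarked ` {..n}"
  proof
    fix x assume "x \<in> {x. num x \<le> n}"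
    then show "x \<in> Marked ` {..n} \<union> Unmarked ` {..n}" by (cases x) auto
  qed
qed simp

lemma finite_SSHT_upto:
  assumes "strict_partition g"
  shows "finite (SSHT_upto n g)"
proof (rule finite_subset)
  show "SSHT_upto n g \<subseteq> shifted_diagram g \<rightarrow>\<^sub>E {x. num x \<le> n}"
    by (intro subsetI PiE_I) (auto simp: SSHT_upto_def SSHT_def PiE_iff extensional_def)
qed (intro finite_PiE finite_shifted_diagram assms finite_num_le)

lemma hook_word_complete:
  assumes "strict_partition g" "b \<in> shifted_diagram g"
  shows "T b \<in> set (hook_word g T)"
proof -
  obtain r c where b: "b = (r, c)" by (cases b)
  note B = shifted_diagram_bounds[OF assms(1) assms(2)[unfolded b]]
  have c: "c < r + g r" using assms(2) by (simp add: b shifted_diagram_def)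
  let ?N = "Suc (max (g 1) (num_parts g))"
  show ?thesis
  proof (cases "is_marked (T b)")
    case True
    then have "T b \<in> set (marked_column g T c)"
      using B assms(2) by (auto simp: marked_column_def b simp del: upt_Suc intro!: imageI)
    moreover have "c \<in> set [1..<?N]" using B by auto
    ultimately show ?thesis by (auto simp: hook_word_def simp del: upt_Suc)
  next
    case False
    then have "T b \<in> set (unmarked_row g T r)"
      using B c by (auto simp: unmarked_row_def b simp del: upt_Suc)
    moreover have "r \<in> set [1..<?N]" using B by auto
    ultimately show ?thesis by (auto simp: hook_word_def simp del: upt_Suc)
  qed
qed

lemma length_hook_word_le:
  "length (hook_word g T) \<le>
     (\<Sum>i\<leftarrow>rev [1..<Suc (max (g 1) (num_parts g))]. num_parts g + g i)"
  unfolding hook_word_def length_concat map_map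
proof (rule sum_list_mono)
  fix i
  have "length (marked_column g T i) \<le> num_parts g"
    unfolding marked_column_def
    by (rule order_trans[OF length_filter_le])
      (simp del: upt_Suc, rule order_trans[OF length_filter_le], simp)
  moreover have "length (unmarked_row g T i) \<le> g i"
    unfolding unmarked_row_def by (rule order_trans[OF length_filter_le]) simp
  ultimately show "(length \<circ> (\<lambda>i. marked_column g T i @ unmarked_row g T i)) i
      \<le> num_parts g + g i" by simp
qed

lemma finite_Yam:
  assumes "strict_partition g"
  shows "finite (Yam g)"
proof (rule finite_subset)
  define N where "N = (\<Sum>i\<leftarrow>rev [1..<Suc (max (g 1) (num_parts g))]. num_parts g + g i)"
  show "Yam g \<subseteq> SSHT_upto N g"
  proof
    fix T assume T: "T \<in> Yam g"
    define w where "w = hook_word g T"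
    have dec: "num_count (Suc i) w \<le> num_count i w" if "i \<ge> 1" for i
      using T that unfolding Yam_def w_def by (metis (mono_tags, lifting) drop0 le0 mem_Collect_eq)
    have "num (T b) \<le> N" if b: "b \<in> shifted_diagram g" for b
    proof -
      let ?k = "num (T b)"
      have "T b \<in> set w" using hook_word_complete[OF assms b] by (simp add: w_def)
      then have k: "num_count ?k w > 0"
        unfolding num_count_def by (auto simp: filter_empty_conv)
      have down: "num_count ?k w \<le> num_count j w" if "1 \<le> j" "j \<le> ?k" for j
        using that(2)
      proof (induction rule: inc_induct)
        case (step i)
        then show ?case using dec[of i] that(1) by linarith
      qed simp
      have "{1..?k} \<subseteq> num ` set w"
      proof
        fix j assume "j \<in> {1..?k}"
        then have "num_count j w > 0" using down[of j] k by auto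
        then show "j \<in> num ` set w"
          unfolding num_count_def by (auto simp: filter_empty_conv)
      qed
      then have "?k \<le> card (num ` set w)"
        using card_mono[of "num ` set w" "{1..?k}"] by simp
      also have "\<dots> \<le> length w"
        using card_image_le[of "set w" num] card_length[of w] by simp
      also have "\<dots> \<le> N" unfolding w_def N_def by (rule length_hook_word_le)
      finally show ?thesis .
    qed
    then show "T \<in> SSHT_upto N g" using T by (auto simp: SSHT_upto_def Yam_def)
  qed
qed (rule finite_SSHT_upto[OF assms])

end

(*
  A standard Young tableau
  is a word of contents, each of which moves a particle of the Maya diagram one step to the right; a
  standard marked shifted tableau is a word whose letters y are doubled to -1-y, y. Moving the right
  halves of all doubled letters past the left halves (full) turns a shifted tableau into a word
  of a Young tableau with the same descents. The number of preimages of a word depends only on the shape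
  that it reaches, because elementary dual equivalences act on the shifted words compatibly. Hence
  P_gamma is a sum of Schur polynomials with multiplicities the numbers of preimages of the row-by-row
  words. The map also preserves the lattice property of consecutive letters, which for Young tableaux
  singles out the superstandard ones and for shifted tableaux is equivalent to the Yamanouchi condition
  on the hook reading word; so these preimages are counted by Yam(gamma).
*)
theory Submission
  imports Defs "HOL-Library.Product_Lexorder"
begin

text \<open>A letter of a Young word is the content (column minus row) less one, since the first box
  moves the particle at -1 of \<open>{..<0}\<close>. For a shifted box put k = column minus row; it
  is written as y = k if unmarked and as y = -1-k if marked. Both move the particles at k and at
  -1-k, so a mark only records the order of the two halves. For k = 0 a single particle makes both
  moves and the order -1, 0 is forced: this is the ban on marked diagonal entries. Semistandard
  tableaux are standard words with labels that must jump at descents, so both sides become sums of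
  fundamental quasisymmetric polynomials. The obstacle is that \<open>full\<close> is not visibly
  compatible with dual equivalence: on shifted words an elementary move sometimes exchanges letters
  and sometimes toggles marks. Compatibility appears once the half \<open>snd (full ys)\<close>,
  which lies outside the Young tableau, is kept too: the same elementary move acts at the same place
  of both halves. As \<open>full\<close> is injective and the move is an involution, fibres then
  inject into each other in both directions.\<close>

section \<open>Words of particle moves and the passing of labels\<close>

definition mv :: "int \<Rightarrow> int set \<Rightarrow> int set" where
  "mv c X = insert (c + 1) (X - {c})"

fun ok :: "int set \<Rightarrow> int list \<Rightarrow> bool" where
  "ok X [] \<longleftrightarrow> True"
| "ok X (c # w) \<longleftrightarrow> c \<in> X \<and> c + 1 \<notin> X \<and> ok (mv c X) w"

fun fin :: "int set \<Rightarrow> int list \<Rightarrow> int set" where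
  "fin X [] = X"
| "fin X (c # w) = fin (mv c X) w"

lemma fin_append [simp]: "fin X (v @ w) = fin (fin X v) w"
  by (induction v arbitrary: X) auto

lemma ok_append [simp]: "ok X (v @ w) \<longleftrightarrow> ok X v \<and> ok (fin X v) w"
  by (induction v arbitrary: X) auto

lemma mv_commute:
  assumes "\<bar>c - d\<bar> \<noteq> 1" "c \<noteq> d"
  shows "mv c (mv d X) = mv d (mv c X)"
  using assms by (auto simp: mv_def)

lemma ok_commute:
  assumes "\<bar>c - d\<bar> \<noteq> 1" "c \<noteq> d"
  shows "ok X (c # d # w) \<longleftrightarrow> ok X (d # c # w)"
proof -
  have "d \<in> mv c X \<longleftrightarrow> d \<in> X" "d + 1 \<in> mv c X \<longleftrightarrow> d + 1 \<in> X"
    "c \<in> mv d X \<longleftrightarrow> c \<in> X" "c + 1 \<in> mv d X \<longleftrightarrow> c + 1 \<in> X"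
    using assms by (auto simp: mv_def)
  then show ?thesis by (auto simp only: ok.simps mv_commute[OF assms])
qed

lemma fin_stay_out: "c \<notin> X \<Longrightarrow> c - 1 \<notin> set w \<Longrightarrow> c \<notin> fin X w"
  by (induction w arbitrary: X) (auto simp: mv_def)

lemma fin_stay_in: "c \<in> X \<Longrightarrow> c \<notin> set w \<Longrightarrow> c \<in> fin X w"
  by (induction w arbitrary: X) (auto simp: mv_def)

text \<open>Between two moves out of c, the particle that has arrived at c + 1 must leave and a new
  one must arrive from c - 1. This replaces the geometry of boxes: equal contents enclose both
  neighbouring ones.\<close>

lemma ok_between:
  assumes "ok X (c # w @ [c])"
  shows "c - 1 \<in> set w" "c + 1 \<in> set w"
proof -
  have X: "c \<notin> mv c X" "c + 1 \<in> mv c X" and f: "c \<in> fin (mv c X) w" "c + 1 \<notin> fin (mv c X) w"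
    using assms by (simp_all add: mv_def)
  show "c - 1 \<in> set w" using fin_stay_out[OF X(1)] f(1) by blast
  show "c + 1 \<in> set w" using fin_stay_in[OF X(2)] f(2) by blast
qed

text \<open>The label of a box moves past the label of the next box; the contents are exchanged only if
  the boxes are not adjacent.\<close>

fun pass :: "int \<Rightarrow> int list \<Rightarrow> int list \<times> int" where
  "pass m [] = ([], m)"
| "pass m (u # us) =
     (let a = (if \<bar>m - u\<bar> = 1 then m else u); (us', m') = pass (m + u - a) us in (a # us', m'))"

text \<open>Each step either leaves the word as it is and only changes which letter counts as
  carried, or exchanges two commuting letters. Equality m = u cannot occur, since position m is
  empty right after the move m.\<close>

lemma pass_ok:
  assumes "ok X (m # us)"
  shows "ok X (fst (pass m us) @ [snd (pass m us)])
    \<and> fin X (fst (pass m us) @ [snd (pass m us)]) = fin X (m # us)"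
  using assms
proof (induction us arbitrary: X m)
  case (Cons u us)
  show ?case
  proof (cases "\<bar>m - u\<bar> = 1")
    case True
    then show ?thesis using Cons.IH[of "mv m X" u] Cons.prems by (simp add: split_beta Let_def)
  next
    case False
    moreover have ne: "m \<noteq> u" using Cons.prems by (auto simp: mv_def)
    ultimately have "ok X (u # m # us)" "mv u (mv m X) = mv m (mv u X)"
      using Cons.prems ok_commute[of m u X us] mv_commute[of m u X] by auto
    then show ?thesis using Cons.IH[of "mv u X" m] False by (simp add: split_beta Let_def)
  qed
qed simp

lemma length_pass [simp]: "length (fst (pass m us)) = length us"
  by (induction us arbitrary: m) (auto simp: split_beta Let_def)

lemma pass_append:
  "pass m (us @ vs) = (fst (pass m us) @ fst (pass (snd (pass m us)) vs), snd (pass (snd (pass m us)) vs))"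
  by (induction us arbitrary: m) (auto simp: split_beta Let_def)

section \<open>Elementary dual equivalence commutes with passing\<close>

definition betw :: "int \<Rightarrow> int \<Rightarrow> int \<Rightarrow> bool" where
  "betw a x b \<longleftrightarrow> a < x \<and> x < b \<or> b < x \<and> x < a"

text \<open>Haiman's elementary dual equivalence, written on the contents of three boxes with
  consecutive labels. The exchanged contents have a third one strictly between them, so they differ
  by at least 2 and commute.\<close>

definition dual :: "int \<Rightarrow> int \<Rightarrow> int \<Rightarrow> int list" where
  "dual a b c = (if betw b a c then [a, c, b] else if betw a c b then [b, a, c] else [a, b, c])"

text \<open>The consequences of \<open>ok\<close> for four consecutive letters, obtained from
  \<open>ok_between\<close>: equal letters need both neighbours in between, hence cannot be closer
  than three places. The condition is invariant under reversal and under negation of all letters,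
  which \<open>ok\<close> itself is not.\<close>

definition fc4 :: "int \<Rightarrow> int \<Rightarrow> int \<Rightarrow> int \<Rightarrow> bool" where
  "fc4 m a b c \<longleftrightarrow> m \<noteq> a \<and> a \<noteq> b \<and> b \<noteq> c \<and> m \<noteq> b \<and> a \<noteq> c \<and>
     (m = c \<longrightarrow> a = m + 1 \<and> b = m - 1 \<or> a = m - 1 \<and> b = m + 1)"

lemma ok_distinct3:
  assumes "ok X (a # b # w)"
  shows "a \<noteq> b" "w = c # v \<Longrightarrow> a \<noteq> c"
proof -
  show "a \<noteq> b" using assms by (auto simp: mv_def)
  show "a \<noteq> c" if "w = c # v"
  proof
    assume "a = c"
    then have "ok X (a # [b] @ [a])" using assms that by simp
    from ok_between[OF this] show False by simp
  qed
qed

lemma ok_fc4: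
  assumes "ok X [m, a, b, c]"
  shows "fc4 m a b c"
proof -
  have "m \<noteq> a" "m \<noteq> b" using ok_distinct3[of X m a "[b, c]"] assms by simp_all
  moreover have "a \<noteq> b" "a \<noteq> c"
    using ok_distinct3[of "mv m X" a b "[c]"] assms by (simp_all del: ok.simps(2) add: ok.simps(2)[of X m])
  moreover have "b \<noteq> c"
    using ok_distinct3[of "mv a (mv m X)" b c "[]"] assms
    by (simp add: ok.simps(2)[of X m] ok.simps(2)[of "mv m X" a] del: ok.simps(2))
  moreover have "m - 1 \<in> {a, b}" "m + 1 \<in> {a, b}" if "m = c"
    using ok_between[of X m "[a, b]"] assms that by (simp_all del: ok.simps(2))
  ultimately show ?thesis unfolding fc4_def by auto
qed

lemma fc4_rev: "fc4 m a b c \<longleftrightarrow> fc4 c b a m"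
  unfolding fc4_def by auto


definition adj :: "int \<Rightarrow> int \<Rightarrow> bool" where "adj a b \<longleftrightarrow> a = b + 1 \<or> b = a + 1"

lemma pass_Cons:
  "pass m (u # us) = (if adj m u then (m # fst (pass u us), snd (pass u us))
                      else (u # fst (pass m us), snd (pass m us)))"
  by (auto simp: adj_def Let_def split_beta)

declare pass.simps(2) [simp del]

lemma adj_sym: "adj a b \<longleftrightarrow> adj b a" by (auto simp: adj_def)
lemma adj_simps [simp]: "adj (a + 1) a" "adj a (a + 1)" "\<not> adj a a" "adj (a - 1) a" "adj a (a - 1)" by (auto simp: adj_def)

text \<open>The value a, read first, is in the middle. By \<open>fc4\<close>, the letter carried
  when b and c are met is adjacent to at most one of them. As b and c commute, their order then only
  decides the order in which their images are emitted, and the final carry is the same.\<close>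

lemma leaf1:
  assumes "fc4 m a b c" "b < a" "a < c"
  shows "\<exists>p q r m'. pass m [a, b, c] = ([p, q, r], m') \<and> pass m [a, c, b] = ([p, r, q], m') \<and> q < p \<and> p < r"
proof (cases "adj m a")
  case True
  have ne: "m \<noteq> b" "m = c \<Longrightarrow> b = a - 2 \<or> b = a + 2" "m \<noteq> a" using assms by (auto simp: fc4_def)
  have bc: "\<not> adj b c" using assms by (auto simp: adj_def)
  consider "b = a - 1" "c \<noteq> a + 1" "m = a + 1" | "c = a + 1" "b \<noteq> a - 1" "m = a - 1 \<or> m = a + 1" | "b \<noteq> a - 1" "c \<noteq> a + 1"
    using True ne assms(2,3) unfolding adj_def by linarith
  then show ?thesis
  proof cases
    case 1
    then have "\<not> adj a c" "\<not> adj (a - 1) c" using assms by (auto simp: adj_def)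
    then show ?thesis using 1 assms by (simp add: pass_Cons)
  next
    case 2
    then have "\<not> adj a b" "\<not> adj (a + 1) b" using assms by (auto simp: adj_def)
    moreover have "m = a - 1" using 2 assms by (auto simp: fc4_def)
    ultimately show ?thesis using 2 True assms by (simp add: pass_Cons)
  next
    case 3
    then have "\<not> adj a b" "\<not> adj a c" using assms by (auto simp: adj_def)
    moreover have "b < m" "m < c" using True 3 assms unfolding adj_def by linarith+
    ultimately show ?thesis using 3 True assms by (simp add: pass_Cons)
  qed
next
  case False
  have ne: "m \<noteq> b" "m \<noteq> a" using assms by (auto simp: fc4_def)
  consider "adj m b" "\<not> adj m c" | "\<not> adj m b" "adj m c" | "\<not> adj m b" "\<not> adj m c"
    using False ne assms unfolding adj_def by linarith
  then show ?thesis
  proof cases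
    case 1
    then have "\<not> adj b c" "m < a" using False assms ne by (auto simp: adj_def)
    then show ?thesis using 1 False assms by (simp add: pass_Cons)
  next
    case 2
    then have "\<not> adj c b" "a < m" using False assms ne by (auto simp: adj_def)
    then show ?thesis using 2 False assms by (simp add: pass_Cons)
  next
    case 3
    then show ?thesis using False assms by (simp add: pass_Cons)
  qed
qed

text \<open>The value c, read last, is in the middle. If m is adjacent to both a and b, then m = c =
  a + 1 = b - 1 and the exchange moves from the first two to the last two emitted letters; in all
  other cases it stays in place. Hence the disjunction in the conclusion.\<close>

lemma leaf2:
  assumes "fc4 m a b c" "a < c" "c < b"
  shows "\<exists>p q r m'. pass m [a, b, c] = ([p, q, r], m') \<and>
    (pass m [b, a, c] = ([q, p, r], m') \<and> betw p r q \<or> pass m [b, a, c] = ([p, r, q], m') \<and> betw q p r)"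
proof -
  have ne: "m \<noteq> b" "m \<noteq> a" "m = c \<Longrightarrow> a = m - 1 \<and> b = m + 1" using assms by (auto simp: fc4_def)
  have ab: "\<not> adj a b" "\<not> adj b a" using assms by (auto simp: adj_def)
  show ?thesis
  proof (cases "adj m a")
    case True
    show ?thesis
    proof (cases "adj m b")
      case b: True
      then have "m = a + 1" "b = a + 2" "c = a + 1" using True assms unfolding adj_def by linarith+
      moreover have "adj (2 + a) (1 + a)" "adj (a + 2) (a + 1)" "\<not> adj (a + 2) a" "\<not> adj a (a + 2)" "adj (a + 1) (a + 2)" by (auto simp: adj_def)
      ultimately show ?thesis by (auto simp: pass_Cons betw_def)
    next
      case b: False
      show ?thesis
      proof (cases "adj a c")
        case True
        then have c: "c = a + 1" using assms by (auto simp: adj_def)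
        have "m \<noteq> a + 1" using ne(3) c b by (auto simp: adj_def)
        then have "m = a - 1" using \<open>adj m a\<close> by (auto simp: adj_def)
        then show ?thesis using c b ab assms by (auto simp: pass_Cons betw_def)
      next
        case False
        have "m < c" using \<open>adj m a\<close> False assms unfolding adj_def by linarith
        then show ?thesis using False True b ab assms by (auto simp: pass_Cons betw_def)
      qed
    qed
  next
    case a: False
    show ?thesis
    proof (cases "adj m b")
      case True
      show ?thesis
      proof (cases "adj b c")
        case bc: True
        then have c: "c = b - 1" using assms by (auto simp: adj_def)
        have "m \<noteq> b - 1" using ne(3) c a by (auto simp: adj_def)
        then have "m = b + 1" using \<open>adj m b\<close> by (auto simp: adj_def)
        then show ?thesis using c a ab assms by (auto simp: pass_Cons betw_def)
      next
        case False
        have "c < m" using \<open>adj m b\<close> False assms unfolding adj_def by linarith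
        then show ?thesis using False True a ab assms by (auto simp: pass_Cons betw_def)
      qed
    next
      case b: False
      show ?thesis
      proof (cases "adj m c")
        case True
        have "a < m" "m < b" using True a b ne assms unfolding adj_def by linarith+
        then show ?thesis using a b ab True assms by (auto simp: pass_Cons betw_def)
      next
        case False
        then show ?thesis using a b ab assms by (auto simp: pass_Cons betw_def)
      qed
    qed
  qed
qed

lemma pass_uminus:
  "pass (- m) (map uminus us) = (map uminus (fst (pass m us)), - snd (pass m us))"
proof (induction us arbitrary: m)
  case (Cons u us)
  have "adj (- m) (- u) \<longleftrightarrow> adj m u" by (auto simp: adj_def)
  then show ?case using Cons.IH[of u] Cons.IH[of m] by (simp add: pass_Cons)
qed simp

lemma pass_mono2:
  assumes "m \<noteq> a" "a \<noteq> b" "m \<noteq> b"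
  shows "\<exists>p q m'. pass m [a, b] = ([p, q], m') \<and> (p < q \<longleftrightarrow> a < b) \<and> p \<noteq> q"
proof (cases "adj m a")
  case True
  show ?thesis
    by (cases "adj a b") (use True assms in \<open>auto simp: pass_Cons adj_def\<close>)
next
  case False
  show ?thesis
    by (cases "adj m b") (use False assms in \<open>auto simp: pass_Cons adj_def\<close>)
qed

text \<open>Up to negation of all contents, the middle value stands first, last or in the middle.
  The first two cases are \<open>leaf1\<close> and \<open>leaf2\<close>. In the third,
  \<open>dual\<close> is the identity, and the point is that a monotone triple is emitted as a
  monotone triple.\<close>

lemma pass_dual_cases:
  assumes "fc4 m a b c"
  shows "\<exists>p q r m'. pass m [a, b, c] = ([p, q, r], m') \<and>
    (dual a b c = [a, b, c] \<and> dual p q r = [p, q, r]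
     \<or> dual a b c = [a, c, b] \<and> pass m [a, c, b] = ([p, r, q], m') \<and> betw q p r
     \<or> dual a b c = [b, a, c] \<and> pass m [b, a, c] = ([p, r, q], m') \<and> betw q p r
     \<or> dual a b c = [b, a, c] \<and> pass m [b, a, c] = ([q, p, r], m') \<and> betw p r q)"
proof -
  have d: "distinct [a, b, c]" using assms by (auto simp: fc4_def)
  have fc': "fc4 (- m) (- a) (- b) (- c)" using assms by (auto simp: fc4_def)
  have neg: "pass m [a, b, c] = ([- p, - q, - r], - m')"
    if "pass (- m) [- a, - b, - c] = ([p, q, r], m')" for a b c p q r m'
    using pass_uminus[of "- m" "[- a, - b, - c]"] that by simp
  consider "b < a" "a < c" | "c < a" "a < b" | "a < c" "c < b" | "b < c" "c < a"
    | "a < b" "b < c" | "c < b" "b < a"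
    using d by fastforce
  then show ?thesis
  proof cases
    case 1
    then have "dual a b c = [a, c, b]" by (simp add: dual_def betw_def)
    moreover obtain p q r m' where
      "pass m [a, b, c] = ([p, q, r], m')" "pass m [a, c, b] = ([p, r, q], m')" "q < p" "p < r"
      using leaf1[OF assms 1] by (elim exE conjE) (rule that)
    ultimately show ?thesis
      by (intro exI[of _ p] exI[of _ q] exI[of _ r] exI[of _ m']) (simp add: betw_def)
  next
    case 2
    then have "dual a b c = [a, c, b]" by (simp add: dual_def betw_def)
    moreover obtain p q r m' where
      "pass (- m) [- a, - b, - c] = ([p, q, r], m')" "pass (- m) [- a, - c, - b] = ([p, r, q], m')"
      "q < p" "p < r" using leaf1[OF fc'] 2 by (auto elim!: exE)
    ultimately show ?thesis using neg[of a b c p q r m'] neg[of a c b p r q m']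
      by (intro exI[of _ "- p"] exI[of _ "- q"] exI[of _ "- r"] exI[of _ "- m'"]) (simp add: betw_def)
  next
    case 3
    then have "dual a b c = [b, a, c]" by (auto simp: dual_def betw_def)
    moreover obtain p q r m' where "pass m [a, b, c] = ([p, q, r], m') \<and>
      (pass m [b, a, c] = ([q, p, r], m') \<and> betw p r q \<or> pass m [b, a, c] = ([p, r, q], m') \<and> betw q p r)"
      using leaf2[OF assms 3] by (elim exE) (rule that)
    ultimately show ?thesis
      by (intro exI[of _ p] exI[of _ q] exI[of _ r] exI[of _ m']) blast
  next
    case 4
    then have "dual a b c = [b, a, c]" by (auto simp: dual_def betw_def)
    moreover have neg4: "- a < - c" "- c < - b" using 4 by auto
    moreover from leaf2[OF fc' neg4] obtain p q r m' where
      "pass (- m) [- a, - b, - c] = ([p, q, r], m') \<and>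
      (pass (- m) [- b, - a, - c] = ([q, p, r], m') \<and> betw p r q
       \<or> pass (- m) [- b, - a, - c] = ([p, r, q], m') \<and> betw q p r)"
      by (elim exE) (rule that)
    moreover have "betw (- x) (- y) (- z) \<longleftrightarrow> betw x y z" for x y z by (auto simp: betw_def)
    ultimately show ?thesis using neg[of a b c p q r m'] neg[of b a c q p r m'] neg[of b a c p r q m']
      by (intro exI[of _ "- p"] exI[of _ "- q"] exI[of _ "- r"] exI[of _ "- m'"]) blast
  next
    case 5
    obtain p q m1 where 1: "pass m [a, b] = ([p, q], m1)" "p < q"
      using pass_mono2[of m a b] assms 5 by (auto simp: fc4_def)
    have m1: "m1 = m \<or> m1 = a \<or> m1 = b" using 1 by (auto simp: pass_Cons split: if_splits)
    obtain r m' where 2: "pass m1 [c] = ([r], m')" by (cases "adj m1 c") (simp_all add: pass_Cons)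
    \<comment> \<open>The letter x carried after a meets b and c next, so \<open>pass_mono2\<close>
      applies once more, one place to the right.\<close>
    have "q < r"
    proof -
      obtain x where x: "pass m [a] = ([p], x)" "pass x [b] = ([q], m1)" "x = m \<or> x = a"
        using 1 by (auto simp: pass_Cons split: if_splits)
      then have "x \<noteq> b" "x \<noteq> c" using assms 5 by (auto simp: fc4_def)
      with pass_mono2[of x b c] x 2 5 show ?thesis by (auto simp: pass_Cons split: if_splits)
    qed
    moreover have "pass m [a, b, c] = ([p, q, r], m')" using pass_append[of m "[a, b]" "[c]"] 1 2 by simp
    ultimately show ?thesis using 1 5 by (auto simp: dual_def betw_def)
  next
    case 6
    obtain p q m1 where 1: "pass m [a, b] = ([p, q], m1)" "q < p"
      using pass_mono2[of m a b] assms 6 by (auto simp: fc4_def)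
    obtain r m' where 2: "pass m1 [c] = ([r], m')" by (cases "adj m1 c") (simp_all add: pass_Cons)
    have "r < q"
    proof -
      obtain x where x: "pass m [a] = ([p], x)" "pass x [b] = ([q], m1)" "x = m \<or> x = a"
        using 1 by (auto simp: pass_Cons split: if_splits)
      then have "x \<noteq> b" "x \<noteq> c" using assms 6 by (auto simp: fc4_def)
      with pass_mono2[of x b c] x 2 6 show ?thesis by (auto simp: pass_Cons split: if_splits)
    qed
    moreover have "pass m [a, b, c] = ([p, q, r], m')" using pass_append[of m "[a, b]" "[c]"] 1 2 by simp
    ultimately show ?thesis using 1 6 by (auto simp: dual_def betw_def)
  qed
qed

lemma pass_dual:
  assumes "fc4 m a b c"
  shows "\<exists>p q r m'. pass m [a, b, c] = ([p, q, r], m') \<and> pass m (dual a b c) = (dual p q r, m')"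
proof -
  have "betw q p r \<Longrightarrow> dual p q r = [p, r, q]" "betw p r q \<Longrightarrow> dual p q r = [q, p, r]" for p q r
    by (auto simp: dual_def betw_def)
  then show ?thesis using pass_dual_cases[OF assms] by fastforce
qed

text \<open>Each local step is its own inverse when read from the right, because adjacency is
  symmetric.\<close>

lemma pass_rev:
  "pass m us = (us', m') \<Longrightarrow> pass m' (rev us') = (rev us, m)"
proof (induction us arbitrary: m us')
  case (Cons u us)
  then show ?case
    by (cases "pass u us"; cases "pass m us")
       (auto simp: pass_Cons pass_append adj_sym split: if_splits)
qed simp

lemma dual_rev: "dual c b a = rev (dual a b c)"
  by (auto simp: dual_def betw_def)

section \<open>From shifted words to words: three consecutive letters\<close>

text \<open>The recursion starts at the right end: the left half of y travels past its own right
  half and then past everything already emitted by the later letters. The carries that come out are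
  stored in the second component, which is what makes the map invertible.\<close>

fun full :: "int list \<Rightarrow> int list \<times> int list" where
  "full [] = ([], [])"
| "full (y # ys) = (fst (pass (- 1 - y) (y # fst (full ys))), snd (pass (- 1 - y) (y # fst (full ys))) # snd (full ys))"

definition dbl :: "int list \<Rightarrow> int list" where
  "dbl ys = concat (map (\<lambda>y. [- 1 - y, y]) ys)"

lemma dbl_simps [simp]: "dbl [] = []" "dbl (y # ys) = (- 1 - y) # y # dbl ys" "dbl (xs @ ys) = dbl xs @ dbl ys"
  by (auto simp: dbl_def)

lemma full_ok:
  assumes "ok X (dbl ys)"
  shows "ok X (fst (full ys) @ snd (full ys)) \<and> fin X (fst (full ys) @ snd (full ys)) = fin X (dbl ys)"
  using assms
proof (induction ys arbitrary: X)
  case (Cons y ys)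
  let ?X = "mv y (mv (- 1 - y) X)"
  have 1: "ok ?X (fst (full ys) @ snd (full ys))" "fin ?X (fst (full ys) @ snd (full ys)) = fin ?X (dbl ys)"
    using Cons.IH[of ?X] Cons.prems by auto
  have "ok X ((- 1 - y) # y # fst (full ys))" using 1(1) Cons.prems by auto
  from pass_ok[OF this] 1 show ?case by auto
qed simp

lemma length_full [simp]: "length (fst (full ys)) = length ys" "length (snd (full ys)) = length ys"
  by (induction ys) auto

text \<open>By \<open>pass_rev\<close>, the emitted word and the final carry determine the word that
  was passed over, and the head of that word is the first letter.\<close>

lemma full_inj: "full xs = full ys \<Longrightarrow> xs = ys"
proof (induction xs arbitrary: ys)
  case Nil
  then show ?case by (cases ys) auto
next
  case (Cons x xs)
  then obtain y zs where ys: "ys = y # zs" by (cases ys) auto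
  have "pass (- 1 - x) (x # fst (full xs)) = pass (- 1 - y) (y # fst (full zs))"
    using Cons.prems ys by (simp add: prod_eq_iff)
  then have "rev (x # fst (full xs)) = rev (y # fst (full zs))"
    using pass_rev[of "- 1 - x" "x # fst (full xs)"] pass_rev[of "- 1 - y" "y # fst (full zs)"]
    by (metis prod.collapse fst_conv)
  then show ?case using Cons.IH[of zs] Cons.prems ys by (simp add: prod_eq_iff)
qed

text \<open>When \<open>- 1 - y\<close> passes its own right half y, \<open>self y\<close> is
  emitted and \<open>mself y\<close> is carried on. They differ from y and \<open>- 1 - y\<close>
  only for y = 0 and y = -1, where the two halves are adjacent.\<close>

definition self :: "int \<Rightarrow> int" where
  "self y = (if y = 0 then -1 else if y = -1 then 0 else y)"
definition mself :: "int \<Rightarrow> int" where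
  "mself y = (if y = 0 then 0 else if y = -1 then -1 else -1 - y)"

lemma mself_between:
  assumes "y2 < y1" "y1 < y3" "y1 \<noteq> -1 - y2" "y1 \<noteq> -1 - y3"
  shows "mself y3 < mself y1" "mself y1 < mself y2"
  using assms by (auto simp: mself_def)

text \<open>For the second halves: if the carry \<open>mself y1\<close> meets an adjacent letter u
  emitted by y2 or y3, then u becomes the new carry. It must still lie between
  \<open>mself y3\<close> and \<open>mself y2\<close>, so that \<open>dual\<close> exchanges these
  two carries as well.\<close>

lemma adj_self_between:
  assumes y: "y2 < y1" "y1 < y3" and k: "y1 \<noteq> -1 - y2" "y1 \<noteq> -1 - y3" "y2 \<noteq> -1 - y3"
    and a: "adj (mself y1) u" "u = self y2 \<or> u = self y3"
  shows "mself y3 < u" "u < mself y2"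
proof -
  consider "y1 = 0" | "y1 = -1" | "y2 = 0 \<or> y2 = -1" | "y3 = 0 \<or> y3 = -1"
    | "y1 \<noteq> 0" "y2 \<noteq> 0" "y3 \<noteq> 0" "y1 \<noteq> -1" "y2 \<noteq> -1" "y3 \<noteq> -1" by blast
  then have "mself y3 < u \<and> u < mself y2"
  proof cases
    case 1
    then have "y2 < -1" "0 < y3" using y k by auto
    moreover from this have "u = self y3 \<and> y3 = 1"
      using a 1 by (auto simp: adj_def self_def mself_def split: if_splits)
    ultimately show ?thesis using 1 k by (simp add: self_def mself_def)
  next
    case 2
    then have "y2 < -1" "0 < y3" using y k by auto
    moreover from this have "u = self y2 \<and> y2 = -2"
      using a 2 by (auto simp: adj_def self_def mself_def split: if_splits)
    ultimately show ?thesis using 2 k by (simp add: self_def mself_def)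
  next
    case 3
    then have "0 < y1" "1 < y3" using y k by auto
    moreover from this have "u = self y2 \<and> y2 = 0"
      using a 3 by (auto simp: adj_def self_def mself_def split: if_splits)
    ultimately show ?thesis by (simp add: self_def mself_def)
  next
    case 4
    then have "y1 < -1" "y2 < -2" using y k by auto
    moreover from this have "u = self y3 \<and> y3 = -1"
      using a 4 by (auto simp: adj_def self_def mself_def split: if_splits)
    ultimately show ?thesis by (simp add: self_def mself_def)
  next
    case 5
    from a(2) show ?thesis
    proof
      assume u: "u = self y2"
      then have "y1 = - y2 \<or> y1 = - 2 - y2" using a(1) 5 by (auto simp: adj_def self_def mself_def)
      then have "y1 \<ge> - 2 - y2" "y2 < 0" using y 5 by linarith+
      then have "y3 > - 1 - y2" "y2 < - 1" using y k 5 by linarith+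
      then show ?thesis using u 5 y by (simp add: self_def mself_def)
    next
      assume u: "u = self y3"
      then have "y1 = - y3 \<or> y1 = - 2 - y3" using a(1) 5 by (auto simp: adj_def self_def mself_def)
      then have "y1 \<le> - y3" "y3 > 0" using y 5 by linarith+
      then have "y2 < - 1 - y3" using y k by linarith
      then show ?thesis using u 5 y \<open>y3 > 0\<close> by (simp add: self_def mself_def)
    qed
  qed
  then show "mself y3 < u" "u < mself y2" by auto
qed

lemma pass_self:
  "pass (- 1 - y) (y # us) = (self y # fst (pass (mself y) us), snd (pass (mself y) us))"
proof -
  have "adj (- 1 - y) y \<longleftrightarrow> y = 0 \<or> y = -1" by (auto simp: adj_def)
  then show ?thesis by (auto simp: pass_Cons self_def mself_def)
qed

lemma snd_pass2:
  "snd (pass m [c, d]) = (if adj m c then (if adj c d then d else c) else if adj m d then d else m)"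
  by (simp add: pass_Cons)

lemma pass1: "\<not> adj m u \<Longrightarrow> pass m [u] = ([u], m)" "adj m u \<Longrightarrow> pass m [u] = ([m], u)"
  by (simp_all add: pass_Cons)

lemma pass_between:
  assumes fc: "fc4 m a b c" and b: "betw b a c"
  shows "\<exists>p q r m'. pass m [a, b, c] = ([p, q, r], m') \<and> pass m [a, c, b] = ([p, r, q], m') \<and> betw q p r"
proof (cases "b < a")
  case True
  then have "a < c" using b by (auto simp: betw_def)
  from leaf1[OF fc True this] show ?thesis unfolding betw_def by (elim exE conjE) (intro exI conjI, assumption+, auto)
next
  case False
  then have "- b < - a" "- a < - c" using b by (auto simp: betw_def)
  moreover have "fc4 (- m) (- a) (- b) (- c)" using fc by (auto simp: fc4_def)
  ultimately obtain p q r m' where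
    1: "pass (- m) [- a, - b, - c] = ([p, q, r], m')" "pass (- m) [- a, - c, - b] = ([p, r, q], m')"
      "q < p" "p < r" using leaf1 by blast
  have "pass m [a, b, c] = ([- p, - q, - r], - m')" "pass m [a, c, b] = ([- p, - r, - q], - m')"
    using pass_uminus[of "- m" "[- a, - b, - c]"] pass_uminus[of "- m" "[- a, - c, - b]"] 1 by simp_all
  moreover have "betw (- q) (- p) (- r)" using 1 by (auto simp: betw_def)
  ultimately show ?thesis by blast
qed

text \<open>What \<open>ok\<close> leaves possible for three consecutive shifted letters. A letter
  is repeated only in passing from a diagonal box to the next one, with a box of letter 1 or -2 in
  between, as in the shape (2,1). The mirror value -1 is excluded later by
  \<open>zero_notin\<close>.\<close>

definition letters3 :: "int \<Rightarrow> int \<Rightarrow> int \<Rightarrow> bool" where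
  "letters3 y1 y2 y3 \<longleftrightarrow> y1 \<noteq> y2 \<and> y1 \<noteq> -1 - y2 \<and> y2 \<noteq> y3 \<and> y2 \<noteq> -1 - y3 \<and> y1 \<noteq> -1 - y3
     \<and> (y1 = y3 \<longrightarrow> (y1 = 0 \<or> y1 = -1) \<and> (y2 = 1 \<or> y2 = -2))"

lemma full_pair_swap:
  assumes "y2 \<noteq> y3" "y2 \<noteq> -1 - y3" "y2 + y3 \<noteq> 0" "y2 + y3 \<noteq> -2" "y3 \<noteq> y2 + 1" "y2 \<noteq> y3 + 1"
  shows "full [y2, y3] = ([self y2, self y3], [mself y2, mself y3])"
proof -
  have "\<not> adj (mself y2) (self y3)" using assms by (auto simp: adj_def self_def mself_def)
  then show ?thesis by (simp add: pass_self pass1)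
qed

text \<open>The underlying boxes lie on neighbouring diagonals, one marked and one not, so the
  doubled letters do not commute. The carry \<open>- 1 - y2\<close> is adjacent to y3 and is emitted
  in its place. Toggling both marks therefore exchanges the two entries of each half, and takes over
  the role of an exchange of y2 and y3.\<close>

lemma full_pair_flip:
  assumes "y2 \<noteq> -1" "y2 \<noteq> 0" "y3 \<noteq> -1" "y3 \<noteq> 0" "y2 + y3 = 0 \<or> y2 + y3 = -2"
  shows "full [y2, y3] = ([y2, - 1 - y2], [y3, - 1 - y3])"
proof -
  have "adj (- 1 - y2) y3" using assms by (auto simp: adj_def)
  then show ?thesis using assms(1-4) by (simp add: pass_self self_def mself_def pass1)
qed

text \<open>What lies between y2 and y3 must lie between the letters that replace them, and likewise
  for the carries. The intervals shrink by one at an end; the values of y1 excluded by the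
  hypotheses are the ones at that boundary.\<close>

lemma flip_between:
  assumes b: "betw y2 y1 y3" and k: "y1 \<noteq> -1 - y2" "y1 \<noteq> -1 - y3"
    and nz: "y2 \<noteq> 0" "y2 \<noteq> -1" "y3 \<noteq> 0" "y3 \<noteq> -1" and s: "y2 + y3 = 0 \<or> y2 + y3 = -2"
  shows "betw y2 y1 (- 1 - y2)" "betw y3 (mself y1) (- 1 - y3)"
    "adj (mself y1) y2 \<Longrightarrow> betw y3 y2 (- 1 - y3)"
    "adj (mself y1) (- 1 - y2) \<Longrightarrow> betw y3 (- 1 - y2) (- 1 - y3)"
proof -
  consider "y3 = - y2" "y2 > 0" | "y3 = - y2" "y2 < - 1" | "y3 = - 2 - y2" "y2 > 0" | "y3 = - 2 - y2" "y2 < - 1"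
    using s nz by linarith
  then have "betw y2 y1 (- 1 - y2) \<and> betw y3 (mself y1) (- 1 - y3) \<and>
    (adj (mself y1) y2 \<longrightarrow> betw y3 y2 (- 1 - y3)) \<and>
    (adj (mself y1) (- 1 - y2) \<longrightarrow> betw y3 (- 1 - y2) (- 1 - y3))"
  proof cases
    case 1
    then have "- y2 < y1" "y1 < y2" "y1 \<noteq> y2 - 1" using b k(2) by (auto simp: betw_def)
    then have "- y2 < y1" "y1 < y2 - 1" by linarith+
    then show ?thesis using 1 by (auto simp: betw_def adj_def mself_def)
  next
    case 2
    then have "y2 < y1" "y1 < - y2" "y1 \<noteq> - y2 - 1" using b k(1) by (auto simp: betw_def)
    then have "y2 < y1" "y1 < - y2 - 1" by linarith+
    then show ?thesis using 2 by (auto simp: betw_def adj_def mself_def)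
  next
    case 3
    then have "- 2 - y2 < y1" "y1 < y2" "y1 \<noteq> - 1 - y2" using b k(1) by (auto simp: betw_def)
    then have "- 1 - y2 < y1" "y1 < y2" by linarith+
    then show ?thesis using 3 by (auto simp: betw_def adj_def mself_def)
  next
    case 4
    then have "y2 < y1" "y1 < - 2 - y2" "y1 \<noteq> y2 + 1" using b k(2) by (auto simp: betw_def)
    then have "y2 + 1 < y1" "y1 < - 2 - y2" by linarith+
    then show ?thesis using 4 by (auto simp: betw_def adj_def mself_def)
  qed
  then show "betw y2 y1 (- 1 - y2)" "betw y3 (mself y1) (- 1 - y3)"
    "adj (mself y1) y2 \<Longrightarrow> betw y3 y2 (- 1 - y3)"
    "adj (mself y1) (- 1 - y2) \<Longrightarrow> betw y3 (- 1 - y2) (- 1 - y3)" by auto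
qed

lemma full_Cons2:
  assumes "full [y2, y3] = ([c, d], [s, t])"
  shows "full [y1, y2, y3] = (fst (pass (- 1 - y1) [y1, c, d]), [snd (pass (- 1 - y1) [y1, c, d]), s, t])"
  using assms by (auto simp: prod_eq_iff)

text \<open>The modified pair z2, z3 yields both halves of y2, y3 with their entries exchanged. Then
  the left half of y1 passes y1 and the two emitted letters; by \<open>pass_between\<close> the
  exchange survives and the carry does not change. The hypothesis on \<open>fc4\<close> stands in
  for \<open>ok\<close>, so that the lemma can also be applied to the reversed word.\<close>

lemma full_dual_right:
  assumes L: "letters3 y1 y2 y3" and b: "betw y2 y1 y3"
    and fc: "\<And>c d s t. full [y2, y3] = ([c, d], [s, t]) \<Longrightarrow> fc4 (- 1 - y1) y1 c d"
    and z: "(z2, z3) = (if y2 + y3 = 0 \<or> y2 + y3 = -2 then (- 1 - y2, - 1 - y3) else (y3, y2))"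
  shows "\<exists>a b c s t v. full [y1, y2, y3] = ([a, b, c], [s, t, v]) \<and> full [y1, z2, z3] = (dual a b c, dual s t v)"
proof -
  have y: "y1 \<noteq> y2" "y1 \<noteq> -1 - y2" "y2 \<noteq> y3" "y2 \<noteq> -1 - y3" "y1 \<noteq> -1 - y3" "y3 \<noteq> -1 - y2"
    using L by (auto simp: letters3_def)
  obtain c d s t where
    f: "full [y2, y3] = ([c, d], [s, t])" "full [z2, z3] = ([d, c], [t, s])"
    and bt: "betw c y1 d" "betw s (snd (pass (- 1 - y1) [y1, c, d])) t"
  proof (cases "y2 + y3 = 0 \<or> y2 + y3 = -2")
    case True
    have nz: "y2 \<noteq> 0" "y2 \<noteq> -1" "y3 \<noteq> 0" "y3 \<noteq> -1" using True b y(2,5) unfolding betw_def by presburger+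
    have z': "z2 = - 1 - y2" "z3 = - 1 - y3" using z True by auto
    have 1: "full [y2, y3] = ([y2, - 1 - y2], [y3, - 1 - y3])" by (rule full_pair_flip) (use nz True in auto)
    have 2: "full [z2, z3] = ([- 1 - y2, y2], [- 1 - y3, y3])"
      using full_pair_flip[of z2 z3] nz True z' by auto
    note fb = flip_between[OF b y(2,5) nz True]
    have nadj: "\<not> adj y2 (- 1 - y2)" using nz by (auto simp: adj_def)
    have eq: "snd (pass (- 1 - y1) [y1, y2, - 1 - y2]) =
       (if adj (mself y1) y2 then y2 else if adj (mself y1) (- 1 - y2) then - 1 - y2 else mself y1)"
      using nadj by (simp add: pass_self snd_pass2)
    have "betw y3 (snd (pass (- 1 - y1) [y1, y2, - 1 - y2])) (- 1 - y3)" using eq fb by auto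
    then show ?thesis using that 1 2 fb(1) by blast
  next
    case False
    then have z': "z2 = y3" "z3 = y2" using z by auto
    have ne: "y3 \<noteq> y2 + 1" "y2 \<noteq> y3 + 1" using b by (auto simp: betw_def)
    have 1: "full [y2, y3] = ([self y2, self y3], [mself y2, mself y3])"
      by (rule full_pair_swap) (use y False ne in auto)
    have 2: "full [z2, z3] = ([self y3, self y2], [mself y3, mself y2])"
      unfolding z' by (rule full_pair_swap) (use y False ne in auto)
    have 3: "betw (self y2) y1 (self y3)" using b y(2,5) by (auto simp: betw_def self_def)
    have nadj: "\<not> adj (self y2) (self y3)" using y(3,4) ne False by (auto simp: adj_def self_def)
    have eq: "snd (pass (- 1 - y1) [y1, self y2, self y3]) = (if adj (mself y1) (self y2) then self y2
        else if adj (mself y1) (self y3) then self y3 else mself y1)"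
      using nadj by (simp add: pass_self snd_pass2)
    have "betw (mself y2) (snd (pass (- 1 - y1) [y1, self y2, self y3])) (mself y3)"
    proof (cases "y2 < y1")
      case True
      then have o: "y2 < y1" "y1 < y3" using b by (auto simp: betw_def)
      show ?thesis using eq mself_between[OF o y(2,5)] adj_self_between[OF o y(2,5,4)]
        by (auto simp: betw_def)
    next
      case False
      then have o: "y3 < y1" "y1 < y2" using b by (auto simp: betw_def)
      show ?thesis using eq mself_between[OF o y(5,2)] adj_self_between[OF o y(5,2,6)]
        by (auto simp: betw_def)
    qed
    then show ?thesis using that 1 2 3 by blast
  qed
  have fc': "fc4 (- 1 - y1) y1 c d" using fc f(1) by blast
  obtain p q r m' where 1: "pass (- 1 - y1) [y1, c, d] = ([p, q, r], m')"
    "pass (- 1 - y1) [y1, d, c] = ([p, r, q], m')" "betw q p r"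
    using pass_between[OF fc' bt(1)] by blast
  have "full [y1, y2, y3] = ([p, q, r], [m', s, t])"
    using full_Cons2[OF f(1), of y1] 1 by simp
  \<comment> \<open>The carry m' lies between s and t, so \<open>dual\<close> exchanges just these
    two.\<close>
  moreover have "full [y1, z2, z3] = (dual p q r, dual m' s t)"
    using full_Cons2[OF f(2), of y1] 1 bt(2) by (auto simp: dual_def betw_def)
  ultimately show ?thesis by blast
qed

lemma ok_fin_swap:
  assumes "\<bar>c - d\<bar> \<noteq> 1" "c \<noteq> d"
  shows "ok X (u @ c # d # w) \<longleftrightarrow> ok X (u @ d # c # w)" "fin X (u @ c # d # w) = fin X (u @ d # c # w)"
  using ok_commute[OF assms, of "fin X u" w] mv_commute[OF assms, of "fin X u"] by auto

lemma letter_swap: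
  assumes "\<bar>a - b\<bar> \<noteq> 1" "a \<noteq> b" "\<bar>a + b + 1\<bar> \<noteq> 1" "a + b \<noteq> -1"
  shows "ok X (u @ (- 1 - a) # a # (- 1 - b) # b # w) \<longleftrightarrow> ok X (u @ (- 1 - b) # b # (- 1 - a) # a # w)"
    "fin X (u @ (- 1 - a) # a # (- 1 - b) # b # w) = fin X (u @ (- 1 - b) # b # (- 1 - a) # a # w)"
proof -
  have 1: "\<bar>a - (- 1 - b)\<bar> \<noteq> 1" "a \<noteq> - 1 - b" and 2: "\<bar>(- 1 - a) - (- 1 - b)\<bar> \<noteq> 1" "- 1 - a \<noteq> - 1 - b"
    and 3: "\<bar>- 1 - a - b\<bar> \<noteq> 1" "- 1 - a \<noteq> b" using assms by auto
  note s1 = ok_fin_swap[OF 1, of X "u @ [- 1 - a]" "b # w"]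
  note s2 = ok_fin_swap[OF 2, of X u "a # b # w"]
  note s3 = ok_fin_swap[OF assms(1,2), of X "u @ [- 1 - b, - 1 - a]" w]
  note s4 = ok_fin_swap[OF 3, of X "u @ [- 1 - b]" "a # w"]
  show "ok X (u @ (- 1 - a) # a # (- 1 - b) # b # w) \<longleftrightarrow> ok X (u @ (- 1 - b) # b # (- 1 - a) # a # w)"
    using s1(1) s2(1) s3(1) s4(1) by (simp only: append.assoc append.simps)
  show "fin X (u @ (- 1 - a) # a # (- 1 - b) # b # w) = fin X (u @ (- 1 - b) # b # (- 1 - a) # a # w)"
    using s1(2) s2(2) s3(2) s4(2) by (simp only: append.assoc append.simps)
qed

lemma letter_flip:
  assumes "a \<noteq> 0" "a \<noteq> -1"
  shows "ok X (u @ (- 1 - a) # a # w) \<longleftrightarrow> ok X (u @ a # (- 1 - a) # w)"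
    "fin X (u @ (- 1 - a) # a # w) = fin X (u @ a # (- 1 - a) # w)"
proof -
  have "\<bar>- 1 - a - a\<bar> \<noteq> 1" "- 1 - a \<noteq> a" using assms by presburger+
  from ok_fin_swap[OF this] show "ok X (u @ (- 1 - a) # a # w) \<longleftrightarrow> ok X (u @ a # (- 1 - a) # w)"
    "fin X (u @ (- 1 - a) # a # w) = fin X (u @ a # (- 1 - a) # w)" by auto
qed

text \<open>Only the letters 0 and -1 touch position 0. The doubled letter 0 fills it from -1 and
  empties it at once, while the doubled letter -1 would first need a particle there.\<close>

lemma zero_notin:
  assumes "0 \<notin> X" "ok X (dbl ys)"
  shows "0 \<notin> fin X (dbl ys)" "-1 \<notin> set ys"
proof -
  have "0 \<notin> fin X (dbl ys) \<and> -1 \<notin> set ys" using assms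
  proof (induction ys arbitrary: X)
    case (Cons y ys)
    have y: "y \<noteq> -1" using Cons.prems by auto
    have "0 \<notin> mv y (mv (- 1 - y) X)" using Cons.prems y by (auto simp: mv_def)
    then show ?case using Cons.IH[of "mv y (mv (- 1 - y) X)"] Cons.prems y by auto
  qed simp
  then show "0 \<notin> fin X (dbl ys)" "-1 \<notin> set ys" by auto
qed

lemma ok_between_append:
  assumes "ok X (u @ c # w @ c # v)"
  shows "c - 1 \<in> set w" "c + 1 \<in> set w"
  using ok_between[of "fin X u" c w] assms by auto

lemma ok_letters2:
  assumes "ok X (u @ dbl [a, b] @ w)"
  shows "a \<noteq> b" "a \<noteq> - 1 - b"
proof -
  have "ok X ((u @ [- 1 - a]) @ a # [- 1 - b] @ b # w)" "ok X ((u @ [- 1 - a]) @ a # [] @ (- 1 - b) # b # w)"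
    using assms by simp_all
  from ok_between_append[of X "u @ [- 1 - a]" a "[- 1 - b]" w] ok_between_append[of X "u @ [- 1 - a]" a "[]" "b # w"] this
  show "a \<noteq> b" "a \<noteq> - 1 - b" by (auto simp del: ok.simps ok_append)
qed

lemma ok_letters3:
  assumes o: "ok X (dbl [a, b, c])"
  shows "letters3 a b c"
proof -
  have ab: "a \<noteq> b" "a \<noteq> - 1 - b" using ok_letters2[of X "[]" a b "dbl [c]"] o by simp_all
  have bc: "b \<noteq> c" "b \<noteq> - 1 - c" using ok_letters2[of X "dbl [a]" b c "[]"] o by simp_all
  have ac: "a \<noteq> - 1 - c"
  proof
    assume "a = - 1 - c"
    then have "ok X ([- 1 - a] @ a # [- 1 - b, b] @ a # [c])" using o by simp
    from ok_between_append[OF this] have "(a - 1 = - 1 - b \<or> a - 1 = b) \<and> (a + 1 = - 1 - b \<or> a + 1 = b)"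
      by (simp only: list.set insert_iff empty_iff) blast
    then show False by presburger
  qed
  have "(a = 0 \<or> a = -1) \<and> (b = 1 \<or> b = -2)" if "a = c"
  proof -
    have "ok X ([- 1 - a] @ a # [- 1 - b, b, - 1 - a] @ a # [])" using o that by simp
    from ok_between_append[OF this] have "(a - 1 = - 1 - b \<or> a - 1 = b \<or> a - 1 = - 1 - a) \<and>
      (a + 1 = - 1 - b \<or> a + 1 = b \<or> a + 1 = - 1 - a)" by (simp only: list.set insert_iff empty_iff) blast
    then show ?thesis by presburger
  qed
  then show ?thesis using ab bc ac by (auto simp: letters3_def)
qed

definition pl :: "int \<Rightarrow> int \<Rightarrow> int" where "pl m u = (if adj m u then m else u)"
definition pr :: "int \<Rightarrow> int \<Rightarrow> int" where "pr m u = (if adj m u then u else m)"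

text \<open>Emitted and carried letter are one function with its arguments exchanged. With this
  recursion the reversal symmetry of \<open>full\<close> becomes a syntactic identity.\<close>

lemma pass_pl: "pass m (u # us) = (pl m u # fst (pass (pl u m) us), snd (pass (pl u m) us))"
  by (auto simp: pass_Cons pl_def adj_sym)

lemma full2_rev: "full [y1, y2] = ([a, b], [s, t]) \<Longrightarrow> full [- 1 - y2, - 1 - y1] = ([t, s], [b, a])"
  by (simp add: pass_pl)

text \<open>Reading a doubled word backwards replaces every letter y by \<open>- 1 - y\<close> and
  exchanges left and right halves; the carries of one word are thus the emitted letters of the
  other, in reverse order.\<close>

lemma full3_rev:
  "full [y1, y2, y3] = ([a, b, c], [s, t, v]) \<Longrightarrow> full [- 1 - y3, - 1 - y2, - 1 - y1] = ([v, t, s], [c, b, a])"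
  by (simp add: pass_pl)

lemma pass_less:
  assumes "ok X (m # us)" "Suc t < length us"
  shows "fst (pass m us) ! t < fst (pass m us) ! Suc t \<longleftrightarrow> us ! t < us ! Suc t"
  using assms
proof (induction us arbitrary: X m t)
  case (Cons a us)
  then obtain b vs where us: "us = b # vs" by (cases us) auto
  have d: "m \<noteq> a" "m \<noteq> b" "a \<noteq> b"
    using ok_distinct3[of X m a us] ok_distinct3[of "mv m X" a b vs] Cons.prems(1) us
    by (simp_all only: ok.simps) blast+
  show ?case
  proof (cases t)
    case 0
    obtain p q m' where "pass m [a, b] = ([p, q], m')" "p < q \<longleftrightarrow> a < b"
      using pass_mono2[of m a b] d by blast
    then show ?thesis using pass_append[of m "[a, b]" vs] us 0 by simp
  next
    case (Suc t')
    have "ok X (fst (pass m [a]) @ [snd (pass m [a])] @ us)"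
      using pass_ok[of X m "[a]"] Cons.prems(1) by simp
    then have "ok (fin X (fst (pass m [a]))) (snd (pass m [a]) # us)" by simp
    from Cons.IH[OF this, of t'] Suc Cons.prems(2) show ?thesis
      using pass_append[of m "[a]" us] by (cases "adj m a") (simp_all add: pass1)
  qed
qed simp

text \<open>Passing keeps comparisons of neighbours by \<open>pass_less\<close>, so only the
  junction of y with the part already emitted needs an argument. The next emitted letter is y' or,
  at the diagonal, \<open>- 1 - y'\<close>; since y is neither, comparing with one is comparing with
  the other.\<close>

lemma full_less:
  assumes "ok X (dbl ys)" "Suc t < length ys"
  shows "fst (full ys) ! t < fst (full ys) ! Suc t \<longleftrightarrow> ys ! t < ys ! Suc t"
  using assms
proof (induction ys arbitrary: X t)
  case (Cons y ys)
  let ?X = "mv y (mv (- 1 - y) X)"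
  have X: "ok ?X (dbl ys)" using Cons.prems by auto
  have o: "ok X ((- 1 - y) # y # fst (full ys))"
    using full_ok[OF X] Cons.prems(1) by auto
  note p = pass_less[OF o, of t]
  show ?case
  proof (cases t)
    case 0
    then obtain y' zs where ys: "ys = y' # zs" using Cons.prems(2) by (cases ys) auto
    have ne: "y \<noteq> y'" "y \<noteq> - 1 - y'"
      using ok_letters2[of X "[]" y y' "dbl zs"] Cons.prems(1) ys by simp_all
    have "fst (full ys) ! 0 = pl (- 1 - y') y'" using ys by (simp add: pass_pl)
    then have "y < fst (full ys) ! 0 \<longleftrightarrow> y < y'"
      using ne by (auto simp: pl_def adj_def)
    then show ?thesis using p 0 ys by simp
  next
    case (Suc t')
    then show ?thesis using p Cons.IH[OF X, of t'] Cons.prems(2) by auto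
  qed
qed simp

text \<open>Backwards in time it is the holes that move to the right, with the same letters.\<close>

lemma ok_rev:
  assumes "ok X w"
  shows "ok (- fin X w) (rev w) \<and> fin (- fin X w) (rev w) = - X"
  using assms
proof (induction w arbitrary: X)
  case (Cons c w)
  then have 1: "ok (- fin (mv c X) w) (rev w)" "fin (- fin (mv c X) w) (rev w) = - mv c X" by auto
  have "c \<in> X" "c + 1 \<notin> X" using Cons.prems by auto
  then have "c \<in> - mv c X" "c + 1 \<notin> - mv c X" "mv c (- mv c X) = - X" by (auto simp: mv_def)
  then show ?case using 1 by simp
qed simp

lemma fc_of_ok: "ok X (dbl [y1, y2, y3]) \<Longrightarrow> full [y2, y3] = ([c, d], [s, t]) \<Longrightarrow> fc4 (- 1 - y1) y1 c d"
  using full_ok[of "fin X (dbl [y1])" "[y2, y3]"] ok_fc4[of X "- 1 - y1" y1 c d]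
  by (simp del: full.simps)

lemma fc_of_ok': "ok X (dbl [y1, y2, y3]) \<Longrightarrow> full [y1, y2] = ([p, q], [s, t]) \<Longrightarrow> fc4 s t (- 1 - y3) y3"
  using full_ok[of X "[y1, y2]"] ok_fc4[of "fin X [p, q]" s t "- 1 - y3" y3]
  by (simp del: full.simps)

lemma dual_obtain:
  obtains p q r where "dual a b c = [p, q, r]"
  unfolding dual_def by (cases "betw b a c"; cases "betw a c b") auto

lemma full3_obtain:
  obtains a b c s t v where "full [y1, y2, y3] = ([a, b, c], [s, t, v])"
  by (simp add: pass_pl)

text \<open>Every elementary move on the image of three shifted letters lifts to them. The same
  three letters may serve again when both triples are fixed; otherwise two letters are exchanged,
  two marks are toggled, or the mark of one letter between two diagonal boxes is toggled.\<close>

lemma block_dual: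
  assumes z: "0 \<notin> X" and o: "ok X (dbl [y1, y2, y3])"
  shows "\<exists>z1 z2 z3 a b c s t v. ok X (dbl [z1, z2, z3]) \<and> fin X (dbl [z1, z2, z3]) = fin X (dbl [y1, y2, y3])
    \<and> full [y1, y2, y3] = ([a, b, c], [s, t, v]) \<and> full [z1, z2, z3] = (dual a b c, dual s t v)"
proof -
  have L: "letters3 y1 y2 y3" by (rule ok_letters3[OF o])
  have y: "y1 \<noteq> y2" "y1 \<noteq> -1 - y2" "y2 \<noteq> y3" "y2 \<noteq> -1 - y3" "y1 \<noteq> -1 - y3"
    using L by (auto simp: letters3_def)
  consider (a) "betw y2 y1 y3" | (b) "betw y1 y3 y2" | (c) "y1 = y3" | (d) "y1 < y2" "y2 < y3" | (e) "y2 < y1" "y3 < y2"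
    using y(1,3) unfolding betw_def by linarith
  then show ?thesis
  proof cases
    case a
    define z2 where "z2 = (if y2 + y3 = 0 \<or> y2 + y3 = -2 then - 1 - y2 else y3)"
    define z3 where "z3 = (if y2 + y3 = 0 \<or> y2 + y3 = -2 then - 1 - y3 else y2)"
    have zz: "(z2, z3) = (if y2 + y3 = 0 \<or> y2 + y3 = -2 then (- 1 - y2, - 1 - y3) else (y3, y2))"
      by (simp add: z2_def z3_def)
    have fc: "fc4 (- 1 - y1) y1 c d" if "full [y2, y3] = ([c, d], [s, t])" for c d s t
      by (rule fc_of_ok[OF o that])
    obtain p q r s t v where f: "full [y1, y2, y3] = ([p, q, r], [s, t, v])" "full [y1, z2, z3] = (dual p q r, dual s t v)"
    proof -
      have "\<exists>a b c s t v. full [y1, y2, y3] = ([a, b, c], [s, t, v]) \<and> full [y1, z2, z3] = (dual a b c, dual s t v)"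
        by (rule full_dual_right[OF L a _ zz]) (rule fc)
      then show ?thesis using that by blast
    qed
    have "ok X (dbl [y1, z2, z3]) \<and> fin X (dbl [y1, z2, z3]) = fin X (dbl [y1, y2, y3])"
    proof (cases "y2 + y3 = 0 \<or> y2 + y3 = -2")
      case True
      have nz: "y2 \<noteq> 0" "y2 \<noteq> -1" "y3 \<noteq> 0" "y3 \<noteq> -1" using True a y(2,5) unfolding betw_def by presburger+
      show ?thesis
        using letter_flip[of y2 X "dbl [y1]" "dbl [y3]"] letter_flip[of y3 X "dbl [y1] @ [y2, - 1 - y2]" "[]"]
          o nz True by (simp add: z2_def z3_def)
    next
      case False
      have "\<bar>y2 - y3\<bar> \<noteq> 1" using a by (auto simp: betw_def)
      moreover have "\<bar>y2 + y3 + 1\<bar> \<noteq> 1" "y2 + y3 \<noteq> -1" using False y(4) by auto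
      ultimately show ?thesis using letter_swap[of y2 y3 X "dbl [y1]" "[]"] o y(3) False
        by (simp add: z2_def z3_def)
    qed
    then show ?thesis using f by blast
  next
    \<comment> \<open>The mirror image of the previous case: \<open>full_dual_right\<close> is
      applied to the reversed word, with letters \<open>- 1 - y\<close>, and carried back by
      \<open>full3_rev\<close> and \<open>dual_rev\<close>.\<close>
    case b
    let ?z = "(if y2 + y1 = 0 \<or> y2 + y1 = -2 then (- 1 - y1, - 1 - y2) else (y2, y1))"
    define z1 where "z1 = fst ?z"
    define z2 where "z2 = snd ?z"
    have L': "letters3 (- 1 - y3) (- 1 - y2) (- 1 - y1)" using L b by (auto simp: letters3_def betw_def)
    have b': "betw (- 1 - y2) (- 1 - y3) (- 1 - y1)" using b by (auto simp: betw_def)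
    have fc: "fc4 (- 1 - (- 1 - y3)) (- 1 - y3) c d" if "full [- 1 - y2, - 1 - y1] = ([c, d], [s, t])" for c d s t
    proof -
      have "full [y1, y2] = ([t, s], [d, c])" using full2_rev[OF that] by simp
      from fc_of_ok'[OF o this] show ?thesis using fc4_rev by simp
    qed
    have zz: "(- 1 - z2, - 1 - z1) = (if (- 1 - y2) + (- 1 - y1) = 0 \<or> (- 1 - y2) + (- 1 - y1) = -2
       then (- 1 - (- 1 - y2), - 1 - (- 1 - y1)) else (- 1 - y1, - 1 - y2))"
      by (auto simp: z1_def z2_def)
    obtain p q r s t v where f: "full [- 1 - y3, - 1 - y2, - 1 - y1] = ([p, q, r], [s, t, v])"
        "full [- 1 - y3, - 1 - z2, - 1 - z1] = (dual p q r, dual s t v)"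
    proof -
      have "\<exists>a b c s t v. full [- 1 - y3, - 1 - y2, - 1 - y1] = ([a, b, c], [s, t, v]) \<and>
        full [- 1 - y3, - 1 - z2, - 1 - z1] = (dual a b c, dual s t v)"
        by (rule full_dual_right[OF L' b' _ zz]) (rule fc)
      then show ?thesis using that by blast
    qed
    obtain p' q' r' where d1: "dual p q r = [p', q', r']" by (rule dual_obtain)
    obtain s' t' v' where d2: "dual s t v = [s', t', v']" by (rule dual_obtain)
    have g: "full [y1, y2, y3] = ([v, t, s], [r, q, p])" using full3_rev[OF f(1)] by simp
    have h: "full [z1, z2, y3] = (dual v t s, dual r q p)"
      using full3_rev[OF f(2)[unfolded d1 d2]] d1 d2 dual_rev[of p q r] dual_rev[of s t v] by simp
    have "ok X (dbl [z1, z2, y3]) \<and> fin X (dbl [z1, z2, y3]) = fin X (dbl [y1, y2, y3])"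
    proof (cases "y2 + y1 = 0 \<or> y2 + y1 = -2")
      case True
      have nz: "y2 \<noteq> 0" "y2 \<noteq> -1" "y1 \<noteq> 0" "y1 \<noteq> -1" using True b y(4,5) unfolding betw_def by presburger+
      show ?thesis
        using letter_flip[of y1 X "[]" "dbl [y2, y3]"] letter_flip[of y2 X "[y1, - 1 - y1]" "dbl [y3]"]
          o nz True by (simp add: z1_def z2_def)
    next
      case False
      have "\<bar>y1 - y2\<bar> \<noteq> 1" using b by (auto simp: betw_def)
      moreover have "\<bar>y1 + y2 + 1\<bar> \<noteq> 1" "y1 + y2 \<noteq> -1" using False y(2) by auto
      ultimately show ?thesis using letter_swap[of y1 y2 X "[]" "dbl [y3]"] o y(1) False
        by (simp add: z1_def z2_def)
    qed
    then show ?thesis using g h by blast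
  next
    \<comment> \<open>A diagonal box, its neighbour and the next diagonal box. The two possible
      words differ in the mark of the middle letter, and their images are simply evaluated.\<close>
    case c
    then have "y1 = 0" "y3 = 0" "y2 = 1 \<or> y2 = -2" using L zero_notin(2)[OF z o] by (auto simp: letters3_def)
    moreover have e: "full [0, 1, 0] = ([-1, 0, -2], [1, -1, 0])" "full [0, -2, 0] = ([-1, -2, 0], [-1, 1, 0])"
      by (simp_all add: pass_Cons adj_def)
    moreover have "dual (-1) 0 (-2) = [-1, -2, 0]" "dual 1 (-1) 0 = [-1, 1, 0]"
      "dual (-1) (-2) 0 = [-1, 0, -2]" "dual (-1) 1 0 = [1, -1, 0]" by (simp_all add: dual_def betw_def)
    moreover have "ok X (dbl [0, 1, 0]) \<longleftrightarrow> ok X (dbl [0, -2, 0])" "fin X (dbl [0, 1, 0]) = fin X (dbl [0, -2, 0])"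
      using letter_flip[of 1 X "[-1, 0]" "[-1, 0]"] by simp_all
    ultimately show ?thesis using o by (metis (no_types))
  next
    \<comment> \<open>A monotone triple is fixed by \<open>dual\<close>, so the letters themselves
      serve as z1, z2, z3. That the carries are monotone too is \<open>full_less\<close> for the
      reversed word.\<close>
    case d
    obtain p q r s t v where f: "full [y1, y2, y3] = ([p, q, r], [s, t, v])" by (rule full3_obtain)
    have o': "ok (- fin X (dbl [y1, y2, y3])) (dbl [- 1 - y3, - 1 - y2, - 1 - y1])"
      using ok_rev[OF o] by simp
    have "p < q" "q < r" using full_less[OF o, of 0] full_less[OF o, of 1] d unfolding f by simp_all
    moreover have "v < t" "t < s"
      using full_less[OF o', of 0] full_less[OF o', of 1] d unfolding full3_rev[OF f] by simp_all
    ultimately have "dual p q r = [p, q, r]" "dual s t v = [s, t, v]" by (auto simp: dual_def betw_def)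
    then show ?thesis using f o by metis
  next
    case e
    obtain p q r s t v where f: "full [y1, y2, y3] = ([p, q, r], [s, t, v])" by (rule full3_obtain)
    have o': "ok (- fin X (dbl [y1, y2, y3])) (dbl [- 1 - y3, - 1 - y2, - 1 - y1])"
      using ok_rev[OF o] by simp
    have "p \<noteq> q" "q \<noteq> r" "s \<noteq> t" "t \<noteq> v"
    proof -
      have 1: "ok X ([p, q, r] @ [s, t, v])" using full_ok[OF o] unfolding f by simp
      then show "p \<noteq> q" "q \<noteq> r" "s \<noteq> t" "t \<noteq> v"
        using ok_distinct3[of X p q "[r, s, t, v]"] ok_distinct3[of "fin X [p]" q r "[s, t, v]"]
          ok_distinct3[of "fin X [p, q, r]" s t "[v]"] ok_distinct3[of "fin X [p, q, r, s]" t v "[]"]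
        by (simp_all only: append.simps ok.simps fin.simps) blast+
    qed
    moreover have "\<not> p < q" "\<not> q < r" using full_less[OF o, of 0] full_less[OF o, of 1] e unfolding f by simp_all
    moreover have "\<not> v < t" "\<not> t < s"
      using full_less[OF o', of 0] full_less[OF o', of 1] e unfolding full3_rev[OF f] by simp_all
    ultimately have "dual p q r = [p, q, r]" "dual s t v = [s, t, v]" by (auto simp: dual_def betw_def)
    then show ?thesis using f o by metis
  qed
qed

section \<open>Elementary moves inside long words and the size of fibres\<close>

fun passes :: "int list \<Rightarrow> int list \<Rightarrow> int list \<times> int list" where
  "passes [] us = (us, [])"
| "passes (m # ms) us = (fst (pass m (fst (passes ms us))), snd (pass m (fst (passes ms us))) # snd (passes ms us))"

lemma length_passes [simp]: "length (fst (passes ms us)) = length us" "length (snd (passes ms us)) = length ms"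
  by (induction ms) auto

lemma passes_ok:
  assumes "ok X (ms @ us)"
  shows "ok X (fst (passes ms us) @ snd (passes ms us)) \<and> fin X (fst (passes ms us) @ snd (passes ms us)) = fin X (ms @ us)"
  using assms
proof (induction ms arbitrary: X)
  case (Cons m ms)
  then have 1: "ok (mv m X) (fst (passes ms us) @ snd (passes ms us))"
    "fin (mv m X) (fst (passes ms us) @ snd (passes ms us)) = fin (mv m X) (ms @ us)" by auto
  then have "ok X (m # fst (passes ms us))" using Cons.prems by auto
  from pass_ok[OF this] 1 show ?case by auto
qed simp

lemma passes_append:
  "passes ms (us @ vs) = (fst (passes ms us) @ fst (passes (snd (passes ms us)) vs), snd (passes (snd (passes ms us)) vs))"
  by (induction ms) (auto simp: pass_append)

text \<open>Moving ms to the right past u is moving u to the left past ms. Through this,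
  \<open>pass_dual\<close> also governs triples inside the letters that move.\<close>

lemma passes_single: "passes ms [u] = ([snd (pass u (rev ms))], rev (fst (pass u (rev ms))))"
proof (induction ms)
  case (Cons m ms)
  then show ?case
    by (cases "adj m (snd (pass u (rev ms)))") (simp_all add: pass_append pass1 adj_sym)
qed simp

lemma full_append:
  "full (ys @ zs) = (fst (full ys) @ fst (passes (snd (full ys)) (fst (full zs))),
    snd (passes (snd (full ys)) (fst (full zs))) @ snd (full zs))"
proof (induction ys)
  case (Cons y ys)
  show ?case using pass_append[of "- 1 - y" "y # fst (full ys)"] by (simp add: Cons)
qed simp

lemma passes_dual_us:
  assumes "ok X (ms @ [a, b, c] @ us)"
  shows "\<exists>a' b' c' us' ms'. passes ms (a # b # c # us) = (a' # b' # c' # us', ms')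
    \<and> passes ms (dual a b c @ us) = (dual a' b' c' @ us', ms')"
  using assms
proof (induction ms arbitrary: X)
  case (Cons m ms)
  have "ok (mv m X) (ms @ [a, b, c] @ us)" using Cons.prems by simp
  from Cons.IH[OF this] obtain a' b' c' us' ms' where 1: "passes ms (a # b # c # us) = (a' # b' # c' # us', ms')"
    "passes ms (dual a b c @ us) = (dual a' b' c' @ us', ms')" by blast
  have "ok (mv m X) (a' # b' # c' # us' @ ms')" using passes_ok[of "mv m X" ms "[a, b, c] @ us"] 1 Cons.prems by simp
  then have "ok X [m, a', b', c']" using Cons.prems by simp
  from pass_dual[OF ok_fc4[OF this]] obtain p q r m' where
    2: "pass m [a', b', c'] = ([p, q, r], m')" "pass m (dual a' b' c') = (dual p q r, m')" by blast
  have "pass m (a' # b' # c' # us') = (p # q # r # fst (pass m' us'), snd (pass m' us'))"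
    using pass_append[of m "[a', b', c']" us'] 2 by simp
  moreover have "pass m (dual a' b' c' @ us') = (dual p q r @ fst (pass m' us'), snd (pass m' us'))"
    using 2 by (simp add: pass_append)
  ultimately show ?case using 1 by auto
qed simp

lemma passes_dual_ms:
  assumes "ok X ([s, t, v] @ us)"
  shows "\<exists>s' t' v' us'. passes [s, t, v] us = (us', [s', t', v']) \<and> passes (dual s t v) us = (us', dual s' t' v')"
  using assms
proof (induction us arbitrary: X s t v)
  case Nil
  have "passes ms [] = ([], ms)" for ms by (induction ms) auto
  then show ?case by blast
next
  case (Cons u us)
  have "fc4 s t v u" using ok_fc4[of X s t v u] Cons.prems by simp
  then have "fc4 u v t s" using fc4_rev by simp
  from pass_dual[OF this] obtain p q r u' where
    1: "pass u [v, t, s] = ([p, q, r], u')" "pass u (dual v t s) = (dual p q r, u')" by blast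
  have 2: "passes [s, t, v] [u] = ([u'], [r, q, p])" using 1 passes_single[of "[s, t, v]" u] by simp
  have 3: "passes (dual s t v) [u] = ([u'], dual r q p)"
    using 1(2) passes_single[of "dual s t v" u] dual_rev[of s t v] dual_rev[of p q r] by simp
  have "ok X ([u'] @ [r, q, p] @ us)"
  proof -
    have "ok X ([s, t, v] @ [u])" "ok (fin X ([s, t, v] @ [u])) us" using Cons.prems by auto
    with passes_ok[of X "[s, t, v]" "[u]"] 2 show ?thesis by (simp del: passes.simps)
  qed
  then have "ok (mv u' X) ([r, q, p] @ us)" by simp
  from Cons.IH[OF this] obtain s' t' v' us' where
    4: "passes [r, q, p] us = (us', [s', t', v'])" "passes (dual r q p) us = (us', dual s' t' v')" by blast
  have "passes [s, t, v] (u # us) = (u' # us', [s', t', v'])"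
    using passes_append[of "[s, t, v]" "[u]" us] 2 4 by (simp del: passes.simps)
  moreover have "passes (dual s t v) (u # us) = (u' # us', dual s' t' v')"
    using passes_append[of "dual s t v" "[u]" us] 3 4 by (simp del: passes.simps)
  ultimately show ?case by blast
qed

lemma take_drop_3:
  assumes "n + 2 < length us"
  shows "us = take n us @ us ! n # us ! (n + 1) # us ! (n + 2) # drop (n + 3) us"
proof -
  have "drop n us = us ! n # us ! (n + 1) # us ! (n + 2) # drop (n + 3) us"
    using assms by (simp add: Cons_nth_drop_Suc[symmetric] numeral_eq_Suc)
  then show ?thesis using append_take_drop_id[of n us] by simp
qed

definition dual_at :: "nat \<Rightarrow> int list \<Rightarrow> int list" where
  "dual_at n us = take n us @ dual (us ! n) (us ! (n + 1)) (us ! (n + 2)) @ drop (n + 3) us"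

lemma dual_at_append: "length us = n \<Longrightarrow> dual_at n (us @ a # b # c # vs) = us @ dual a b c @ vs"
  by (simp add: dual_at_def nth_append)

text \<open>The block at positions n, n + 1, n + 2 is replaced by means of
  \<open>block_dual\<close>. Letters after the block see it only through its carries, treated by
  \<open>passes_dual_ms\<close>; letters before it see only its emitted letters, treated by
  \<open>passes_dual_us\<close>. Neither changes what is emitted or carried elsewhere.\<close>

lemma word_dual:
  assumes z: "0 \<notin> X" and o: "ok X (dbl ys)" and n: "n + 2 < length ys"
  shows "\<exists>zs. length zs = length ys \<and> ok X (dbl zs) \<and> fin X (dbl zs) = fin X (dbl ys)
    \<and> full zs = (dual_at n (fst (full ys)), dual_at n (snd (full ys)))"
proof -
  define pre where "pre = take n ys"
  define post where "post = drop (n + 3) ys"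
  obtain y1 y2 y3 where ys: "ys = pre @ [y1, y2, y3] @ post"
    using take_drop_3[OF n] that by (simp add: pre_def post_def)
  have len: "length pre = n" using n by (simp add: pre_def)
  define Y where "Y = fin X (dbl pre)"
  have Y: "0 \<notin> Y" "ok Y (dbl [y1, y2, y3])" using zero_notin(1)[OF z, of pre] o ys by (auto simp: Y_def)
  obtain z1 z2 z3 a b c s t v where
    b: "ok Y (dbl [z1, z2, z3])" "fin Y (dbl [z1, z2, z3]) = fin Y (dbl [y1, y2, y3])"
      "full [y1, y2, y3] = ([a, b, c], [s, t, v])" "full [z1, z2, z3] = (dual a b c, dual s t v)"
    using block_dual[OF Y] by blast
  define zs where "zs = pre @ [z1, z2, z3] @ post"
  let ?Y3 = "fin Y (dbl [y1, y2, y3])"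
  have p: "ok ?Y3 (dbl post)" using o ys by (simp add: Y_def)
  have okz: "ok X (dbl zs)" and finz: "fin X (dbl zs) = fin X (dbl ys)"
    using b(1,2) p o ys by (simp_all add: zs_def Y_def)
  have U: "ok Y ([a, b, c] @ [s, t, v])" "fin Y ([a, b, c] @ [s, t, v]) = ?Y3"
    using full_ok[OF Y(2)] b(3) by simp_all
  have pU: "ok ?Y3 (fst (full post) @ snd (full post))" using full_ok[OF p] by simp
  have "ok (fin Y [a, b, c]) ([s, t, v] @ fst (full post))" using U pU by simp
  from passes_dual_ms[OF this] obtain s' t' v' us' where
    3: "passes [s, t, v] (fst (full post)) = (us', [s', t', v'])"
      "passes (dual s t v) (fst (full post)) = (us', dual s' t' v')" by blast
  have 4: "full ([y1, y2, y3] @ post) = (a # b # c # us', [s', t', v'] @ snd (full post))"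
    using full_append[of "[y1, y2, y3]" post] b(3) 3 by (simp del: full.simps passes.simps)
  have 5: "full ([z1, z2, z3] @ post) = (dual a b c @ us', dual s' t' v' @ snd (full post))"
    using full_append[of "[z1, z2, z3]" post] b(4) 3 by (simp del: full.simps passes.simps)
  have okp: "ok X (dbl pre)" using o ys by simp
  have okt: "ok Y (dbl ([y1, y2, y3] @ post))" using o ys by (simp add: Y_def)
  have "ok (fin X (fst (full pre))) (snd (full pre) @ [a, b, c] @ us')"
    using full_ok[OF okp] full_ok[OF okt] 4 by (simp add: Y_def del: full.simps)
  from passes_dual_us[OF this] obtain a' b' c' vs ms where
    6: "passes (snd (full pre)) (a # b # c # us') = (a' # b' # c' # vs, ms)"
      "passes (snd (full pre)) (dual a b c @ us') = (dual a' b' c' @ vs, ms)" by blast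
  have lms: "length ms = n" using length_passes(2)[of "snd (full pre)" "a # b # c # us'"] 6(1) len by simp
  have 7: "full ys = (fst (full pre) @ a' # b' # c' # vs, ms @ s' # t' # v' # snd (full post))"
    using full_append[of pre "[y1, y2, y3] @ post"] 4 6 ys by (simp del: full.simps)
  have 8: "full zs = (fst (full pre) @ dual a' b' c' @ vs, ms @ dual s' t' v' @ snd (full post))"
    using full_append[of pre "[z1, z2, z3] @ post"] 5 6 by (simp add: zs_def del: full.simps)
  have "full zs = (dual_at n (fst (full ys)), dual_at n (snd (full ys)))"
    unfolding 7 8 using len lms by (simp add: dual_at_append)
  moreover have "length zs = length ys" using ys by (simp add: zs_def)
  ultimately show ?thesis using okz finz by blast
qed

lemma dual_dual: "dual a b c = [p, q, r] \<Longrightarrow> dual p q r = [a, b, c]"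
  by (auto simp: dual_def betw_def split: if_splits)

lemma dual_at_dual_at:
  assumes "n + 2 < length us"
  shows "dual_at n (dual_at n us) = us"
proof -
  define pre where "pre = take n us"
  define post where "post = drop (n + 3) us"
  have us: "us = pre @ us ! n # us ! (n + 1) # us ! (n + 2) # post"
    using take_drop_3[OF assms] by (simp add: post_def pre_def)
  have len: "length pre = n" using assms by (simp add: pre_def)
  obtain p q r where d: "dual (us ! n) (us ! (n + 1)) (us ! (n + 2)) = [p, q, r]" by (rule dual_obtain)
  have "dual_at n us = pre @ p # q # r # post"
    by (simp add: dual_at_def pre_def post_def d[simplified])
  then show ?thesis using dual_at_append[OF len] dual_dual[OF d] us by simp
qed

lemma length_dual [simp]: "length (dual a b c) = 3" by (simp add: dual_def)

lemma length_dual_at: "n + 2 < length us \<Longrightarrow> length (dual_at n us) = length us"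
  by (simp add: dual_at_def)

definition shifted_words :: "int set \<Rightarrow> int list set" where
  "shifted_words Y = {ys. ok {..<0} (dbl ys) \<and> fin {..<0} (dbl ys) = Y}"

definition fibre :: "int set \<Rightarrow> int list \<Rightarrow> int list set" where
  "fibre Y U = {ys \<in> shifted_words Y. fst (full ys) = U}"

lemma card_fibre_dual:
  assumes "n + 2 < length U" and fin: "\<And>V. finite (fibre Y V)"
  shows "card (fibre Y (dual_at n U)) = card (fibre Y U)"
proof -
  have le: "card (fibre Y V) \<le> card (fibre Y (dual_at n V))" if len: "n + 2 < length V" for V
  proof -
    have "\<forall>ys\<in>fibre Y V. \<exists>zs. zs \<in> fibre Y (dual_at n V) \<and> snd (full zs) = dual_at n (snd (full ys))"
    proof
      fix ys assume ys: "ys \<in> fibre Y V"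
      then have "n + 2 < length ys" using len by (auto simp: fibre_def)
      with word_dual[of "{..<0}" ys n] ys
      show "\<exists>zs. zs \<in> fibre Y (dual_at n V) \<and> snd (full zs) = dual_at n (snd (full ys))"
        by (auto simp: fibre_def shifted_words_def)
    qed
    then obtain f where f: "\<And>ys. ys \<in> fibre Y V \<Longrightarrow> f ys \<in> fibre Y (dual_at n V)"
      "\<And>ys. ys \<in> fibre Y V \<Longrightarrow> snd (full (f ys)) = dual_at n (snd (full ys))" by metis
    have "inj_on f (fibre Y V)"
    proof
      fix xs ys assume x: "xs \<in> fibre Y V" and y: "ys \<in> fibre Y V" and e: "f xs = f ys"
      have l: "length xs = length V" "length ys = length V"
        using x y length_full(1)[of xs] length_full(1)[of ys] by (simp_all add: fibre_def)
      have "dual_at n (snd (full xs)) = dual_at n (snd (full ys))" using f(2)[OF x] f(2)[OF y] e by simp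
      note * = this
      \<comment> \<open>The move on the second halves is an involution, so these halves can be
        recovered; together with the common first half V they determine the word.\<close>
      have "dual_at n (dual_at n (snd (full xs))) = snd (full xs)" "dual_at n (dual_at n (snd (full ys))) = snd (full ys)"
        by (rule dual_at_dual_at, simp only: length_full l len)+
      then have "snd (full xs) = snd (full ys)" unfolding * by simp
      moreover have "fst (full xs) = fst (full ys)" using x y by (simp add: fibre_def)
      ultimately show "xs = ys" by (rule full_inj[OF prod_eqI, rotated])
    qed
    then show ?thesis using card_inj_on_le[of f "fibre Y V" "fibre Y (dual_at n V)"] f(1) fin by blast
  qed
  from le[of U] le[of "dual_at n U"] assms show ?thesis
    using dual_at_dual_at[of n U] length_dual_at[of n U] by simp
qed

section \<open>Words of one shape are connected by dual equivalence\<close>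

definition words :: "int set \<Rightarrow> int list set" where
  "words Y = {w. ok {..<0} w \<and> fin {..<0} w = Y}"

lemma fin_snoc_state:
  assumes "ok X (w @ [c])"
  shows "c \<notin> fin X (w @ [c])" "c + 1 \<in> fin X (w @ [c])" "fin X w = insert c (fin X (w @ [c]) - {c + 1})"
  using assms by (auto simp: mv_def)

text \<open>The box of content x is a removable corner of the final shape. If the last letter c is
  another one, it also belongs to a removable corner, hence is not adjacent to x; so x is brought to
  the end of the preceding part and then commutes past c.\<close>

lemma move_to_end:
  assumes "ok {..<0} w" "x \<notin> fin {..<0} w" "x + 1 \<in> fin {..<0} w"
  shows "\<exists>v. v @ [x] \<in> words (fin {..<0} w)"
  using assms
proof (induction w rule: rev_induct)
  case (snoc c w)
  note s = fin_snoc_state[OF snoc.prems(1)]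
  show ?case
  proof (cases "c = x")
    case True
    then show ?thesis using snoc.prems(1) by (auto simp: words_def)
  next
    case False
    have d: "\<bar>c - x\<bar> \<noteq> 1"
    proof
      assume "\<bar>c - x\<bar> = 1"
      then have "c = x + 1 \<or> x = c + 1" by linarith
      then show False using s snoc.prems(2,3) by blast
    qed
    define Z where "Z = fin {..<0} (w @ [c])"
    have "fin {..<0} w = insert c (Z - {c + 1})" "x \<notin> Z" "x + 1 \<in> Z"
      unfolding Z_def by (rule s(3) snoc.prems(2,3))+
    then have "x \<notin> fin {..<0} w" "x + 1 \<in> fin {..<0} w" using False d by auto
    then obtain v where v: "ok {..<0} (v @ [x])" "fin {..<0} (v @ [x]) = fin {..<0} w"
      using snoc.IH snoc.prems(1) by (auto simp: words_def)
    have "\<bar>x - c\<bar> \<noteq> 1" "x \<noteq> c" using d False by auto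
    note sw = ok_fin_swap[OF this, of "{..<0}" v "[]"]
    have "ok {..<0} ((v @ [x]) @ [c])" "fin {..<0} ((v @ [x]) @ [c]) = fin {..<0} (w @ [c])"
      using v snoc.prems(1) unfolding ok_append[of _ "v @ [x]"] fin_append[of _ "v @ [x]"] ok_append[of _ w] fin_append[of _ w]
      by simp_all
    then have "(v @ [c]) @ [x] \<in> words (fin {..<0} (w @ [c]))" using sw by (simp add: words_def)
    then show ?thesis by blast
  qed
qed simp

definition dual_rel :: "(int list \<times> int list) set" where
  "dual_rel = {(U, dual_at n U) | U n. n + 2 < length U}"

lemma dual_rel_append: "(U, V) \<in> dual_rel\<^sup>* \<Longrightarrow> (U @ w, V @ w) \<in> dual_rel\<^sup>*"
proof (induction rule: rtrancl_induct)
  case (step V W)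
  then obtain n where n: "n + 2 < length V" "W = dual_at n V" by (auto simp: dual_rel_def)
  then have "W @ w = dual_at n (V @ w)" by (simp add: dual_at_def nth_append)
  moreover have "n + 2 < length (V @ w)" using n by simp
  ultimately have "(V @ w, W @ w) \<in> dual_rel" unfolding dual_rel_def by blast
  then show ?case using step.IH by simp
qed simp

lemma dual_rel_length: "(U, V) \<in> dual_rel\<^sup>* \<Longrightarrow> length U = length V"
  by (induction rule: rtrancl_induct) (auto simp: dual_rel_def length_dual_at)

lemma sign_change:
  fixes a b :: int
  assumes "a < b" "a \<notin> Z" "b \<in> Z"
  shows "\<exists>x. a \<le> x \<and> x < b \<and> x \<notin> Z \<and> x + 1 \<in> Z"
  using assms
proof (induction "nat (b - a)" arbitrary: b)
  case (Suc k)
  show ?case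
  proof (cases "b - 1 \<in> Z")
    case True
    then have "a < b - 1" using Suc.prems by (cases "a = b - 1") auto
    moreover have "k = nat (b - 1 - a)" using Suc.hyps(2) by linarith
    ultimately obtain x where "a \<le> x" "x < b - 1" "x \<notin> Z" "x + 1 \<in> Z"
      using Suc.hyps(1)[of "b - 1"] Suc.prems True by auto
    then show ?thesis by (intro exI[of _ x]) auto
  next
    case False
    then show ?thesis using Suc.prems by (intro exI[of _ "b - 1"]) auto
  qed
qed simp

text \<open>Haiman's theorem that standard tableaux of one shape are dual equivalent. If the last
  letters c and c' differ, remove both corners. The boundary of the remaining shape must turn
  somewhere between them, at a corner x strictly between c and c'. Both words are connected by
  induction to words ending in x, c', c and in x, c, c', and these differ by an elementary move
  because x is in the middle.\<close>

lemma words_connected: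
  assumes "U \<in> words Y" "V \<in> words Y"
  shows "(U, V) \<in> dual_rel\<^sup>*"
  using assms
proof (induction "length U" arbitrary: U V Y rule: less_induct)
  case less
  have e: "fin {..<0} U = fin {..<0} V" "ok {..<0} U" "ok {..<0} V" "Y = fin {..<0} U"
    using less.prems by (auto simp: words_def)
  show ?case
  proof (cases U rule: rev_cases)
    case Nil
    then have Y: "fin {..<0} V = {..<0}" using e by simp
    have "V = []"
    proof (cases V rule: rev_cases)
      case (snoc v c)
      then show ?thesis using fin_snoc_state(1,2)[of "{..<0}" v c] e(3) Y by auto
    qed
    then show ?thesis using Nil by simp
  next
    case (snoc u c)
    note su = fin_snoc_state[of "{..<0}" u c, folded snoc, OF e(2)]
    show ?thesis
    proof (cases V rule: rev_cases)
      case Nil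
      then show ?thesis using su(1,2) e(1) by auto
    next
      case v: (snoc v c')
      note sv = fin_snoc_state[of "{..<0}" v c', folded v, OF e(3)]
      have u: "u \<in> words (fin {..<0} u)" "v \<in> words (fin {..<0} v)" using e snoc v by (auto simp: words_def)
      show ?thesis
      proof (cases "c = c'")
        case True
        then have "fin {..<0} u = fin {..<0} v" using su(3) sv(3) e(1) by simp
        then have "(u, v) \<in> dual_rel\<^sup>*" using less.hyps[of u _ v] u snoc by simp
        then show ?thesis using dual_rel_append snoc v True by simp
      next
        case False
        have d: "c' \<noteq> c + 1" "c \<noteq> c' + 1" using su(1,2) sv(1,2) e(1) by metis+
        let ?Yc = "fin {..<0} u"
        have "c' \<notin> ?Yc" "c' + 1 \<in> ?Yc" using su(3) sv(1,2) e(1) False d by auto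
        then obtain u1 where u1: "u1 @ [c'] \<in> words ?Yc" using move_to_end[of u c'] u by (auto simp: words_def)
        let ?Y2 = "fin {..<0} u1"
        have ok1: "ok {..<0} (u1 @ [c'])" "fin {..<0} (u1 @ [c']) = ?Yc" using u1 by (auto simp: words_def)
        have cY: "c \<in> ?Yc" "c + 1 \<notin> ?Yc" using e(2) snoc by auto
        have Y2: "?Y2 = insert c' (?Yc - {c' + 1})" using fin_snoc_state(3)[OF ok1(1)] ok1(2) by simp
        have m: "c \<in> ?Y2" "c + 1 \<notin> ?Y2" "c' \<in> ?Y2" "c' + 1 \<notin> ?Y2"
          using Y2 cY d False by auto
        \<comment> \<open>Going up from the smaller of c + 1 and c' + 1, which is empty, to the
          larger of c and c', which is occupied, there is a last empty position before an occupied
          one: a removable corner.\<close>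
        obtain x where x: "x \<notin> ?Y2" "x + 1 \<in> ?Y2" "betw c' x c"
        proof (cases "c' < c")
          case True
          then have "c' + 1 < c" using d by simp
          from sign_change[OF this m(4,1)] that show ?thesis by (auto simp: betw_def)
        next
          case False
          then have "c + 1 < c'" using d \<open>c \<noteq> c'\<close> by simp
          from sign_change[OF this m(2,3)] that show ?thesis by (auto simp: betw_def)
        qed
        obtain w where w: "w @ [x] \<in> words ?Y2" using move_to_end[OF _ x(1,2)] ok1 by auto
        have okw: "ok {..<0} (w @ [x])" "fin {..<0} (w @ [x]) = ?Y2" using w by (auto simp: words_def)
        have 1: "w @ [x, c'] \<in> words ?Yc"
        proof -
          have "ok {..<0} ((w @ [x]) @ [c'])" "fin {..<0} ((w @ [x]) @ [c']) = ?Yc"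
            using okw ok1 by (simp_all only: ok_append fin_append)
          then show ?thesis by (simp add: words_def)
        qed
        have "\<bar>c' - c\<bar> \<noteq> 1" "c' \<noteq> c" using d False by auto
        note swp = ok_fin_swap[OF this, of "{..<0}" "w @ [x]" "[]"]
        have 2: "w @ [x, c', c] \<in> words Y"
        proof -
          have "ok {..<0} ((w @ [x, c']) @ [c])" "fin {..<0} ((w @ [x, c']) @ [c]) = fin {..<0} (u @ [c])"
            using 1 e(2) snoc unfolding words_def mem_Collect_eq by (simp_all only: ok_append fin_append)
          then show ?thesis using snoc e(4) by (simp add: words_def)
        qed
        then have 3: "w @ [x, c, c'] \<in> words Y" using swp by (simp add: words_def)
        then have 4: "w @ [x, c] \<in> words (fin {..<0} v)"
        proof -
          have "ok {..<0} ((w @ [x, c]) @ [c'])" "fin {..<0} ((w @ [x, c]) @ [c']) = fin {..<0} V"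
            using 3 e by (simp_all add: words_def)
          from fin_snoc_state(3)[OF this(1)] this sv(3) show ?thesis by (simp add: words_def)
        qed
        have uw: "(u, w @ [x, c']) \<in> dual_rel\<^sup>*" using less.hyps[OF _ u(1) 1] snoc by simp
        have len: "length u = length (w @ [x, c'])" by (rule dual_rel_length[OF uw])
        from dual_rel_append[OF uw, of "[c]"] have A: "(U, w @ [x, c', c]) \<in> dual_rel\<^sup>*" using snoc by simp
        have "w @ [x, c, c'] = dual_at (length w) (w @ [x, c', c])"
          using x(3) dual_at_append[of w "length w" x c' c "[]"] by (simp add: dual_def)
        moreover have "length w + 2 < length (w @ [x, c', c])" by simp
        ultimately have B: "(w @ [x, c', c], w @ [x, c, c']) \<in> dual_rel" unfolding dual_rel_def by blast
        have "(w @ [x, c], v) \<in> dual_rel\<^sup>*" using less.hyps[OF _ 4 u(2)] len snoc by simp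
        from dual_rel_append[OF this, of "[c']"] have C: "(w @ [x, c, c'], V) \<in> dual_rel\<^sup>*" using v by simp
        show ?thesis using A B C by simp
      qed
    qed
  qed
qed


lemma fin_bounds:
  assumes "ok {..<0} w"
  shows "set w \<subseteq> {- int (length w)..<int (length w)}"
    "{..<- int (length w)} \<subseteq> fin {..<0} w" "fin {..<0} w \<subseteq> {..<int (length w)}"
  using assms
proof (induction w rule: rev_induct)
  case (snoc c w)
  {
    case 1
    have o: "ok {..<0} w" "c \<in> fin {..<0} w" "c + 1 \<notin> fin {..<0} w" using 1 by auto
    have "c < int (length w)" using snoc.IH(3)[OF o(1)] o(2) by auto
    moreover have "\<not> c + 1 < - int (length w)" using snoc.IH(2)[OF o(1)] o(3) by auto
    ultimately show ?case using snoc.IH(1)[OF o(1)] by auto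
  next
    case 2
    have o: "ok {..<0} w" "c + 1 \<notin> fin {..<0} w" using 2 by auto
    have "\<not> c + 1 < - int (length w)" using snoc.IH(2)[OF o(1)] o(2) by auto
    then show ?case using snoc.IH(2)[OF o(1)] by (auto simp: mv_def)
  next
    case 3
    have o: "ok {..<0} w" "c \<in> fin {..<0} w" using 3 by auto
    then show ?case using snoc.IH(3)[OF o(1)] by (auto simp: mv_def)
  }
qed auto

lemma finite_words: "finite (words Y)"
proof (cases "words Y = {}")
  case False
  then obtain w where w: "w \<in> words Y" by blast
  let ?m = "length w"
  have "words Y \<subseteq> {v. set v \<subseteq> {- int ?m..<int ?m} \<and> length v = ?m}"
  proof
    fix v assume v: "v \<in> words Y"
    \<comment> \<open>Connectedness supplies the common length of all words that reach Y.\<close>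
    have "length v = ?m" using dual_rel_length[OF words_connected[OF v w]] .
    then show "v \<in> {v. set v \<subseteq> {- int ?m..<int ?m} \<and> length v = ?m}"
      using fin_bounds(1)[of v] v by (auto simp: words_def)
  qed
  then show ?thesis by (rule finite_subset) (simp add: finite_lists_length_eq)
qed simp

lemma inj_dbl: "inj dbl"
proof
  fix xs ys :: "int list" assume "dbl xs = dbl ys"
  then show "xs = ys"
  proof (induction xs arbitrary: ys)
    case Nil
    then show ?case by (cases ys) auto
  next
    case (Cons x xs)
    then show ?case by (cases ys) auto
  qed
qed

lemma finite_shifted_words: "finite (shifted_words Y)"
proof -
  have "dbl ` shifted_words Y \<subseteq> words Y" by (auto simp: shifted_words_def words_def)
  then show ?thesis using finite_words inj_dbl finite_imageD[of dbl "shifted_words Y"] finite_subset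
    by (metis inj_on_subset subset_UNIV)
qed

lemma card_fibre_const:
  assumes "U \<in> words S" "V \<in> words S"
  shows "card (fibre Y U) = card (fibre Y V)"
  using words_connected[OF assms]
proof (induction rule: rtrancl_induct)
  case (step V W)
  have "finite (fibre Y V)" for V using finite_shifted_words[of Y] by (simp add: fibre_def)
  then show ?case using step card_fibre_dual[of _ V Y] by (auto simp: dual_rel_def)
qed simp

section \<open>The lattice property of two consecutive runs\<close>

definition cnt :: "int \<Rightarrow> int list \<Rightarrow> int" where
  "cnt x l = int (length (filter (\<lambda>c. x \<le> c) l))"

text \<open>The Yamanouchi condition for two labels i and i + 1 whose boxes have the letters A and
  B, when boxes are read by decreasing letter, with i before i + 1 at equal letters.\<close>

definition lattice :: "int list \<Rightarrow> int list \<Rightarrow> bool" where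
  "lattice A B \<longleftrightarrow> (\<forall>x. cnt x B \<le> cnt x A)"

lemma cnt_append [simp]: "cnt x (u @ v) = cnt x u + cnt x v" by (simp add: cnt_def)
lemma cnt_Nil [simp]: "cnt x [] = 0" by (simp add: cnt_def)
lemma cnt_Cons: "cnt x (c # l) = (if x \<le> c then 1 else 0) + cnt x l" by (simp add: cnt_def)

lemma cnt_step: "distinct l \<Longrightarrow> cnt x l = cnt (x + 1) l + (if x \<in> set l then 1 else 0)"
proof (induction l)
  case (Cons a l)
  have "x \<le> a \<longleftrightarrow> x + 1 \<le> a \<or> x = a" by auto
  then show ?case using Cons by (auto simp: cnt_Cons)
qed simp

lemma sorted_before: "sorted_wrt (<) (u @ c # v) \<Longrightarrow> x \<in> set u \<Longrightarrow> x < (c::int)"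
  by (auto simp: sorted_wrt_append)
lemma sorted_after: "sorted_wrt (<) (u @ c # v) \<Longrightarrow> x \<in> set v \<Longrightarrow> c < (x::int)"
  by (auto simp: sorted_wrt_append)

lemma strict_distinct: "sorted_wrt (<) (l :: int list) \<Longrightarrow> distinct l"
  by (induction l) auto

lemma not_in_run:
  assumes "ok X (m # C)" "sorted_wrt (<) C"
  shows "m \<notin> set C"
proof
  assume "m \<in> set C"
  then obtain u v where C: "C = u @ m # v" by (auto simp: in_set_conv_decomp)
  then have "ok X ([] @ m # u @ m # v)" using assms(1) by simp
  from ok_between_append(2)[OF this] sorted_before[of u m v "m + 1"] assms(2) C show False by auto
qed

text \<open>Letters below m - 1 commute with m. If m - 1 occurs, the carry becomes m - 1 and is too
  small to meet anything after it, as m does not occur. Otherwise m + 1, m + 2, ... are met in turn,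
  each emitting its predecessor, until the first gap.\<close>

lemma pass_run:
  assumes "ok X (m # C)" "sorted_wrt (<) C"
  obtains
    (none) "pass m C = (C, m)"
  | (left) "m - 1 \<in> set C" "m \<notin> set C" "pass m C = (map (\<lambda>c. if c = m - 1 then m else c) C, m - 1)"
  | (right) m' where "m < m'" "{m + 1..m'} \<subseteq> set C" "m' + 1 \<notin> set C" "m - 1 \<notin> set C" "m \<notin> set C"
      "pass m C = (map (\<lambda>c. if m < c \<and> c \<le> m' then c - 1 else c) C, m')"
proof -
  have "pass m C = (C, m) \<or>
    (m - 1 \<in> set C \<and> m \<notin> set C \<and> pass m C = (map (\<lambda>c. if c = m - 1 then m else c) C, m - 1)) \<or>
    (\<exists>m'. m < m' \<and> {m + 1..m'} \<subseteq> set C \<and> m' + 1 \<notin> set C \<and> m - 1 \<notin> set C \<and> m \<notin> set C \<and>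
      pass m C = (map (\<lambda>c. if m < c \<and> c \<le> m' then c - 1 else c) C, m'))"
    using assms
  proof (induction C arbitrary: X m)
    case (Cons c C)
    have nm: "m \<notin> set (c # C)" by (rule not_in_run[OF Cons.prems])
    have s: "sorted_wrt (<) C" "\<And>d. d \<in> set C \<Longrightarrow> c < d" using Cons.prems(2) by auto
    consider "c = m - 1" | "c = m + 1" | "\<not> adj m c" unfolding adj_def by linarith
    then show ?case
    proof cases
      case 1
      have o: "ok (mv m X) (c # C)" using Cons.prems(1) by simp
      have "pass c C = (C, c)"
      proof -
        have "c + 1 \<notin> set C" "c - 1 \<notin> set C" using nm 1 s(2)[of "c - 1"] by auto
        then show ?thesis using Cons.IH[OF o s(1)] 1 by (auto simp: subset_iff)
      qed
      moreover have "map (\<lambda>d. if d = m - 1 then m else d) C = C"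
        using s(2) 1 by (intro map_idI) auto
      ultimately show ?thesis using 1 nm by (simp add: pass_Cons)
    next
      case 2
      have o: "ok (mv m X) (c # C)" using Cons.prems(1) by simp
      have c1: "c - 1 \<notin> set C" using s(2) by force
      have a: "adj m c" using 2 by (simp add: adj_def)
      have m1: "m - 1 \<notin> set (c # C)" using 2 s(2) by force
      from Cons.IH[OF o s(1)] c1 consider "pass c C = (C, c)" "c + 1 \<notin> set C"
        | m' where "c < m'" "{c + 1..m'} \<subseteq> set C" "m' + 1 \<notin> set C" "pass c C = (map (\<lambda>d. if c < d \<and> d \<le> m' then d - 1 else d) C, m')"
      proof (cases "c + 1 \<in> set C")
        case True
        have "pass c C \<noteq> (C, c)"
        proof (cases C)
          case (Cons d D)
          have "d = c + 1" using True s Cons by (cases "d = c + 1") (auto, force)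
          then show ?thesis using Cons by (simp add: pass_Cons)
        qed (use True in simp)
        then show ?thesis using that Cons.IH[OF o s(1)] c1 by blast
      next
        case False
        then have "{c + 1..m'} \<subseteq> set C \<Longrightarrow> \<not> c < m'" for m' by (auto simp: subset_iff)
        then show ?thesis using that False Cons.IH[OF o s(1)] c1 by blast
      qed
      then show ?thesis
      proof cases
        case 1
        have "map (\<lambda>d. if m < d \<and> d \<le> c then d - 1 else d) C = C"
          using s(2) by (intro map_idI) force
        then have "m < c \<and> {m + 1..c} \<subseteq> set (c # C) \<and> c + 1 \<notin> set (c # C) \<and> m - 1 \<notin> set (c # C) \<and> m \<notin> set (c # C) \<and>
          pass m (c # C) = (map (\<lambda>d. if m < d \<and> d \<le> c then d - 1 else d) (c # C), c)"
          using 1 2 a nm m1 by (simp add: pass_Cons)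
        then show ?thesis by blast
      next
        case (2 m')
        have "{m + 1..m'} \<subseteq> set (c # C)"
        proof
          fix d assume "d \<in> {m + 1..m'}"
          then show "d \<in> set (c # C)" using 2(2) \<open>c = m + 1\<close> by (cases "d = c") auto
        qed
        moreover have "map (\<lambda>d. if c < d \<and> d \<le> m' then d - 1 else d) C = map (\<lambda>d. if m < d \<and> d \<le> m' then d - 1 else d) C"
          using s(2) \<open>c = m + 1\<close> by (intro map_cong) force+
        ultimately have "m < m' \<and> {m + 1..m'} \<subseteq> set (c # C) \<and> m' + 1 \<notin> set (c # C) \<and> m - 1 \<notin> set (c # C) \<and> m \<notin> set (c # C) \<and>
          pass m (c # C) = (map (\<lambda>d. if m < d \<and> d \<le> m' then d - 1 else d) (c # C), m')"
          using 2 \<open>c = m + 1\<close> a nm m1 by (simp add: pass_Cons)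
        then show ?thesis by blast
      qed
    next
      case 3
      have ne: "m \<noteq> c" "m + 1 \<noteq> c" "m - 1 \<noteq> c" using 3 nm by (auto simp: adj_def)
      have "ok X ([] @ c # m # C)" using ok_fin_swap(1)[of m c X "[]" C] ne Cons.prems(1) by auto
      then have o: "ok (mv c X) (m # C)" by simp
      have p: "pass m (c # C) = (c # fst (pass m C), snd (pass m C))" using 3 by (simp add: pass_Cons)
      from Cons.IH[OF o s(1)] show ?thesis
      proof (elim disjE exE conjE)
        assume "pass m C = (C, m)"
        then show ?thesis using p by simp
      next
        assume "m - 1 \<in> set C" "pass m C = (map (\<lambda>c. if c = m - 1 then m else c) C, m - 1)"
        then show ?thesis using p ne nm by auto
      next
        fix m' assume h: "m < m'" "{m + 1..m'} \<subseteq> set C" "m' + 1 \<notin> set C" "m - 1 \<notin> set C"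
          "pass m C = (map (\<lambda>c. if m < c \<and> c \<le> m' then c - 1 else c) C, m')"
        have "m + 1 \<in> set C" using h(1,2) by (auto simp: subset_iff)
        then have cm: "c < m" using s(2)[of "m + 1"] ne by force
        then show ?thesis using p h ne nm by (intro disjI2 exI[of _ m']) auto
      qed
    qed
  qed simp
  then show ?thesis using that by blast
qed

lemma cnt_left:
  assumes "sorted_wrt (<) C" "m - 1 \<in> set C"
  shows "cnt x (map (\<lambda>c. if c = m - 1 then m else c) C) = cnt x C + (if x = m then 1 else 0)"
proof -
  have "cnt x (map (\<lambda>c. if c = m - 1 then m else c) C) = cnt x C + (if x = m \<and> m - 1 \<in> set C then 1 else 0)"
    using strict_distinct[OF assms(1)] by (induction C) (auto simp: cnt_Cons)
  then show ?thesis using assms(2) by simp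
qed

text \<open>The entries m + 1, ..., m' each drop by one, so each threshold in this interval loses
  the single entry equal to it.\<close>

lemma cnt_right:
  assumes "sorted_wrt (<) C" "{m + 1..m'} \<subseteq> set C"
  shows "cnt x (map (\<lambda>c. if m < c \<and> c \<le> m' then c - 1 else c) C) = cnt x C - (if m < x \<and> x \<le> m' then 1 else 0)"
proof -
  have "cnt x (map (\<lambda>c. if m < c \<and> c \<le> m' then c - 1 else c) C) =
    cnt x C - (if m < x \<and> x \<le> m' \<and> x \<in> set C then 1 else 0)"
    using strict_distinct[OF assms(1)] by (induction C) (auto simp: cnt_Cons)
  moreover have "m < x \<and> x \<le> m' \<Longrightarrow> x \<in> set C" using assms(2) by auto
  ultimately show ?thesis by auto
qed

text \<open>Lowering the threshold past y changes the excess of B over A by one for y in B and minus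
  one for y in A. Below z the excess does not fall while y stays in B, and it rises at the first y
  missing from A, at the latest at l. So the excess just above z is not maximal: the lattice
  condition has slack there.\<close>

lemma chain_down:
  assumes d: "distinct A" "distinct B" and l: "l \<notin> set A" "l \<le> z" and z: "z \<in> set B"
    and step: "\<And>y. l < y \<Longrightarrow> y \<le> z \<Longrightarrow> y \<in> set A \<Longrightarrow> y \<in> set B \<Longrightarrow> y - 1 \<in> set B"
  shows "\<exists>x\<le>z. cnt (z + 1) B - cnt (z + 1) A + 1 \<le> cnt x B - cnt x A"
  using l(2) z step
proof (induction "nat (z - l)" arbitrary: z)
  case 0
  then have "z \<notin> set A" using l by auto
  then show ?case using cnt_step[OF d(1), of z] cnt_step[OF d(2), of z] 0 by (intro exI[of _ z]) auto
next
  case (Suc k)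
  show ?case
  proof (cases "z \<in> set A")
    case True
    then have "z - 1 \<in> set B" "l \<le> z - 1" using Suc.prems l(1) Suc.hyps(2) by auto
    moreover have "k = nat (z - 1 - l)" using Suc.hyps(2) by auto
    ultimately obtain x where "x \<le> z - 1" "cnt z B - cnt z A + 1 \<le> cnt x B - cnt x A"
      using Suc.hyps(1)[of "z - 1"] Suc.prems(3) by auto
    then show ?thesis using cnt_step[OF d(1), of z] cnt_step[OF d(2), of z] True Suc.prems(2)
      by (intro exI[of _ x]) auto
  next
    case False
    then show ?thesis using cnt_step[OF d(1), of z] cnt_step[OF d(2), of z] Suc.prems(2) by (intro exI[of _ z]) auto
  qed
qed

text \<open>The mirror image of \<open>chain_down\<close>: raising the threshold, the excess of B
  over A stays constant while both runs continue and rises where B has its first gap.\<close>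

lemma chain_up:
  assumes d: "distinct A" "distinct B" and l: "l \<notin> set B" "z \<le> l" and z: "z \<in> set A"
    and step: "\<And>y. z \<le> y \<Longrightarrow> y \<in> set A \<Longrightarrow> y \<in> set B \<Longrightarrow> y + 1 \<in> set A"
  shows "\<exists>x>z. cnt z B - cnt z A + 1 \<le> cnt x B - cnt x A"
  using l(2) z step
proof (induction "nat (l - z)" arbitrary: z)
  case 0
  then have "z \<notin> set B" using l by auto
  then show ?case using cnt_step[OF d(1), of z] cnt_step[OF d(2), of z] 0 by (intro exI[of _ "z + 1"]) auto
next
  case (Suc k)
  show ?case
  proof (cases "z \<in> set B")
    case True
    then have "z + 1 \<in> set A" "z + 1 \<le> l" using Suc.prems l(1) Suc.hyps(2) by auto
    moreover have "k = nat (l - (z + 1))" using Suc.hyps(2) by auto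
    ultimately obtain x where "z + 1 < x" "cnt (z + 1) B - cnt (z + 1) A + 1 \<le> cnt x B - cnt x A"
      using Suc.hyps(1)[of "z + 1"] Suc.prems(3) by auto
    then show ?thesis using cnt_step[OF d(1), of z] cnt_step[OF d(2), of z] True Suc.prems(2)
      by (intro exI[of _ x]) auto
  next
    case False
    then show ?thesis using cnt_step[OF d(1), of z] cnt_step[OF d(2), of z] Suc.prems(2)
      by (intro exI[of _ "z + 1"]) auto
  qed
qed

lemma bounded_notin: "\<exists>l\<ge>z. l \<notin> set (B :: int list)" "\<exists>l\<le>z. l \<notin> set B"
proof -
  have "finite (set B)" by simp
  moreover have "infinite {z..}" "infinite {..z}" using infinite_Ici infinite_Iic by blast+
  ultimately have "\<not> {z..} \<subseteq> set B" "\<not> {..z} \<subseteq> set B" using finite_subset by blast+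
  then show "\<exists>l\<ge>z. l \<notin> set B" "\<exists>l\<le>z. l \<notin> set B" by auto
qed

text \<open>If m - 1 is raised to m, only the threshold m changes, and the slack needed there comes
  from \<open>chain_down\<close>. If m + 1, ..., m' are lowered, the conditions given up are those
  with m < x \<le> m'; these contents lie in B and m is not in A, so the excess there is at most the
  one at m, whose condition is kept. The hypotheses \<open>R\<close> and \<open>L\<close> are what
  the path must provide.\<close>

lemma lattice_pass_right:
  assumes o: "ok X (m # C)" and s: "sorted_wrt (<) (Bp @ C)" and d: "distinct A"
    and R: "m + 1 \<in> set C \<Longrightarrow> m - 1 \<notin> set C \<Longrightarrow> m \<notin> set A"
    and L: "m - 1 \<in> set C \<Longrightarrow> \<exists>l\<le>m - 1. l \<notin> set A \<and>
      (\<forall>y. l < y \<longrightarrow> y \<le> m - 1 \<longrightarrow> y \<in> set A \<longrightarrow> y \<in> set (Bp @ C) \<longrightarrow> y - 1 \<in> set (Bp @ C))"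
  shows "lattice A (Bp @ C) \<longleftrightarrow> lattice A (Bp @ fst (pass m C))"
proof -
  have sC: "sorted_wrt (<) C" using s by (simp add: sorted_wrt_append)
  have dB: "distinct (Bp @ C)" by (rule strict_distinct[OF s])
  note st = cnt_step[OF d] and sb = cnt_step[OF dB]
  show ?thesis
  proof (cases rule: pass_run[OF o sC])
    case 2
    have c: "cnt x (fst (pass m C)) = cnt x C + (if x = m then 1 else 0)" for x
      unfolding 2(3) fst_conv by (rule cnt_left[OF sC 2(1)])
    show ?thesis
    proof
      assume h: "lattice A (Bp @ C)"
      obtain l where l: "l \<le> m - 1" "l \<notin> set A"
        "\<And>y. l < y \<Longrightarrow> y \<le> m - 1 \<Longrightarrow> y \<in> set A \<Longrightarrow> y \<in> set (Bp @ C) \<Longrightarrow> y - 1 \<in> set (Bp @ C)"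
        using L[OF 2(1)] by blast
      have "m - 1 \<in> set (Bp @ C)" using 2(1) by simp
      from chain_down[OF d dB l(2,1) this l(3)] obtain x where
        "cnt m (Bp @ C) - cnt m A + 1 \<le> cnt x (Bp @ C) - cnt x A" by auto
      moreover have "cnt x (Bp @ C) \<le> cnt x A" using h unfolding lattice_def by blast
      ultimately have "cnt m (Bp @ C) + 1 \<le> cnt m A" by linarith
      then show "lattice A (Bp @ fst (pass m C))" using h c by (auto simp: lattice_def)
    next
      assume h: "lattice A (Bp @ fst (pass m C))"
      show "lattice A (Bp @ C)" unfolding lattice_def
      proof
        fix x
        have "cnt x (Bp @ fst (pass m C)) \<le> cnt x A" using h unfolding lattice_def by blast
        then show "cnt x (Bp @ C) \<le> cnt x A" using c[of x] by (simp split: if_splits)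
      qed
    qed
  next
    case (3 m')
    have c: "cnt x (fst (pass m C)) = cnt x C - (if m < x \<and> x \<le> m' then 1 else 0)" for x
      unfolding 3(6) fst_conv by (rule cnt_right[OF sC 3(2)])
    have "m + 1 \<in> set C" using 3(1,2) by auto
    then have mA: "m \<notin> set A" using R 3(4) by blast
    show ?thesis
    proof
      assume h: "lattice A (Bp @ C)"
      show "lattice A (Bp @ fst (pass m C))" unfolding lattice_def
      proof
        fix x
        have "cnt x (Bp @ C) \<le> cnt x A" using h unfolding lattice_def by blast
        then show "cnt x (Bp @ fst (pass m C)) \<le> cnt x A" using c[of x] by (simp split: if_splits)
      qed
    next
      assume h: "lattice A (Bp @ fst (pass m C))"
      have up: "cnt x (Bp @ C) - cnt x A \<le> cnt m (Bp @ C) - cnt m A" if "m < x" "x \<le> m'" for x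
      proof -
        have "m + 1 \<le> x" using that by simp
        then have "cnt x (Bp @ C) - cnt x A \<le> cnt (m + 1) (Bp @ C) - cnt (m + 1) A"
          using that(2)
        proof (induction x rule: int_ge_induct)
          case (step k)
          then have "k \<in> {m + 1..m'}" by simp
          then have "k \<in> set (Bp @ C)" using 3(2) by auto
          then show ?case using step.IH step.prems st[of k] sb[of k] by (auto split: if_splits)
        qed simp
        then show ?thesis using st[of m] sb[of m] mA by (auto split: if_splits)
      qed
      show "lattice A (Bp @ C)" unfolding lattice_def
      proof
        fix x
        have x: "cnt x (Bp @ fst (pass m C)) \<le> cnt x A" "cnt m (Bp @ fst (pass m C)) \<le> cnt m A"
          using h unfolding lattice_def by blast+
        show "cnt x (Bp @ C) \<le> cnt x A"
        proof (cases "m < x \<and> x \<le> m'")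
          case True
          then show ?thesis using up[of x] x(2) c[of m] by auto
        next
          case False
          then show ?thesis using x(1) c[of x] by auto
        qed
      qed
    qed
  qed simp
qed

lemma ok_between_sorted:
  assumes o: "ok X (u @ c # w @ B)" and s: "sorted_wrt (<) B" and c: "c \<in> set B"
  shows "c + 1 \<in> set w" "c - 1 \<in> set w \<or> c - 1 \<in> set B"
proof -
  obtain B1 B2 where B: "B = B1 @ c # B2" using c by (auto simp: in_set_conv_decomp)
  have o': "ok X (u @ c # (w @ B1) @ c # B2)" using o B by simp
  have "c + 1 \<notin> set B1" using sorted_before[of B1 c B2 "c + 1"] s B by auto
  then show "c + 1 \<in> set w" "c - 1 \<in> set w \<or> c - 1 \<in> set B"
    using ok_between_append[OF o'] B by auto
qed

text \<open>If m - 1 is raised to m, the condition at m is weakened. When m is in B, the path forces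
  m + 1 into C, and \<open>chain_up\<close> derives the old condition at m from one at a larger
  threshold. If m + 1, ..., m' are lowered, the excess of B over A for m < x \<le> m' is at most the
  one at m', and that is negative because m' is in A but not in B.\<close>

lemma lattice_pass_left:
  assumes o: "ok X (m # C @ B)" and s: "sorted_wrt (<) (Ap @ C)" and sB: "sorted_wrt (<) B"
  shows "lattice (Ap @ C) B \<longleftrightarrow> lattice (Ap @ fst (pass m C)) B"
proof -
  have sC: "sorted_wrt (<) C" using s by (simp add: sorted_wrt_append)
  have dA: "distinct (Ap @ C)" by (rule strict_distinct[OF s])
  have dB: "distinct B" by (rule strict_distinct[OF sB])
  have oC: "ok X (m # C)" using o by simp
  note sa = cnt_step[OF dA] and sb = cnt_step[OF dB]
  \<comment> \<open>Between two occurrences of x there is an x + 1, and in the increasing run B it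
    would come too late.\<close>
  have AB: "x + 1 \<in> set C" if x: "x \<in> set C" "x \<in> set B" for x
  proof -
    obtain C1 C2 where C: "C = C1 @ x # C2" using x(1) by (auto simp: in_set_conv_decomp)
    have "ok X ((m # C1) @ x # C2 @ B)" using o C by simp
    from ok_between_sorted(1)[OF this sB x(2)] show ?thesis using C by simp
  qed
  show ?thesis
  proof (cases rule: pass_run[OF oC sC])
    case 2
    have c: "cnt x (fst (pass m C)) = cnt x C + (if x = m then 1 else 0)" for x
      unfolding 2(3) fst_conv by (rule cnt_left[OF sC 2(1)])
    have less: "x < m - 1" if "x \<in> set Ap" for x using s 2(1) that by (auto simp: sorted_wrt_append)
    have mA: "m \<notin> set (Ap @ C)" using 2(2) less by force
    show ?thesis
    proof
      assume h: "lattice (Ap @ C) B"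
      show "lattice (Ap @ fst (pass m C)) B" unfolding lattice_def
      proof
        fix x
        have "cnt x B \<le> cnt x (Ap @ C)" using h unfolding lattice_def by blast
        then show "cnt x B \<le> cnt x (Ap @ fst (pass m C))" using c[of x] by (simp split: if_splits)
      qed
    next
      assume h: "lattice (Ap @ fst (pass m C)) B"
      have h': "cnt x B \<le> cnt x (Ap @ C)" if "x \<noteq> m" for x
        using h c[of x] that unfolding lattice_def by (metis add.right_neutral cnt_append)
      have "cnt m B \<le> cnt m (Ap @ C)"
      proof (cases "m \<in> set B")
        case False
        then show ?thesis using sa[of m] sb[of m] mA h'[of "m + 1"] by simp
      next
        case True
        have "ok X ([] @ m # C @ B)" using o by simp
        from ok_between_sorted(1)[OF this sB True] have m1: "m + 1 \<in> set (Ap @ C)" by simp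
        obtain l where l: "m + 1 \<le> l" "l \<notin> set B" using bounded_notin(1) by blast
        have "\<exists>x>m + 1. cnt (m + 1) B - cnt (m + 1) (Ap @ C) + 1 \<le> cnt x B - cnt x (Ap @ C)"
        proof (rule chain_up[OF dA dB l(2,1) m1])
          fix y assume "m + 1 \<le> y" "y \<in> set (Ap @ C)" "y \<in> set B"
          then show "y + 1 \<in> set (Ap @ C)" using AB[of y] less[of y] by auto
        qed
        then obtain x where "x > m + 1" "cnt (m + 1) B - cnt (m + 1) (Ap @ C) + 1 \<le> cnt x B - cnt x (Ap @ C)"
          by blast
        then show ?thesis using h'[of x] sa[of m] sb[of m] mA True by simp
      qed
      then show "lattice (Ap @ C) B" using h' unfolding lattice_def by metis
    qed
  next
    case (3 m')
    have c: "cnt x (fst (pass m C)) = cnt x C - (if m < x \<and> x \<le> m' then 1 else 0)" for x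
      unfolding 3(6) fst_conv by (rule cnt_right[OF sC 3(2)])
    have m': "m' \<in> set C" using 3(1,2) by auto
    then have mB: "m' \<notin> set B" using AB[of m'] 3(3) by blast
    show ?thesis
    proof
      assume h: "lattice (Ap @ fst (pass m C)) B"
      show "lattice (Ap @ C) B" unfolding lattice_def
      proof
        fix x
        have "cnt x B \<le> cnt x (Ap @ fst (pass m C))" using h unfolding lattice_def by blast
        then show "cnt x B \<le> cnt x (Ap @ C)" using c[of x] by (simp split: if_splits)
      qed
    next
      assume h: "lattice (Ap @ C) B"
      have up: "cnt x B - cnt x (Ap @ C) \<le> cnt m' B - cnt m' (Ap @ C)" if "m < x" "x \<le> m'" for x
        using that(2,1)
      proof (induction x rule: int_le_induct)
        case (step k)
        then have "k - 1 \<in> {m + 1..m'}" by simp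
        with 3(2) have "k - 1 \<in> set C" by blast
        then have "k - 1 \<in> set (Ap @ C)" by simp
        then show ?case using step.IH step.prems sa[of "k - 1"] sb[of "k - 1"] by (auto split: if_splits)
      qed simp
      show "lattice (Ap @ fst (pass m C)) B" unfolding lattice_def
      proof
        fix x
        have x: "cnt x B \<le> cnt x (Ap @ C)" "cnt (m' + 1) B \<le> cnt (m' + 1) (Ap @ C)"
          using h unfolding lattice_def by blast+
        show "cnt x B \<le> cnt x (Ap @ fst (pass m C))"
        proof (cases "m < x \<and> x \<le> m'")
          case True
          then show ?thesis using up[of x] x(2) c[of x] sa[of m'] sb[of m'] m' mB by auto
        next
          case False
          then show ?thesis using x(1) c[of x] by auto
        qed
      qed
    qed
  qed simp
qed

lemma transp_less_int: "transp ((<) :: int \<Rightarrow> int \<Rightarrow> bool)" by (simp add: transp_on_def)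

lemma sorted_iff_Suc: "sorted_wrt (<) (l :: int list) \<longleftrightarrow> (\<forall>i. Suc i < length l \<longrightarrow> l ! i < l ! Suc i)"
  using sorted_wrt_iff_nth_Suc_transp[OF transp_less_int] .

lemma sorted_pass:
  assumes "ok X (m # C)" "sorted_wrt (<) C"
  shows "sorted_wrt (<) (fst (pass m C))"
  using assms pass_less[OF assms(1)] by (auto simp: sorted_iff_Suc)

lemma sorted_passes:
  assumes "ok X (ms @ us)" "sorted_wrt (<) us"
  shows "sorted_wrt (<) (fst (passes ms us))"
  using assms
proof (induction ms arbitrary: X)
  case (Cons m ms)
  have "ok (mv m X) (ms @ us)" using Cons.prems by simp
  note IH = Cons.IH[OF this Cons.prems(2)] and p = passes_ok[OF this]
  have "ok X (m # fst (passes ms us))" using p Cons.prems by simp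
  from sorted_pass[OF this IH] show ?case by simp
qed simp

text \<open>A run of equal labels stays increasing while its letters are processed from the right,
  so \<open>pass_run\<close> applies at every stage. Only the junction matters: b is below y and is
  not its partner \<open>- 1 - y\<close>, hence below \<open>self y\<close> as well.\<close>

lemma sorted_append_full:
  assumes "ok X (dbl (Bp @ Bs))" "sorted_wrt (<) (Bp @ Bs)"
  shows "sorted_wrt (<) (Bp @ fst (full Bs))"
proof (cases "Bp = [] \<or> Bs = []")
  case True
  then show ?thesis
  proof
    assume "Bp = []"
    then show ?thesis using assms full_less[of X Bs] by (auto simp: sorted_iff_Suc)
  qed (use assms in auto)
next
  case False
  then obtain b Bp' y Bs' where B: "Bp = Bp' @ [b]" "Bs = y # Bs'"
    by (metis neq_Nil_conv rev_exhaust)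
  have o: "ok (fin X (dbl Bp)) (dbl Bs)" "ok (fin X (dbl Bp')) (dbl [b] @ dbl Bs)"
    using assms(1) B by simp_all
  have sU: "sorted_wrt (<) (fst (full Bs))"
    using assms(2) full_less[OF o(1)] by (auto simp: sorted_iff_Suc sorted_wrt_append)
  have "b < y" using assms(2) B by (simp add: sorted_wrt_append)
  moreover have "b \<noteq> - 1 - y" using ok_letters2[of "fin X (dbl Bp')" "[]" b y "dbl Bs'"] o(2) B by simp
  moreover have hd: "fst (full Bs) = self y # fst (pass (mself y) (fst (full Bs')))"
    using B pass_self by simp
  ultimately have "b < self y" by (auto simp: self_def)
  then have "x < self y" if "x \<in> set Bp" for x
    using that assms(2) B by (auto simp: sorted_wrt_append)
  moreover have "self y \<le> z" if "z \<in> set (fst (full Bs))" for z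
    using that sU unfolding hd by auto
  moreover have "sorted_wrt (<) Bp" using assms(2) by (simp add: sorted_wrt_append)
  ultimately show ?thesis using sU by (force simp: sorted_wrt_append)
qed

text \<open>One letter passes the A run and what comes out passes the B run. The side conditions of
  \<open>lattice_pass_right\<close> for the new letters of A follow from \<open>ok_between\<close>;
  they have to be assumed only for the part Ap that is not passed.\<close>

lemma lattice_step:
  assumes o: "ok X (m # C @ D)" and s: "sorted_wrt (<) (Ap @ C)" "sorted_wrt (<) (Ap @ fst (pass m C))" "sorted_wrt (<) D"
    and R: "snd (pass m C) + 1 \<in> set D \<Longrightarrow> snd (pass m C) \<notin> set Ap"
    and L: "\<And>z. z \<le> snd (pass m C) - 1 \<Longrightarrow> z \<in> set Ap \<Longrightarrow> z \<in> set D \<Longrightarrow> z - 1 \<in> set D"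
  shows "lattice (Ap @ C) D \<longleftrightarrow> lattice (Ap @ fst (pass m C)) (fst (pass (snd (pass m C)) D))"
proof -
  define C' where "C' = fst (pass m C)"
  define m' where "m' = snd (pass m C)"
  have oC: "ok X (m # C)" "ok (fin X (m # C)) D" using o by simp_all
  have o': "ok X (C' @ m' # D)" using pass_ok[OF oC(1)] oC(2) by (simp add: C'_def m'_def)
  have sC': "sorted_wrt (<) C'" using s(2) by (simp add: C'_def sorted_wrt_append)
  have "lattice (Ap @ C) D \<longleftrightarrow> lattice (Ap @ C') D"
    unfolding C'_def by (rule lattice_pass_left[OF o s(1,3)])
  also have "\<dots> \<longleftrightarrow> lattice (Ap @ C') (fst (pass m' D))"
  proof (rule lattice_pass_right[of "fin X C'" m' D "[]" "Ap @ C'", simplified append.simps])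
    show "ok (fin X C') (m' # D)" using o' by simp
    show "sorted_wrt (<) D" by (rule s(3))
    show "distinct (Ap @ C')" using strict_distinct[OF s(2)] by (simp add: C'_def)
    have later: False if "y \<in> set C'" "C' = u @ y # v" "y - 1 \<in> set v" for y u v
      using sorted_after[of u y v "y - 1"] sC' that by auto
    show "m' \<notin> set (Ap @ C')" if "m' + 1 \<in> set D" "m' - 1 \<notin> set D"
    proof -
      have "m' \<notin> set C'"
      proof
        assume m': "m' \<in> set C'"
        then obtain u v where C': "C' = u @ m' # v" by (auto simp: in_set_conv_decomp)
        then have "ok X (u @ m' # v @ m' # D)" using o' by simp
        from ok_between_append(1)[OF this] later[OF m' C'] show False by blast
      qed
      then show ?thesis using R that by (simp add: m'_def)
    qed
    show "\<exists>l\<le>m' - 1. l \<notin> set (Ap @ C') \<and>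
      (\<forall>y>l. y \<le> m' - 1 \<longrightarrow> y \<in> set (Ap @ C') \<longrightarrow> y \<in> set D \<longrightarrow> y - 1 \<in> set D)" if "m' - 1 \<in> set D"
    proof -
      obtain l where l: "l \<le> m' - 1" "l \<notin> set (Ap @ C')" using bounded_notin(2) by blast
      have "y - 1 \<in> set D" if y: "y \<le> m' - 1" "y \<in> set (Ap @ C')" "y \<in> set D" for y
      proof (cases "y \<in> set C'")
        case True
        then obtain u v where C': "C' = u @ y # v" by (auto simp: in_set_conv_decomp)
        then have "ok X (u @ y # (v @ [m']) @ D)" using o' by simp
        from ok_between_sorted(2)[OF this s(3) y(3)] later[OF True C'] y(1) show ?thesis by auto
      next
        case False
        then show ?thesis using y L by (simp add: m'_def)
      qed
      then show ?thesis using l by blast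
    qed
  qed
  finally show ?thesis by (simp add: C'_def m'_def)
qed

lemma in_dbl: "x \<in> set (dbl ys) \<longleftrightarrow> x \<in> set ys \<or> - 1 - x \<in> set ys"
proof (induction ys)
  case (Cons y ys)
  have "x = - 1 - y \<longleftrightarrow> - 1 - x = y" by auto
  with Cons show ?case by auto
qed simp

lemma in_dblE:
  assumes "x \<in> set (dbl ys)"
  obtains u where "u \<in> set ys" "x = u \<or> x = - 1 - u"
  using assms in_dbl[of x ys] that[of x] that[of "- 1 - x"] by auto

text \<open>If a letter of an increasing run that is still doubled occurs again, a - 1 stands in
  between. Among the doubled later letters u > a of the run, a - 1 can only be the left half of u =
  - a.\<close>

lemma raw_between:
  assumes o: "ok X (dbl Ap @ w @ a # v)" and s: "sorted_wrt (<) Ap" and a: "a \<in> set Ap"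
  shows "a - 1 \<in> set w \<or> - a \<in> set Ap \<and> a < - a"
proof -
  obtain A1 A2 where A: "Ap = A1 @ a # A2" using a by (auto simp: in_set_conv_decomp)
  have "ok X ((dbl A1 @ [- 1 - a]) @ a # (dbl A2 @ w) @ a # v)" using o A by simp
  from ok_between_append(1)[OF this] have "a - 1 \<in> set (dbl A2) \<or> a - 1 \<in> set w" by simp
  moreover have "- a \<in> set A2 \<and> a < - a" if dA: "a - 1 \<in> set (dbl A2)"
  proof -
    obtain u where u: "u \<in> set A2" "a - 1 = u \<or> a - 1 = - 1 - u" using dA by (rule in_dblE)
    then have "a < u" using sorted_after[of A1 a A2 u] s A by simp
    then have "u = - a" using u(2) by auto
    then show ?thesis using u(1) \<open>a < u\<close> by simp
  qed
  ultimately show ?thesis using A by auto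
qed

text \<open>The letters of B are processed from the right while A and the beginning Bp of B are
  still doubled. The side conditions of \<open>lattice_pass_right\<close> come from
  \<open>raw_between\<close>.\<close>

lemma lattice_full_right:
  assumes "ok X (dbl A @ dbl Bp @ dbl Bs)" "-1 \<notin> set A" "sorted_wrt (<) A" "sorted_wrt (<) (Bp @ Bs)"
  shows "lattice A (Bp @ Bs) \<longleftrightarrow> lattice A (Bp @ fst (full Bs))"
  using assms
proof (induction Bs arbitrary: Bp)
  case (Cons y Bs)
  define C where "C = fst (full Bs)"
  define m where "m = - 1 - y"
  let ?X = "fin X (dbl A @ dbl Bp)"
  have o1: "ok ?X (m # y # dbl Bs)" using Cons.prems(1) by (simp add: m_def)
  then have "ok (fin ?X [m, y]) (dbl Bs)" by simp
  from full_ok[OF this] o1 have o2: "ok ?X (m # y # C)" by (simp add: C_def)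
  have "ok X (dbl A @ dbl (Bp @ [y]) @ dbl Bs)" using Cons.prems(1) by simp
  from Cons.IH[OF this Cons.prems(2,3)] Cons.prems(4)
  have "lattice A (Bp @ y # Bs) \<longleftrightarrow> lattice A (Bp @ y # C)" by (simp add: C_def)
  also have "\<dots> \<longleftrightarrow> lattice A (Bp @ fst (pass m (y # C)))"
  proof (rule lattice_pass_right[OF o2])
    have "ok (fin X (dbl A)) (dbl ((Bp @ [y]) @ Bs))" using Cons.prems(1) by simp
    from sorted_append_full[OF this] Cons.prems(4) show s: "sorted_wrt (<) (Bp @ y # C)" by (simp add: C_def)
    show "distinct A" by (rule strict_distinct[OF Cons.prems(3)])
    have ge: "y \<le> c" if "c \<in> set (y # C)" for c using s that by (auto simp: sorted_wrt_append)
    have lt: "u < y" if "u \<in> set Bp" for u using s that by (auto simp: sorted_wrt_append)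
    have o3: "ok X (dbl A @ dbl Bp @ m # y # C)" using o2 Cons.prems(1) by simp
    show "m \<notin> set A" if "m + 1 \<in> set (y # C)" "m - 1 \<notin> set (y # C)"
    proof
      assume mA: "m \<in> set A"
      have "m \<ge> -1" using ge[OF that(1)] by (simp add: m_def)
      moreover have "m \<noteq> -1" using mA Cons.prems(2) by blast
      ultimately have m: "m \<ge> 0" by simp
      then have "m - 1 \<in> set (dbl Bp)" using raw_between[OF o3 Cons.prems(3) mA] by auto
      \<comment> \<open>Letters of Bp are below y = -1 - m, so their halves are below -1 - m or
        above m, and never equal to m - 1.\<close>
      then obtain u where "u \<in> set Bp" "m - 1 = u \<or> m - 1 = - 1 - u" by (rule in_dblE)
      then show False using lt[of u] m by (auto simp: m_def)
    qed
    show "\<exists>l\<le>m - 1. l \<notin> set A \<and> (\<forall>z>l. z \<le> m - 1 \<longrightarrow> z \<in> set A \<longrightarrow> z \<in> set (Bp @ y # C) \<longrightarrow> z - 1 \<in> set (Bp @ y # C))"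
      if "m - 1 \<in> set (y # C)"
    proof -
      have m: "m \<ge> 0" using ge[OF that] by (simp add: m_def)
      have "z - 1 \<in> set (Bp @ y # C)" if z: "-1 < z" "z \<le> m - 1" "z \<in> set A" "z \<in> set (Bp @ y # C)" for z
      proof -
        have "z \<notin> set Bp" using lt[of z] z(1) m by (auto simp: m_def)
        then have "z \<in> set (y # C)" using z(4) by auto
        then obtain C1 C2 where C: "y # C = C1 @ z # C2" by (meson split_list)
        have "ok X (dbl A @ (dbl Bp @ m # C1) @ z # C2)" using o3 C by simp
        from raw_between[OF this Cons.prems(3) z(3)] z(1)
        consider "z - 1 \<in> set (dbl Bp)" | "z - 1 = m" | "z - 1 \<in> set C1" by auto
        then show ?thesis
        proof cases
          case 1
          then obtain u where "u \<in> set Bp" "z - 1 = u \<or> z - 1 = - 1 - u" by (rule in_dblE)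
          then show ?thesis using lt[of u] z(2) by (auto simp: m_def)
        next
          case 3
          then show ?thesis unfolding C by simp
        qed (use z in auto)
      qed
      \<comment> \<open>The gap l of A is -1, a letter that does not occur in shifted words.\<close>
      then show ?thesis using m Cons.prems(2) by (intro exI[of _ "-1"]) auto
    qed
  qed
  finally show ?case by (simp add: C_def m_def)
qed simp

text \<open>Now the letters of A are processed from the right, and every carry that leaves the A run
  goes on through the B run. This is \<open>lattice_step\<close>, with \<open>raw_between\<close>
  for the part Ap that is still doubled.\<close>

lemma lattice_full_left:
  assumes "ok X (dbl Ap @ dbl As @ B)" "-1 \<notin> set Ap" "-1 \<notin> set As" "sorted_wrt (<) (Ap @ As)" "sorted_wrt (<) B"
  shows "lattice (Ap @ As) B \<longleftrightarrow> lattice (Ap @ fst (full As)) (fst (passes (snd (full As)) B))"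
  using assms
proof (induction As arbitrary: Ap)
  case (Cons y As)
  define C where "C = fst (full As)"
  define V where "V = snd (full As)"
  define D where "D = fst (passes V B)"
  define m where "m = - 1 - y"
  let ?X = "fin X (dbl Ap)"
  have okY: "ok (fin ?X [m, y]) (dbl As)" "ok (fin (fin ?X [m, y]) (dbl As)) B"
    using Cons.prems(1) by (simp_all add: m_def)
  have CV: "ok (fin ?X [m, y]) (C @ V)" "fin (fin ?X [m, y]) (C @ V) = fin (fin ?X [m, y]) (dbl As)"
    using full_ok[OF okY(1)] by (simp_all add: C_def V_def)
  have VB: "ok (fin (fin ?X [m, y]) C) (V @ B)" using CV okY(2) by simp
  have o2: "ok ?X (m # y # C @ D)"
    using passes_ok[OF VB] CV(1) Cons.prems(1) by (simp add: D_def m_def)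
  have sD: "sorted_wrt (<) D" unfolding D_def by (rule sorted_passes[OF VB Cons.prems(5)])
  have "ok X (dbl ((Ap @ [y]) @ As))" using Cons.prems(1) by simp
  from sorted_append_full[OF this] Cons.prems(4) have s1: "sorted_wrt (<) (Ap @ y # C)" by (simp add: C_def)
  have "ok X (dbl (Ap @ y # As))" using Cons.prems(1) by simp
  from sorted_append_full[OF this] Cons.prems(4) have s2: "sorted_wrt (<) (Ap @ fst (pass m (y # C)))"
    by (simp add: C_def m_def)
  have "ok X (dbl (Ap @ [y]) @ dbl As @ B)" using Cons.prems(1) by simp
  from Cons.IH[OF this] Cons.prems have "lattice (Ap @ y # As) B \<longleftrightarrow> lattice (Ap @ y # C) D"
    by (simp add: C_def D_def V_def)
  also have "\<dots> \<longleftrightarrow> lattice (Ap @ fst (pass m (y # C))) (fst (pass (snd (pass m (y # C))) D))"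
  proof (rule lattice_step[of ?X m "y # C" D Ap, OF _ s1 s2 sD])
    show "ok ?X (m # (y # C) @ D)" using o2 by simp
    define C' where "C' = fst (pass m (y # C))"
    define m' where "m' = snd (pass m (y # C))"
    have o3: "ok ?X (m # y # C)" using o2 by (simp del: ok.simps add: ok_append[of ?X "m # y # C", simplified append.simps])
    have o4: "ok X (dbl Ap @ C' @ m' # D)"
    proof -
      have "ok (fin ?X (m # y # C)) D" using o2 by simp
      with pass_ok[OF o3] show ?thesis using Cons.prems(1) by (simp add: C'_def m'_def)
    qed
    have sAp: "sorted_wrt (<) Ap" using s1 by (simp add: sorted_wrt_append)
    have small: "z \<notin> set C'" "z - 1 \<notin> set C'" if "z \<in> set Ap" for z
      using s2 that unfolding C'_def[symmetric] by (force simp: sorted_wrt_append)+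
    \<comment> \<open>Such a letter - z of Ap is at least 2, so y exceeds 2 and the moving letter
      \<open>- 1 - y\<close> lies far below the run \<open>y # C\<close>: it passes
      unchanged.\<close>
    have neg: "m' = - 1 - y \<and> - z < y" if z: "- z \<in> set Ap" "z < - z" "z \<noteq> -1" for z
    proof -
      have zy: "- z < y" using s1 z(1) by (auto simp: sorted_wrt_append)
      then have y: "2 < y" using z by linarith
      have ge: "y \<le> c" if "c \<in> set (y # C)" for c using s1 that by (auto simp: sorted_wrt_append)
      have sy: "sorted_wrt (<) (y # C)" using s1 by (simp add: sorted_wrt_append)
      have "m' = m"
      proof (cases rule: pass_run[OF o3 sy])
        case 2
        then show ?thesis using ge[of "m - 1"] y by (auto simp: m_def)
      next
        case (3 x)
        from 3(1) have "m + 1 \<in> {m + 1..x}" by simp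
        with 3(2) have "m + 1 \<in> set (y # C)" by blast
        then show ?thesis using ge[of "m + 1"] y by (auto simp: m_def)
      qed (simp_all add: m'_def)
      then show ?thesis using zy by (simp add: m_def)
    qed
    show "snd (pass m (y # C)) \<notin> set Ap" if "snd (pass m (y # C)) + 1 \<in> set D"
      unfolding m'_def[symmetric]
    proof
      assume a: "m' \<in> set Ap"
      from raw_between[OF o4 sAp a] small(2)[OF a] have "- m' \<in> set Ap" "m' < - m'" by auto
      moreover have "m' \<noteq> -1" using a Cons.prems(2) by blast
      ultimately show False using neg[of m'] by auto
    qed
    show "z - 1 \<in> set D" if "z \<le> snd (pass m (y # C)) - 1" "z \<in> set Ap" "z \<in> set D" for z
    proof -
      obtain D1 D2 where D: "D = D1 @ z # D2" using \<open>z \<in> set D\<close> by (auto simp: in_set_conv_decomp)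
      have "ok X (dbl Ap @ (C' @ m' # D1) @ z # D2)" using o4 D by simp
      from raw_between[OF this sAp that(2)] small(2)[OF that(2)] that(1)
      consider "z - 1 \<in> set D1" | "- z \<in> set Ap" "z < - z" by (auto simp: m'_def[symmetric])
      then show ?thesis
      proof cases
        case 2
        moreover have "z \<noteq> -1" using that(2) Cons.prems(2) by blast
        ultimately show ?thesis using neg[of z] that(1) unfolding m'_def[symmetric] by linarith
      qed (simp add: D)
    qed
  qed
  finally show ?case by (simp add: C_def D_def V_def m_def)
qed simp

lemma lattice_passes:
  assumes "ok X (ms @ A @ B)" "sorted_wrt (<) A" "sorted_wrt (<) B"
  shows "lattice A B \<longleftrightarrow> lattice (fst (passes ms A)) (fst (passes (snd (passes ms A)) B))"
  using assms
proof (induction ms arbitrary: X)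
  case (Cons m ms)
  define A' where "A' = fst (passes ms A)"
  define ms' where "ms' = snd (passes ms A)"
  define B' where "B' = fst (passes ms' B)"
  have o1: "ok (mv m X) (ms @ A @ B)" "ok (mv m X) (ms @ A)" using Cons.prems(1) by simp_all
  have o2: "ok (mv m X) (A' @ ms' @ B)" using passes_ok[OF o1(2)] o1(1) by (simp add: A'_def ms'_def)
  then have o3: "ok (fin (mv m X) A') (ms' @ B)" by simp
  have o4: "ok X (m # A' @ B')" using passes_ok[OF o3] o2 Cons.prems(1) by (simp add: B'_def)
  have sA: "sorted_wrt (<) A'" unfolding A'_def by (rule sorted_passes[OF o1(2) Cons.prems(2)])
  have sB: "sorted_wrt (<) B'" unfolding B'_def by (rule sorted_passes[OF o3 Cons.prems(3)])
  have o5: "ok X (m # A')" using o4 by simp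
  have "lattice A B \<longleftrightarrow> lattice A' B'" using Cons.IH[OF o1(1) Cons.prems(2,3)] by (simp add: A'_def B'_def ms'_def)
  also have "\<dots> \<longleftrightarrow> lattice (fst (pass m A')) (fst (pass (snd (pass m A')) B'))"
    using lattice_step[OF o4, of "[]"] sA sB sorted_pass[OF o5 sA] by simp
  finally show ?case by (simp add: A'_def B'_def ms'_def)
qed simp

text \<open>Three phases, each preserving the property: B is processed, then A together with the
  travel of its carries through B, and finally the carries of P travel through A and B. What follows
  in Q does not act on the first halves of A and B.\<close>

lemma lattice_full:
  assumes z: "0 \<notin> X" and o: "ok X (dbl (P @ A @ B @ Q))" and s: "sorted_wrt (<) A" "sorted_wrt (<) B"
  shows "\<exists>U A' B' R. fst (full (P @ A @ B @ Q)) = U @ A' @ B' @ R \<and> length U = length P \<and>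
    length A' = length A \<and> length B' = length B \<and> (lattice A B \<longleftrightarrow> lattice A' B')"
proof -
  let ?X = "fin X (dbl P)"
  define B1 where "B1 = fst (full B)"
  define A1 where "A1 = fst (full A)"
  define V where "V = snd (full A)"
  define B2 where "B2 = fst (passes V B1)"
  define W where "W = snd (full P)"
  define A2 where "A2 = fst (passes W A1)"
  define B3 where "B3 = fst (passes (snd (passes W A1)) B2)"
  have n: "-1 \<notin> set A" using zero_notin(2)[OF z o] by simp
  have o1: "ok ?X (dbl A @ dbl [] @ dbl B)" using o by simp
  have okA: "ok ?X (dbl A)" "ok (fin ?X (dbl A)) (dbl B)" "ok X (dbl P)" using o by simp_all
  have o2: "ok ?X (dbl A @ B1)" using full_ok[OF okA(2)] okA(1) by (simp add: B1_def)
  have sB1: "sorted_wrt (<) B1" using sorted_append_full[of "fin ?X (dbl A)" "[]" B] okA s by (simp add: B1_def)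
  have sA1: "sorted_wrt (<) A1" using sorted_append_full[of ?X "[]" A] okA s by (simp add: A1_def)
  have AV: "ok ?X (A1 @ V)" "fin ?X (A1 @ V) = fin ?X (dbl A)" using full_ok[OF okA(1)] by (simp_all add: A1_def V_def)
  have o3: "ok (fin ?X A1) (V @ B1)" using AV o2 by simp
  have sB2: "sorted_wrt (<) B2" unfolding B2_def by (rule sorted_passes[OF o3 sB1])
  have o4: "ok ?X (A1 @ B2)" using passes_ok[OF o3] AV by (simp add: B2_def)
  have o5: "ok (fin X (fst (full P))) (W @ A1 @ B2)" using full_ok[OF okA(3)] o4 by (simp add: W_def)
  have "lattice A B \<longleftrightarrow> lattice A B1" using lattice_full_right[OF o1 n s(1)] s(2) by (simp add: B1_def)
  also have "\<dots> \<longleftrightarrow> lattice A1 B2"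
    using lattice_full_left[of ?X "[]" A B1] o2 n s(1) sB1 by (simp add: A1_def B2_def V_def)
  also have "\<dots> \<longleftrightarrow> lattice A2 B3" using lattice_passes[OF o5 sA1 sB2] by (simp add: A2_def B3_def)
  finally have l: "lattice A B \<longleftrightarrow> lattice A2 B3" .
  obtain R1 where 1: "fst (full (B @ Q)) = B1 @ R1" by (simp add: full_append B1_def)
  obtain R2 where 2: "fst (full (A @ B @ Q)) = A1 @ B2 @ R2"
    by (simp add: full_append[of A] 1 passes_append A1_def B2_def V_def)
  obtain R3 where 3: "fst (full (P @ A @ B @ Q)) = fst (full P) @ A2 @ B3 @ R3"
    by (simp add: full_append[of P] 2 passes_append A2_def B3_def W_def)
  show ?thesis using l 3 by (intro exI[of _ "fst (full P)"] exI[of _ A2] exI[of _ B3] exI[of _ R3])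
    (simp add: A2_def B3_def A1_def B2_def B1_def)
qed

section \<open>Partitions as Maya diagrams\<close>

definition maya :: "(nat \<Rightarrow> nat) \<Rightarrow> int set" where
  "maya p = (\<lambda>r. int (p r) - int r) ` {1..}"

definition partial_maya :: "(nat \<Rightarrow> nat) \<Rightarrow> nat \<Rightarrow> int set" where
  "partial_maya p N = {..<- int N} \<union> (\<lambda>r. int (p r) - int r) ` {1..N}"

text \<open>Letters are contents less one, so row r starts at - r and its last letter is one below
  the final position of its particle.\<close>

definition row_word :: "(nat \<Rightarrow> nat) \<Rightarrow> nat \<Rightarrow> int list" where
  "row_word p r = [- int r..int (p r) - int r - 1]"

definition superstandard :: "(nat \<Rightarrow> nat) \<Rightarrow> int list" where
  "superstandard p = concat (map (row_word p) [1..<Suc (num_parts p)])"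

lemma length_row_word [simp]: "length (row_word p r) = p r"
  by (simp add: row_word_def)

lemma run_ok:
  assumes "c \<in> X" "X \<inter> {c<..c + int m} = {}"
  shows "ok X [c..c + int m - 1] \<and> fin X [c..c + int m - 1] = insert (c + int m) (X - {c})"
  using assms(2)
proof (induction m)
  case 0
  then show ?case using assms(1) by auto
next
  case (Suc m)
  have "X \<inter> {c<..c + int m} = {}" using Suc.prems by auto
  note IH = Suc.IH[OF this]
  have e: "[c..c + int (Suc m) - 1] = [c..c + int m - 1] @ [c + int m]"
    using upto_rec2[of c "c + int m"] by (simp add: algebra_simps)
  have n: "c + int (Suc m) \<notin> X" using Suc.prems by (auto simp: disjoint_iff)
  have "c + int m \<notin> X - {c}" using Suc.prems by (cases m) (auto simp: disjoint_iff)
  then show ?case unfolding e using IH n by (auto simp: mv_def algebra_simps)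
qed

text \<open>The only particle in the window from c to b is at most the one at c, and an increasing
  word cannot come back to a letter it has passed; so it can only push this one particle.\<close>

lemma run_unique:
  assumes "ok X w" "sorted_wrt (<) w" "\<And>x. x \<in> set w \<Longrightarrow> c \<le> x \<and> x < b" "X \<inter> {c..<b} \<subseteq> {c}"
  shows "w = [c..c + int (length w) - 1]"
  using assms
proof (induction w arbitrary: c X)
  case (Cons x w)
  have "x \<in> X" "c \<le> x" "x < b" using Cons.prems(1,3) by auto
  then have x: "x = c" using Cons.prems(4) by auto
  have "w = [c + 1..c + 1 + int (length w) - 1]"
  proof (rule Cons.IH)
    show "ok (mv c X) w" using Cons.prems(1) x by simp
    show "mv c X \<inter> {c + 1..<b} \<subseteq> {c + 1}" using Cons.prems(4) by (auto simp: mv_def)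
    show "c + 1 \<le> y \<and> y < b" if "y \<in> set w" for y
      using that Cons.prems(2,3) x by fastforce
  qed (use Cons.prems in simp)
  moreover have "[c..c + int (length (x # w)) - 1] = c # [c + 1..c + int (length (x # w)) - 1]"
    by (subst upto_rec1) auto
  ultimately show ?case using x by (simp add: algebra_simps)
qed simp

text \<open>A particle whose right neighbour is occupied cannot move, so the first letter is not
  inside the filled sea.\<close>

lemma sea_first:
  assumes "ok X w" "sorted_wrt (<) w" "{..c} \<subseteq> X" "x \<in> set w"
  shows "c \<le> x"
proof (cases w)
  case (Cons y v)
  then have "y + 1 \<notin> X" using assms(1) by simp
  then have "c \<le> y" using assms(3) by (metis atMost_iff linorder_not_le subsetD zle_add1_eq_le add1_zle_eq)
  then show ?thesis using Cons assms(2,4) by auto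
qed (use assms in simp)

lemma row_step:
  assumes "\<And>r. 1 \<le> r \<Longrightarrow> r \<le> N \<Longrightarrow> p (Suc N) \<le> p r"
  shows "ok (partial_maya p N) (row_word p (Suc N))"
    and "fin (partial_maya p N) (row_word p (Suc N)) = partial_maya p (Suc N)"
proof -
  let ?c = "- int (Suc N)" and ?X = "partial_maya p N"
  have c: "?c \<in> ?X" by (simp add: partial_maya_def)
  have g: "int (p (Suc N)) - int N \<le> int (p r) - int r" if "r \<in> {1..N}" for r
    using assms[of r] that by auto
  have d: "?X \<inter> {?c<..?c + int (p (Suc N))} = {}"
    using g unfolding partial_maya_def by fastforce
  have e: "row_word p (Suc N) = [?c..?c + int (p (Suc N)) - 1]"
    by (simp add: row_word_def algebra_simps)
  note R = run_ok[OF c d, folded e]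
  show "ok ?X (row_word p (Suc N))" using R by blast
  have "?X - {?c} = {..<?c} \<union> (\<lambda>r. int (p r) - int r) ` {1..N}"
    using g by (fastforce simp: partial_maya_def)
  moreover have "{1..Suc N} = insert (Suc N) {1..N}" by auto
  ultimately have "insert (?c + int (p (Suc N))) (?X - {?c}) = partial_maya p (Suc N)"
    by (auto simp: partial_maya_def algebra_simps)
  then show "fin ?X (row_word p (Suc N)) = partial_maya p (Suc N)" using R by simp
qed

lemma rows_ok:
  assumes "\<And>r s. 1 \<le> r \<Longrightarrow> r \<le> s \<Longrightarrow> s \<le> N \<Longrightarrow> p s \<le> p r"
  shows "ok {..<0} (concat (map (row_word p) [1..<Suc N])) \<and>
    fin {..<0} (concat (map (row_word p) [1..<Suc N])) = partial_maya p N"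
  using assms
proof (induction N)
  case 0
  then show ?case by (simp add: partial_maya_def)
next
  case (Suc N)
  have IH: "ok {..<0} (concat (map (row_word p) [1..<Suc N])) \<and>
    fin {..<0} (concat (map (row_word p) [1..<Suc N])) = partial_maya p N"
    using Suc by simp
  have "[1..<Suc (Suc N)] = [1..<Suc N] @ [Suc N]" by simp
  then show ?case using IH row_step[of N p] Suc.prems[of _ "Suc N"] by (simp del: upt_Suc)
qed

lemma num_parts_zero:
  assumes "is_partition p" "num_parts p < r" shows "p r = 0"
  using partition_parts[OF assms(1)] assms(2) by (metis (mono_tags) atLeastAtMost_iff bot_nat_0.not_eq_extremum linorder_not_le mem_Collect_eq)

lemma partial_maya_full:
  assumes "is_partition p" "num_parts p \<le> N"
  shows "partial_maya p N = maya p"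
proof -
  have "{1..} = {1..N} \<union> {Suc N..}" by auto
  moreover have "(\<lambda>r. int (p r) - int r) ` {Suc N..} = {..<- int N}"
  proof (intro equalityI subsetI)
    fix x assume "x \<in> {..<- int N}"
    then have "x = int (p (nat (- x))) - int (nat (- x))" "nat (- x) \<in> {Suc N..}"
      using num_parts_zero[OF assms(1), of "nat (- x)"] assms(2) by auto
    then show "x \<in> (\<lambda>r. int (p r) - int r) ` {Suc N..}" by blast
  next
    fix x assume "x \<in> (\<lambda>r. int (p r) - int r) ` {Suc N..}"
    then obtain r where "x = int (p r) - int r" "Suc N \<le> r" by auto
    then show "x \<in> {..<- int N}" using num_parts_zero[OF assms(1), of r] assms(2) by auto
  qed
  ultimately show ?thesis unfolding maya_def partial_maya_def by (simp add: image_Un Un_commute)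
qed

lemma superstandard_words:
  assumes "is_partition p" shows "superstandard p \<in> words (maya p)"
  using rows_ok[of "num_parts p" p] partition_antimono[OF assms] partial_maya_full[OF assms order_refl]
  by (simp add: words_def superstandard_def)

lemma maya_strict:
  assumes "is_partition p" "1 \<le> r" "r < s"
  shows "int (p s) - int s < int (p r) - int r"
  using partition_antimono[OF assms(1,2), of s] assms(3) by simp

text \<open>Positions decrease strictly with the row. If all rows before r agree, the position of
  row r of one partition must come from a row of the other that is not earlier, hence is at most the
  position of row r there; by symmetry the two are equal.\<close>

lemma maya_inj:
  assumes p: "is_partition p" and q: "is_partition q" and e: "maya p = maya q"
  shows "p = q"
proof -
  have le: "int (p' r) - int r \<le> int (q' r) - int r"
    if r: "1 \<le> r" and IH: "\<And>s. s < r \<Longrightarrow> 1 \<le> s \<Longrightarrow> p' s = q' s" and e: "maya p' = maya q'"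
      and p: "is_partition p'" and q: "is_partition q'" for p' q' r
  proof -
    have "int (p' r) - int r \<in> maya q'" unfolding e[symmetric] using r by (auto simp: maya_def)
    then obtain s where s: "1 \<le> s" "int (p' r) - int r = int (q' s) - int s" by (auto simp: maya_def)
    have "\<not> s < r" using IH[of s] s maya_strict[OF p s(1), of r] by auto
    then show ?thesis using s maya_strict[OF q r, of s] by (cases "r = s") auto
  qed
  have "p r = q r" if "1 \<le> r" for r
    using that
  proof (induction r rule: less_induct)
    case (less r)
    then show ?case using le[of r p q] le[of r q p] e p q by fastforce
  qed
  moreover have "p 0 = q 0" using p q by (simp add: is_partition_def)
  ultimately show ?thesis by (metis ext less_one linorder_not_le)
qed

lemma maya_mv:
  assumes "is_partition p" "1 \<le> r"
  shows "mv (int (p r) - int r) (maya p) = maya (p(r := Suc (p r)))"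
proof -
  let ?f = "\<lambda>r. int (p r) - int r"
  have "?f s \<noteq> ?f r" if "1 \<le> s" "s \<noteq> r" for s
    using maya_strict[OF assms(1) that(1), of r] maya_strict[OF assms, of s] that(2) by linarith
  then have 1: "maya p - {?f r} = ?f ` ({1..} - {r})" by (auto simp: maya_def)
  have 2: "{1..} = insert r ({1..} - {r})" using assms(2) by auto
  show ?thesis unfolding mv_def 1 unfolding maya_def by (subst (2) 2) auto
qed

lemma maya_zero: "maya (\<lambda>_. 0) = {..<0}"
proof -
  have z: "is_partition (\<lambda>_. 0)" by (simp add: is_partition_def)
  have "num_parts (\<lambda>_. 0) \<le> 0" by (simp add: num_parts_def)
  from partial_maya_full[OF z this] show ?thesis by (simp add: partial_maya_def)
qed

text \<open>If the previous row had the same length, its particle would stand immediately to the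
  right of that of row r and block the move.\<close>

lemma is_partition_add:
  assumes p: "is_partition p" and r: "1 \<le> r" and n: "int (p r) - int r + 1 \<notin> maya p"
  shows "is_partition (p(r := Suc (p r)))"
proof -
  have f: "finite {i. p i > 0}" using p by (simp add: is_partition_def)
  have "{i. (p(r := Suc (p r))) i > 0} \<subseteq> insert r {i. p i > 0}" by auto
  then have "finite {i. (p(r := Suc (p r))) i > 0}" using f finite_subset by blast
  moreover have "(p(r := Suc (p r))) (Suc i) \<le> (p(r := Suc (p r))) i" if "1 \<le> i" for i
  proof (cases "Suc i = r")
    case True
    have "p r \<noteq> p i"
    proof
      assume "p r = p i"
      then have "int (p r) - int r + 1 = int (p i) - int i" using True by auto
      then show False using n that by (auto simp: maya_def)
    qed
    moreover have "p r \<le> p i" using p that True by (auto simp: is_partition_def)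
    ultimately show ?thesis using True by auto
  next
    case False
    have "p (Suc i) \<le> p i" using p that by (simp add: is_partition_def)
    with False show ?thesis by auto
  qed
  ultimately show ?thesis using p r by (simp add: is_partition_def)
qed

lemma reachable_maya:
  assumes "ok {..<0} w"
  shows "\<exists>p. is_partition p \<and> fin {..<0} w = maya p"
  using assms
proof (induction w rule: rev_induct)
  case Nil
  have "is_partition (\<lambda>_. 0)" by (simp add: is_partition_def)
  then show ?case using maya_zero by auto
next
  case (snoc c w)
  then obtain p where p: "is_partition p" "fin {..<0} w = maya p" by auto
  then have c: "c \<in> maya p" "c + 1 \<notin> maya p" using snoc.prems by auto
  then obtain r where r: "1 \<le> r" "c = int (p r) - int r" by (auto simp: maya_def)
  then show ?case using is_partition_add[OF p(1) r(1)] maya_mv[OF p(1) r(1)] c p by auto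
qed

lemma cnt_upto: "cnt x [a..b] = max 0 (b - max a x + 1)"
proof (induction a b rule: upto.induct)
  case (1 i j)
  show ?case
  proof (cases "i \<le> j")
    case True
    then have "[i..j] = i # [i + 1..j]" by (rule upto_rec1)
    then show ?thesis using 1[OF True] True by (auto simp: cnt_Cons max_def)
  next
    case False
    then show ?thesis by (simp add: cnt_Nil)
  qed
qed

lemma lattice_rows:
  assumes "p (Suc r) \<le> p r" shows "lattice (row_word p r) (row_word p (Suc r))"
  using assms unfolding lattice_def row_word_def cnt_upto by auto

section \<open>Pairs of labels and letters; Yamanouchi words are superstandard\<close>

definition blk :: "nat \<Rightarrow> (nat \<times> int) list \<Rightarrow> int list" where
  "blk i ps = map snd (filter (\<lambda>q. fst q = i) ps)"

definition superstandard_pairs :: "(nat \<Rightarrow> nat) \<Rightarrow> (nat \<times> int) list" where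
  "superstandard_pairs p = concat (map (\<lambda>r. map (Pair r) (row_word p r)) [1..<Suc (num_parts p)])"

lemma blk_append [simp]: "blk i (u @ v) = blk i u @ blk i v" by (simp add: blk_def)

lemma sorted_pairs_fst: "sorted_wrt (<) (ps :: (nat \<times> int) list) \<Longrightarrow> sorted (map fst ps)"
  by (induction ps) (auto simp: less_prod_def)

lemma sorted_blk:
  assumes "sorted_wrt (<) ps" shows "sorted_wrt (<) (blk i ps)"
proof -
  have "sorted_wrt (<) (filter (\<lambda>q. fst q = i) ps)" using assms by (rule sorted_wrt_filter)
  then have "sorted_wrt (\<lambda>a b. snd a < snd b) (filter (\<lambda>q. fst q = i) ps)"
    by (rule sorted_wrt_mono_rel[rotated]) (auto simp: less_prod_def)
  then show ?thesis by (simp add: blk_def sorted_wrt_map)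
qed

lemma filter_split:
  assumes "sorted (map fst ps)"
  shows "ps = filter (\<lambda>q. fst q \<le> N) ps @ filter (\<lambda>q. N < fst q) (ps :: (nat \<times> int) list)"
  using assms
proof (induction ps)
  case (Cons q ps)
  show ?case
  proof (cases "fst q \<le> N")
    case True
    then show ?thesis using Cons by simp
  next
    case False
    then have "N < fst s" if "s \<in> set ps" for s using that Cons.prems by auto
    then have "filter (\<lambda>q. fst q \<le> N) ps = []" "filter (\<lambda>q. N < fst q) ps = ps"
      by (auto simp: filter_empty_conv filter_id_conv linorder_not_le)
    then show ?thesis using False by simp
  qed
qed simp

lemma filter_step:
  assumes "sorted (map fst ps)"
  shows "filter (\<lambda>q. fst q \<le> Suc N) ps =
    filter (\<lambda>q. fst q \<le> N) ps @ filter (\<lambda>q. fst q = Suc N) (ps :: (nat \<times> int) list)"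
proof -
  have "sorted (map fst (filter (\<lambda>q. fst q \<le> Suc N) ps))" using assms by (rule sorted_filter)
  note filter_split[OF this, of N]
  moreover have "(fst q \<le> Suc N \<and> fst q \<le> N) = (fst q \<le> N)"
    "(fst q \<le> Suc N \<and> N < fst q) = (fst q = Suc N)" for q :: "nat \<times> int" by auto
  ultimately show ?thesis by simp
qed

lemma filter_Pair: "filter (\<lambda>q. fst q = i) ps = map (Pair i) (blk i ps)"
  unfolding blk_def by (induction ps) auto

text \<open>By induction on N, label N fills row N. The letters of label N + 1 start no earlier than
  - (N + 1), because the sea below cannot move, and by the lattice property they end before the
  particle of row N. In this window the only particle is that of row N + 1, so
  \<open>run_unique\<close> applies.\<close>

lemma yamanouchi_pairs:
  assumes s: "sorted_wrt (<) qs" and pos: "\<And>q. q \<in> set qs \<Longrightarrow> 1 \<le> fst q"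
    and o: "ok {..<0} (map snd qs)" and l: "\<And>i. 1 \<le> i \<Longrightarrow> lattice (blk i qs) (blk (Suc i) qs)"
  defines "p \<equiv> \<lambda>i. length (blk i qs)"
  shows "is_partition p" "qs = superstandard_pairs p"
proof -
  have sf: "sorted (map fst qs)" by (rule sorted_pairs_fst[OF s])
  have z: "blk 0 qs = []" using pos by (fastforce simp: blk_def filter_empty_conv)
  have main: "(\<forall>r. 1 \<le> r \<longrightarrow> r \<le> N \<longrightarrow> blk r qs = row_word p r) \<and>
    (\<forall>r s. 1 \<le> r \<longrightarrow> r \<le> s \<longrightarrow> s \<le> N \<longrightarrow> p s \<le> p r) \<and>
    filter (\<lambda>q. fst q \<le> N) qs = concat (map (\<lambda>r. map (Pair r) (row_word p r)) [1..<Suc N])" for N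
  proof (induction N)
    case 0
    then show ?case using pos by (fastforce simp: filter_empty_conv)
  next
    case (Suc N)
    let ?w = "blk (Suc N) qs" and ?c = "- int (Suc N)"
    have dec: "p s \<le> p r" if "1 \<le> r" "r \<le> s" "s \<le> N" for r s using Suc.IH that by blast
    have pre: "map snd (filter (\<lambda>q. fst q \<le> N) qs) = concat (map (row_word p) [1..<Suc N])"
      using Suc.IH by (simp add: map_concat o_def del: upt_Suc)
    have "ok {..<0} (map snd (filter (\<lambda>q. fst q \<le> Suc N) qs @ filter (\<lambda>q. Suc N < fst q) qs))"
      using o filter_split[OF sf] by metis
    then have "ok {..<0} (concat (map (row_word p) [1..<Suc N]) @ ?w)"
      unfolding filter_step[OF sf] by (simp add: pre blk_def del: upt_Suc)
    moreover have "fin {..<0} (concat (map (row_word p) [1..<Suc N])) = partial_maya p N"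
      using rows_ok[of N p] dec by blast
    ultimately have ow: "ok (partial_maya p N) ?w" by (simp del: upt_Suc)
    have sw: "sorted_wrt (<) ?w" by (rule sorted_blk[OF s])
    \<comment> \<open>Without a previous row, for N = 0, all positions from 0 on are empty, and any
      bound beyond the letters will do.\<close>
    obtain b where b: "\<And>x. x \<in> set ?w \<Longrightarrow> x < b" "partial_maya p N \<inter> {?c..<b} \<subseteq> {?c}"
    proof (cases "N = 0")
      case True
      have "x < Max (insert 0 (set ?w)) + 1" if "x \<in> set ?w" for x
        using Max_ge[of "insert 0 (set ?w)" x] that by simp
      moreover have "partial_maya p N \<inter> {?c..<Max (insert 0 (set ?w)) + 1} \<subseteq> {?c}"
        using True by (auto simp: partial_maya_def)
      ultimately show ?thesis using that by blast
    next
      case False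
      \<comment> \<open>A letter x of label N + 1 requires a letter of label N that is at least x,
        and row N ends at \<open>int (p N) - int N - 1\<close>.\<close>
      have "x < int (p N) - int N" if x: "x \<in> set ?w" for x
      proof -
        have "cnt x ?w \<ge> 1" using x by (auto simp: cnt_def Suc_le_eq filter_empty_conv simp flip: of_nat_Suc)
        moreover have "blk N qs = row_word p N" using Suc.IH False by simp
        ultimately have "cnt x (row_word p N) \<ge> 1"
          using l[of N] False unfolding lattice_def by (metis One_nat_def Suc_leI bot_nat_0.not_eq_extremum order_trans)
        then show ?thesis by (simp add: row_word_def cnt_upto)
      qed
      moreover have "partial_maya p N \<inter> {?c..<int (p N) - int N} \<subseteq> {?c}"
      proof
        fix x assume x: "x \<in> partial_maya p N \<inter> {?c..<int (p N) - int N}"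
        have "int (p N) - int N \<le> int (p r) - int r" if "r \<in> {1..N}" for r
          using dec[of r N] that by auto
        then show "x \<in> {?c}" using x by (fastforce simp: partial_maya_def)
      qed
      ultimately show ?thesis using that by blast
    qed
    have "{..?c} \<subseteq> partial_maya p N" by (auto simp: partial_maya_def)
    then have "?c \<le> x" if "x \<in> set ?w" for x using sea_first[OF ow sw _ that] by blast
    then have "?w = [?c..?c + int (length ?w) - 1]"
      using run_unique[OF ow sw _ b(2)] b(1) by blast
    moreover have "?c + int (length ?w) - 1 = int (p (Suc N)) - int (Suc N) - 1"
      by (simp add: p_def)
    ultimately have w: "?w = row_word p (Suc N)" by (simp add: row_word_def)
    have "p (Suc N) \<le> p N" if "1 \<le> N"
    proof -
      have "lattice (row_word p N) (row_word p (Suc N))" using l[of N] that w Suc.IH by simp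
      then have "cnt (- int (Suc N)) (row_word p (Suc N)) \<le> cnt (- int (Suc N)) (row_word p N)"
        unfolding lattice_def by blast
      then show ?thesis by (simp add: row_word_def cnt_upto max_def split: if_splits)
    qed
    then have "p (Suc N) \<le> p r" if "1 \<le> r" "r \<le> N" for r
      using dec[of r N] that by (meson dual_order.trans le_refl)
    then have d: "\<forall>r s. 1 \<le> r \<longrightarrow> r \<le> s \<longrightarrow> s \<le> Suc N \<longrightarrow> p s \<le> p r"
      using dec by (metis le_Suc_eq order_refl)
    have "filter (\<lambda>q. fst q \<le> Suc N) qs =
        concat (map (\<lambda>r. map (Pair r) (row_word p r)) [1..<Suc N]) @ map (Pair (Suc N)) (row_word p (Suc N))"
      unfolding filter_step[OF sf] using Suc.IH by (simp add: filter_Pair w del: upt_Suc)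
    then show ?case using d w Suc.IH by (auto simp: le_Suc_eq)
  qed
  define N where "N = Max (insert 0 (fst ` set qs))"
  have N: "fst q \<le> N" if "q \<in> set qs" for q unfolding N_def using that by simp
  have big: "p i = 0" if "N < i" for i
    using N that by (fastforce simp: p_def blk_def filter_empty_conv)
  have "{i. p i > 0} \<subseteq> {..N}" using big by (metis (mono_tags) atMost_iff linorder_not_le mem_Collect_eq neq0_conv subsetI)
  then show part: "is_partition p" unfolding is_partition_def
  proof (intro conjI allI impI)
    show "p 0 = 0" using z by (simp add: p_def)
    show "p (Suc i) \<le> p i" if "1 \<le> i" for i using main[of "Suc i"] that by simp
  qed (rule finite_subset, assumption, simp)
  have "num_parts p \<le> N"
  proof (rule ccontr)
    assume "\<not> num_parts p \<le> N"
    then have "num_parts p \<in> {i. p i > 0}" unfolding partition_parts[OF part] by auto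
    then show False using big[of "num_parts p"] \<open>\<not> num_parts p \<le> N\<close> by simp
  qed
  then have u: "[1..<Suc N] = [1..<Suc (num_parts p)] @ [Suc (num_parts p)..<Suc N]"
    by (metis Suc_le_mono le_add_diff_inverse le_add1 plus_1_eq_Suc upt_add_eq_append)
  have r: "row_word p r = []" if "num_parts p < r" for r
    using num_parts_zero[OF part that] by (simp add: row_word_def)
  have "concat (map (\<lambda>r. map (Pair r) (row_word p r)) [Suc (num_parts p)..<Suc N]) = []"
    using r by auto
  then have "concat (map (\<lambda>r. map (Pair r) (row_word p r)) [1..<Suc N]) = superstandard_pairs p"
    unfolding superstandard_pairs_def u map_append concat_append by (simp del: upt_Suc)
  moreover have "filter (\<lambda>q. fst q \<le> N) qs = qs" using N by (simp add: filter_id_conv)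
  ultimately show "qs = superstandard_pairs p" using main[of N] by simp
qed

lemma map_snd_superstandard_pairs: "map snd (superstandard_pairs p) = superstandard p"
  by (simp add: superstandard_pairs_def superstandard_def map_concat o_def)

lemma sorted_superstandard_pairs: "sorted_wrt (<) (superstandard_pairs p)"
proof -
  have "sorted_wrt (<) (concat (map (\<lambda>r. map (Pair r) (row_word p r)) [1..<Suc N])) \<and>
    (\<forall>q \<in> set (concat (map (\<lambda>r. map (Pair r) (row_word p r)) [1..<Suc N])). fst q \<le> N)" for N
  proof (induction N)
    case (Suc N)
    have "sorted_wrt (<) (row_word p (Suc N))" unfolding row_word_def by simp
    then have "sorted_wrt (<) (map (Pair (Suc N)) (row_word p (Suc N)))"
      by (simp add: sorted_wrt_map)
    moreover have "[1..<Suc (Suc N)] = [1..<Suc N] @ [Suc N]" by simp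
    moreover have lt: "(a, x) < (Suc N, y)" if "a \<le> N" for a x y
      using that by (simp add: less_prod_def)
    ultimately show ?case using Suc
      by (auto simp: sorted_wrt_append lt simp del: upt_Suc dest!: bspec)
  qed simp
  then show ?thesis by (simp add: superstandard_pairs_def)
qed

lemma superstandard_pairs_pos: "q \<in> set (superstandard_pairs p) \<Longrightarrow> 1 \<le> fst q"
  by (auto simp: superstandard_pairs_def)

lemma blk_superstandard_pairs:
  assumes "is_partition p" "1 \<le> i"
  shows "blk i (superstandard_pairs p) = row_word p i"
proof -
  have e: "blk i (concat (map (\<lambda>r. map (Pair r) (row_word p r)) rs)) =
    concat (map (\<lambda>r. if r = i then row_word p r else []) rs)" for rs
    by (induction rs) (auto simp: blk_def o_def)
  have "concat (map (\<lambda>r. if r = i then row_word p r else []) rs) =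
    (if i \<in> set rs then row_word p i else [])" if "distinct rs" for rs
    using that by (induction rs) auto
  then have "blk i (superstandard_pairs p) = (if i \<in> {1..<Suc (num_parts p)} then row_word p i else [])"
    unfolding superstandard_pairs_def e by (metis distinct_upt set_upt)
  then show ?thesis using assms(2) num_parts_zero[OF assms(1), of i] by (auto simp: row_word_def)
qed

lemma compatible_full:
  assumes "ok X (dbl ys)" "length is = length ys"
  shows "sorted_wrt (<) (zip is ys) \<longleftrightarrow> sorted_wrt (<) (zip (is :: nat list) (fst (full ys)))"
proof -
  have t: "transp ((<) :: nat \<times> int \<Rightarrow> _)" by (simp add: transp_on_def)
  show ?thesis using full_less[OF assms(1)] assms(2)
    by (simp add: sorted_wrt_iff_nth_Suc_transp[OF t])
qed

lemma blk_zip_none: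
  assumes "\<And>q. q \<in> set ps \<Longrightarrow> fst q \<noteq> i"
  shows "blk i (zip (map fst ps) U) = []"
  using assms by (fastforce simp: blk_def filter_empty_conv dest: set_zip_leftD)

lemma blk_zip_all:
  assumes "\<And>q. q \<in> set ps \<Longrightarrow> fst q = i" "length U = length ps"
  shows "blk i (zip (map fst ps) U) = U"
proof -
  have "filter (\<lambda>q. fst q = i) (zip (map fst ps) U) = zip (map fst ps) U"
    using assms(1) by (fastforce simp: filter_id_conv dest: set_zip_leftD)
  then show ?thesis using assms(2) by (simp add: blk_def)
qed

text \<open>Labels are attached to positions and the runs keep their positions under
  \<open>full\<close>, so the blocks of labels i and i + 1 in the image are the A' and B' of
  \<open>lattice_full\<close>.\<close>

lemma lattice_blocks_full:
  assumes z: "0 \<notin> X" and o: "ok X (dbl (map snd ps))" and s: "sorted_wrt (<) ps"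
  shows "lattice (blk i ps) (blk (Suc i) ps) \<longleftrightarrow>
    lattice (blk i (zip (map fst ps) (fst (full (map snd ps))))) (blk (Suc i) (zip (map fst ps) (fst (full (map snd ps)))))"
proof -
  have sf: "sorted (map fst ps)" by (rule sorted_pairs_fst[OF s])
  define P where "P = filter (\<lambda>q. fst q < i) ps"
  define A where "A = filter (\<lambda>q. fst q = i) ps"
  define B where "B = filter (\<lambda>q. fst q = Suc i) ps"
  define Q where "Q = filter (\<lambda>q. Suc i < fst q) ps"
  have "filter (\<lambda>q. fst q \<le> i) ps = P @ A"
  proof (cases i)
    case 0
    then show ?thesis by (simp add: P_def A_def)
  next
    case (Suc j)
    then show ?thesis using filter_step[OF sf, of j] by (simp add: P_def A_def less_Suc_eq_le)
  qed
  then have ps: "ps = P @ A @ B @ Q"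
    using filter_split[OF sf, of "Suc i"] filter_step[OF sf, of i] by (simp add: B_def Q_def)
  have bl: "blk i ps = map snd A" "blk (Suc i) ps = map snd B" by (simp_all add: blk_def A_def B_def)
  have ms: "map snd ps = map snd P @ map snd A @ map snd B @ map snd Q" by (subst ps) simp
  have "sorted_wrt (<) (map snd A)" "sorted_wrt (<) (map snd B)"
    using sorted_blk[OF s, of i] sorted_blk[OF s, of "Suc i"] by (simp_all add: bl)
  from lattice_full[OF z o[unfolded ms] this, folded ms]
  obtain U A' B' R where U: "fst (full (map snd ps)) = U @ A' @ B' @ R" "length U = length P"
    "length A' = length A" "length B' = length B" "lattice (map snd A) (map snd B) \<longleftrightarrow> lattice A' B'"
    by auto
  have mf: "map fst ps = map fst P @ map fst A @ map fst B @ map fst Q" by (subst ps) simp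
  have "zip (map fst ps) (fst (full (map snd ps))) =
      zip (map fst P) U @ zip (map fst A) A' @ zip (map fst B) B' @ zip (map fst Q) R"
    unfolding mf U(1) using U(2-4) by simp
  moreover have "blk i (zip (map fst P) U) = []" "blk i (zip (map fst B) B') = []" "blk i (zip (map fst Q) R) = []"
    "blk (Suc i) (zip (map fst P) U) = []" "blk (Suc i) (zip (map fst A) A') = []" "blk (Suc i) (zip (map fst Q) R) = []"
    by (auto intro!: blk_zip_none simp: P_def A_def B_def Q_def)
  moreover have "blk i (zip (map fst A) A') = A'" "blk (Suc i) (zip (map fst B) B') = B'"
    using U(3,4) by (auto intro!: blk_zip_all simp: A_def B_def)
  ultimately show ?thesis using U(5) bl by simp
qed

section \<open>Tableaux as sorted words of pairs, uniformly for both kinds\<close>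

definition before :: "nat \<times> nat \<Rightarrow> nat \<times> nat \<Rightarrow> bool" where
  "before b b' \<longleftrightarrow> fst b = fst b' \<and> snd b < snd b' \<or> snd b = snd b' \<and> fst b < fst b'"

text \<open>Both kinds of tableaux are fillings with strictly increasing keys (label, letter) along
  rows and columns. The second component encodes which ties are allowed: it increases along rows for
  ordinary entries, and along columns for marked ones.\<close>

definition fillings :: "(nat \<times> nat \<Rightarrow> 'l \<Rightarrow> nat \<times> int) \<Rightarrow> (nat \<times> nat \<Rightarrow> 'l \<Rightarrow> bool) \<Rightarrow>
    (nat \<times> nat) set \<Rightarrow> (nat \<times> nat \<Rightarrow> 'l) set" where
  "fillings key good D = {T \<in> extensional D. (\<forall>b\<in>D. good b (T b)) \<and>
     (\<forall>b\<in>D. \<forall>b'\<in>D. before b b' \<longrightarrow> key b (T b) < key b' (T b'))}"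

definition keys :: "(nat \<times> nat \<Rightarrow> 'l \<Rightarrow> nat \<times> int) \<Rightarrow> (nat \<times> nat) set \<Rightarrow> (nat \<times> nat \<Rightarrow> 'l) \<Rightarrow> (nat \<times> int) list" where
  "keys key D T = sorted_list_of_set ((\<lambda>b. key b (T b)) ` D)"

definition pair_words :: "int list set \<Rightarrow> (nat \<times> int) list set" where
  "pair_words W = {ps. sorted_wrt (<) ps \<and> (\<forall>q\<in>set ps. 1 \<le> fst q) \<and> map snd ps \<in> W}"

lemma sorted_list_of_set_snoc:
  fixes q :: "'a :: linorder"
  assumes "finite A" "\<And>a. a \<in> A \<Longrightarrow> a < q"
  shows "sorted_list_of_set (insert q A) = sorted_list_of_set A @ [q]"
proof (rule strict_sorted_equal)
  show "sorted_wrt (<) (sorted_list_of_set A @ [q])"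
    using assms by (auto simp: sorted_wrt_append)
  show "sorted_wrt (<) (sorted_list_of_set (insert q A))" by (rule strict_sorted_list_of_set)
  show "set (sorted_list_of_set (insert q A)) = set (sorted_list_of_set A @ [q])"
    using assms(1) by (simp del: sorted_list_of_set_insert_remove)
qed

lemma fillings_less:
  assumes "T \<in> fillings key good D" "b \<in> D" "b' \<in> D" "before b b'"
  shows "key b (T b) < key b' (T b')"
  using assms by (simp add: fillings_def)

text \<open>Boxes with equal keys are separated by a third box that follows one and precedes the
  other, so their keys differ after all.\<close>

lemma key_inj_on:
  assumes T: "T \<in> fillings key good D"
    and sep: "\<And>b b' l l'. b \<in> D \<Longrightarrow> b' \<in> D \<Longrightarrow> good b l \<Longrightarrow> good b' l' \<Longrightarrow> key b l = key b' l' \<Longrightarrow>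
      b = b' \<or> (\<exists>d\<in>D. before b d \<and> before d b' \<or> before b' d \<and> before d b)"
  shows "inj_on (\<lambda>b. key b (T b)) D"
proof (rule inj_onI, rule ccontr)
  fix b b' assume b: "b \<in> D" "b' \<in> D" "key b (T b) = key b' (T b')" "b \<noteq> b'"
  have "good b (T b)" "good b' (T b')" using T b by (auto simp: fillings_def)
  from sep[OF b(1,2) this b(3)] b(4)
  obtain d where "d \<in> D" "before b d \<and> before d b' \<or> before b' d \<and> before d b" by auto
  then have "key b (T b) < key b' (T b') \<or> key b' (T b') < key b (T b)"
    using fillings_less[OF T] b(1,2) less_trans by blast
  then show False using b(3) by simp
qed

text \<open>Here s is a shape with diagram \<open>D s\<close>, and \<open>step s' y b s\<close> says
  that s arises from s' by the box b with letter y. The box with the largest key can be removed and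
  accounts for the last pair of the word; conversely, the last letter of a word determines the box.
  Induction on the number of boxes then gives the bijection, once for Young and once for shifted
  diagrams.\<close>

lemma bij_keys:
  fixes D :: "'s \<Rightarrow> (nat \<times> nat) set" and key :: "nat \<times> nat \<Rightarrow> 'l \<Rightarrow> nat \<times> int"
  assumes fin: "\<And>s. S s \<Longrightarrow> finite (D s)"
    and pos: "\<And>b l. good b l \<Longrightarrow> 1 \<le> fst (key b l)"
    and kinj: "\<And>b l l'. key b l = key b l' \<Longrightarrow> l = l'"
    and sep: "\<And>s b b' l l'. S s \<Longrightarrow> b \<in> D s \<Longrightarrow> b' \<in> D s \<Longrightarrow> good b l \<Longrightarrow> good b' l' \<Longrightarrow> key b l = key b' l' \<Longrightarrow>
      b = b' \<or> (\<exists>d\<in>D s. before b d \<and> before d b' \<or> before b' d \<and> before d b)"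
    and remove: "\<And>s b l. S s \<Longrightarrow> b \<in> D s \<Longrightarrow> good b l \<Longrightarrow> (\<And>b'. b' \<in> D s \<Longrightarrow> \<not> before b b') \<Longrightarrow>
      \<exists>s'. step s' (snd (key b l)) b s"
    and stepD: "\<And>s s' y b. step s' y b s \<Longrightarrow> S s' \<and> D s = insert b (D s') \<and> b \<notin> D s' \<and> (\<forall>b'\<in>D s. \<not> before b b')"
    and det: "\<And>s s' s'' y b b'. step s' y b s \<Longrightarrow> step s'' y b' s \<Longrightarrow> s' = s'' \<and> b = b'"
    and letter: "\<And>s s' y b i. step s' y b s \<Longrightarrow> 1 \<le> i \<Longrightarrow> \<exists>l. good b l \<and> key b l = (i, y)"
    and stepW: "\<And>s s' y b w. step s' y b s \<Longrightarrow> w \<in> W s' \<Longrightarrow> w @ [y] \<in> W s"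
    and Wstep: "\<And>s y w. S s \<Longrightarrow> w @ [y] \<in> W s \<Longrightarrow> \<exists>s' b. step s' y b s \<and> w \<in> W s'"
    and Wempty: "\<And>s. S s \<Longrightarrow> [] \<in> W s \<longleftrightarrow> D s = {}"
    and s: "S s"
  shows "bij_betw (keys key (D s)) (fillings key good (D s)) (pair_words (W s))"
  using s
proof (induction "card (D s)" arbitrary: s)
  case 0
  then have D: "D s = {}" using fin by simp
  have W: "W s = {[]}"
  proof -
    have "w = []" if "w \<in> W s" for w
    proof (cases w rule: rev_exhaust)
      case (snoc v y)
      then show ?thesis using Wstep[of s v y] stepD 0 that D by fastforce
    qed
    then show ?thesis using Wempty D 0 by auto
  qed
  have "fillings key good (D s) = {\<lambda>_. undefined}" by (auto simp: D fillings_def)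
  moreover have "pair_words (W s) = {[]}" by (auto simp: W pair_words_def)
  ultimately show ?case by (simp add: keys_def D bij_betw_def)
next
  case (Suc n s)
  have ne: "D s \<noteq> {}" using Suc(2) by auto
  have kstep: "keys key (D s) T = keys key (D s') T' @ [key b (T b)] \<and> T' = restrict T (D s')"
    if st: "step s' y b s" and T: "T' \<in> extensional (D s')" "T = T'(b := l)"
      and m: "\<And>b'. b' \<in> D s' \<Longrightarrow> key b' (T' b') < key b l" for s' y b T T' l
  proof -
    have D: "D s = insert b (D s')" "b \<notin> D s'" "S s'" using stepD[OF st] by auto
    have e1: "(\<lambda>b. key b (T b)) ` D s = insert (key b l) ((\<lambda>b. key b (T' b)) ` D s')"
      using D T by auto
    have e2: "sorted_list_of_set (insert (key b l) ((\<lambda>b. key b (T' b)) ` D s')) =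
        sorted_list_of_set ((\<lambda>b. key b (T' b)) ` D s') @ [key b l]"
      by (rule sorted_list_of_set_snoc) (use m fin[OF D(3)] in auto)
    have e3: "key b (T b) = key b l" using T(2) by simp
    have e4: "T' = restrict T (D s')" using D T by (auto simp: restrict_def extensional_def)
    show ?thesis unfolding keys_def e1 e2 e3 using e4 by blast
  qed
  have IH: "bij_betw (keys key (D s')) (fillings key good (D s')) (pair_words (W s'))" if "step s' y b s" for s' y b
  proof (rule Suc(1))
    have D: "D s = insert b (D s')" "b \<notin> D s'" "S s'" using stepD[OF that] by auto
    show "n = card (D s')" using Suc(2) D fin[OF D(3)] by simp
    show "S s'" by (rule D(3))
  qed
  have decomp: "\<exists>s' b i y T'. step s' y b s \<and> T' \<in> fillings key good (D s') \<and> T = T'(b := T b) \<and> key b (T b) = (i, y) \<and> 1 \<le> i \<and>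
      (\<forall>q\<in>set (keys key (D s') T'). q < (i, y)) \<and> keys key (D s) T = keys key (D s') T' @ [(i, y)]"
    if T: "T \<in> fillings key good (D s)" for T
  proof -
    let ?k = "\<lambda>b. key b (T b)"
    have inj: "inj_on ?k (D s)" by (rule key_inj_on[OF T sep[OF Suc(3)]])
    have fD: "finite (D s)" by (rule fin[OF Suc(3)])
    obtain b where b: "b \<in> D s" "\<And>b'. b' \<in> D s \<Longrightarrow> ?k b' \<le> ?k b"
    proof -
      define M where "M = Max (?k ` D s)"
      have "M \<in> ?k ` D s" unfolding M_def by (rule Max_in) (use fD ne in simp_all)
      then obtain b where b: "b \<in> D s" "M = ?k b" by blast
      have "?k b' \<le> M" if "b' \<in> D s" for b' unfolding M_def by (rule Max_ge) (use fD that in simp_all)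
      then show ?thesis using that b by simp
    qed
    have g: "good b (T b)" using T b by (simp add: fillings_def)
    \<comment> \<open>A box after b would have a larger key, so the box with the largest key is a
      corner.\<close>
    have "\<not> before b b'" if "b' \<in> D s" for b'
      using b(2)[OF that] fillings_less[OF T b(1) that] by (meson linorder_not_le)
    from remove[OF Suc(3) b(1) g this] obtain s' where st: "step s' (snd (?k b)) b s" by blast
    have D: "D s = insert b (D s')" "b \<notin> D s'" "S s'" using stepD[OF st] by auto
    have lt: "?k b' < ?k b" if "b' \<in> D s'" for b'
    proof -
      have "b' \<in> D s" "b' \<noteq> b" using that D by auto
      then have "?k b' \<noteq> ?k b" using inj_onD[OF inj, of b' b] b(1) by blast
      then show ?thesis using b(2)[of b'] \<open>b' \<in> D s\<close> by simp
    qed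
    define T' where "T' = restrict T (D s')"
    have TT: "T = T'(b := T b)"
    proof
      fix x
      have "T \<in> extensional (D s)" using T by (simp add: fillings_def)
      then have "x \<notin> D s \<Longrightarrow> T x = undefined" by (rule extensional_arb)
      then show "T x = (T'(b := T b)) x" using D by (auto simp: T'_def restrict_def)
    qed
    have T': "T' \<in> fillings key good (D s')" using T D by (auto simp: T'_def fillings_def)
    have m: "key b' (T' b') < key b (T b)" if "b' \<in> D s'" for b' using lt[OF that] that by (simp add: T'_def)
    obtain i y where iy: "?k b = (i, y)" by fastforce
    have eT: "T' \<in> extensional (D s')" by (simp add: T'_def)
    have k: "keys key (D s) T = keys key (D s') T' @ [(i, y)]"
      using conjunct1[OF kstep[OF st eT TT m]] unfolding iy .
    have l: "\<forall>q\<in>set (keys key (D s') T'). q < (i, y)"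
    proof
      fix q assume "q \<in> set (keys key (D s') T')"
      then obtain b' where "b' \<in> D s'" "q = key b' (T' b')" using fin[OF D(3)] by (auto simp: keys_def)
      then show "q < (i, y)" using m[of b'] unfolding iy by blast
    qed
    have "step s' y b s" "1 \<le> i" using st pos[OF g] unfolding iy by simp_all
    then show ?thesis using T' TT iy k l by blast
  qed
  show ?case
  proof (intro bij_betwI')
    fix T1 T2 assume T: "T1 \<in> fillings key good (D s)" "T2 \<in> fillings key good (D s)"
    show "keys key (D s) T1 = keys key (D s) T2 \<longleftrightarrow> T1 = T2"
    proof
      assume e: "keys key (D s) T1 = keys key (D s) T2"
      from decomp[OF T(1)] obtain s1 b1 i1 y1 T1' where 1: "step s1 y1 b1 s" "T1' \<in> fillings key good (D s1)"
        "T1 = T1'(b1 := T1 b1)" "key b1 (T1 b1) = (i1, y1)" "keys key (D s) T1 = keys key (D s1) T1' @ [(i1, y1)]" by blast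
      from decomp[OF T(2)] obtain s2 b2 i2 y2 T2' where 2: "step s2 y2 b2 s" "T2' \<in> fillings key good (D s2)"
        "T2 = T2'(b2 := T2 b2)" "key b2 (T2 b2) = (i2, y2)" "keys key (D s) T2 = keys key (D s2) T2' @ [(i2, y2)]" by blast
      have k: "keys key (D s1) T1' = keys key (D s2) T2'" "i1 = i2" "y1 = y2" using e 1(5) 2(5) by auto
      then have sb: "s1 = s2" "b1 = b2" using det[of s1 y1 b1 s s2 b2] 1(1) 2(1) by auto
      have "T1' = T2'" using inj_onD[OF bij_betw_imp_inj_on[OF IH[OF 1(1)]]] 1(2) 2(2) k(1) unfolding sb by blast
      moreover have "T1 b1 = T2 b1" using kinj[of b1] 1(4) 2(4) k sb by simp
      ultimately show "T1 = T2" using 1(3) 2(3) sb by metis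
    qed simp
  next
    fix T assume "T \<in> fillings key good (D s)"
    from decomp[OF this] obtain s' b i y T' where 1: "step s' y b s" "T' \<in> fillings key good (D s')" "1 \<le> i"
      "\<forall>q\<in>set (keys key (D s') T'). q < (i, y)" "keys key (D s) T = keys key (D s') T' @ [(i, y)]" by blast
    have "keys key (D s') T' \<in> pair_words (W s')" by (rule bij_betw_apply[OF IH[OF 1(1)] 1(2)])
    then show "keys key (D s) T \<in> pair_words (W s)"
      using 1(3-5) stepW[OF 1(1)] by (auto simp: pair_words_def sorted_wrt_append)
  next
    fix ps assume ps: "ps \<in> pair_words (W s)"
    have "ps \<noteq> []" using ps Wempty[OF Suc(3)] ne by (auto simp: pair_words_def)
    then obtain ps' i y where p: "ps = ps' @ [(i, y)]" by (metis rev_exhaust surj_pair)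
    then have "map snd ps' @ [y] \<in> W s" using ps by (simp add: pair_words_def)
    from Wstep[OF Suc(3) this] obtain s' b where st: "step s' y b s" "map snd ps' \<in> W s'" by blast
    have "ps' \<in> pair_words (W s')" using ps p st by (auto simp: pair_words_def sorted_wrt_append)
    then have "ps' \<in> keys key (D s') ` fillings key good (D s')"
      unfolding bij_betw_imp_surj_on[OF IH[OF st(1)]] .
    then obtain T' where T': "T' \<in> fillings key good (D s')" "keys key (D s') T' = ps'"
      by (elim imageE) simp
    have i: "1 \<le> i" using ps p by (auto simp: pair_words_def)
    from letter[OF st(1) i] obtain l where l: "good b l" "key b l = (i, y)" by blast
    have D: "D s = insert b (D s')" "b \<notin> D s'" "S s'" "\<forall>b'\<in>D s. \<not> before b b'" using stepD[OF st(1)] by auto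
    have m: "key b' (T' b') < key b l" if "b' \<in> D s'" for b'
    proof -
      have "key b' (T' b') \<in> set ps'" using T'(2) that fin[OF D(3)] by (auto simp: keys_def)
      then show ?thesis using ps p l by (auto simp: pair_words_def sorted_wrt_append)
    qed
    have "T'(b := l) \<in> fillings key good (D s)"
    proof -
      have "before c c' \<Longrightarrow> key c ((T'(b := l)) c) < key c' ((T'(b := l)) c')" if "c \<in> D s" "c' \<in> D s" for c c'
      proof (cases "c' = b")
        case True
        assume "before c c'"
        then have "c \<noteq> b" using D(4) that True by auto
        then show ?thesis using m that True D(1) by auto
      next
        case False
        assume a: "before c c'"
        then have "c \<noteq> b" using D(4) that by auto
        then show ?thesis using False T'(1) that a D(1) by (auto simp: fillings_def)
      qed
      moreover have "T'(b := l) \<in> extensional (D s)" using T'(1) D by (auto simp: fillings_def extensional_def)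
      moreover have "\<forall>c\<in>D s. good c ((T'(b := l)) c)" using T'(1) D l by (auto simp: fillings_def)
      ultimately show ?thesis by (simp add: fillings_def)
    qed
    moreover have "keys key (D s) (T'(b := l)) = ps"
    proof -
      have "T' \<in> extensional (D s')" using T' by (simp add: fillings_def)
      from conjunct1[OF kstep[OF st(1) this refl m]] show ?thesis unfolding T'(2) p by (simp add: l(2))
    qed
    ultimately show "\<exists>T\<in>fillings key good (D s). ps = keys key (D s) T" by auto
  qed
qed

lemma length_filter_keys:
  assumes "finite D" "inj_on (\<lambda>b. key b (T b)) D"
  shows "length (filter P (keys key D T)) = card {b \<in> D. P (key b (T b))}"
proof -
  have "length (filter P (keys key D T)) = card {q \<in> (\<lambda>b. key b (T b)) ` D. P q}"
    unfolding keys_def using assms(1) by (simp add: distinct_length_filter Int_def conj_commute)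
  also have "{q \<in> (\<lambda>b. key b (T b)) ` D. P q} = (\<lambda>b. key b (T b)) ` {b \<in> D. P (key b (T b))}" by auto
  also have "card \<dots> = card {b \<in> D. P (key b (T b))}"
    using assms(2) by (intro card_image inj_on_subset[OF assms(2)]) auto
  finally show ?thesis .
qed

lemma set_keys: "finite D \<Longrightarrow> set (keys key D T) = (\<lambda>b. key b (T b)) ` D"
  by (simp add: keys_def)

section \<open>Marked shifted tableaux and words of doubled letters\<close>

definition skey :: "nat \<times> nat \<Rightarrow> letter \<Rightarrow> nat \<times> int" where
  "skey b x = (num x, if is_marked x then int (fst b) - int (snd b) - 1 else int (snd b) - int (fst b))"

definition sgood :: "nat \<times> nat \<Rightarrow> letter \<Rightarrow> bool" where
  "sgood b x \<longleftrightarrow> 1 \<le> num x \<and> (is_marked x \<longrightarrow> fst b \<noteq> snd b)"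

lemma skey_row:
  assumes "r \<le> c" "c < c'"
  shows "skey (r, c) x < skey (r, c') x' \<longleftrightarrow> x \<le> x' \<and> \<not> (is_marked x \<and> x = x')"
  using assms by (cases x; cases x') (auto simp: skey_def less_prod_def less_eq_letter_def)

lemma skey_col:
  assumes "r < r'" "r' \<le> c"
  shows "skey (r, c) x < skey (r', c) x' \<longleftrightarrow> x \<le> x' \<and> \<not> (\<not> is_marked x \<and> x = x')"
  using assms by (cases x; cases x') (auto simp: skey_def less_prod_def less_eq_letter_def)

lemma is_marked_ex: "is_marked x \<longleftrightarrow> x = Marked (num x)" "\<not> is_marked x \<longleftrightarrow> x = Unmarked (num x)"
  by (cases x; simp)+

text \<open>Equal entries must be unmarked in a row and marked in a column. The sign change in
  \<open>skey\<close> turns this into strict increase of keys, and the two cardinality conditions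
  express the same for all pairs of boxes.\<close>

lemma SSHT_fillings:
  assumes g: "strict_partition g"
  shows "SSHT g = fillings skey sgood (shifted_diagram g)" (is "_ = fillings _ _ ?D")
proof -
  have fD: "finite ?D" by (rule finite_shifted_diagram[OF g])
  have f1: "finite {r. (r, c) \<in> ?D \<and> P r}" for c P
    by (rule finite_subset[OF _ finite_imageI[OF fD, of fst]]) force
  have f2: "finite {c. (r, c) \<in> ?D \<and> P c}" for r P
    by (rule finite_subset[OF _ finite_imageI[OF fD, of snd]]) force
  have le: "r \<le> c" if "(r, c) \<in> ?D" for r c using that by (simp add: shifted_diagram_def)
  show ?thesis
  proof (intro set_eqI iffI)
    fix T assume T: "T \<in> SSHT g"
    have row: "T (r, c) \<le> T (r, c')" if "(r, c) \<in> ?D" "(r, c') \<in> ?D" "c < c'" for r c c'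
      using T that unfolding SSHT_def by blast
    have col: "T (r, c) \<le> T (r', c)" if "(r, c) \<in> ?D" "(r', c) \<in> ?D" "r < r'" for r r' c
      using T that unfolding SSHT_def by blast
    have "card {r. (r, c) \<in> ?D \<and> T (r, c) = Unmarked i} \<le> Suc 0" for i c
      using T unfolding SSHT_def by auto
    then have u: "r = r'" if "(r, c) \<in> ?D" "(r', c) \<in> ?D" "T (r, c) = Unmarked i" "T (r', c) = Unmarked i" for r r' c i
      using that unfolding card_le_Suc0_iff_eq[OF f1] by blast
    have "card {c. (r, c) \<in> ?D \<and> T (r, c) = Marked i} \<le> Suc 0" for i r
      using T unfolding SSHT_def by auto
    then have m: "c = c'" if "(r, c) \<in> ?D" "(r, c') \<in> ?D" "T (r, c) = Marked i" "T (r, c') = Marked i" for r c c' i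
      using that unfolding card_le_Suc0_iff_eq[OF f2] by blast
    have "sgood b (T b)" if "b \<in> ?D" for b
    proof -
      have "1 \<le> num (T b)" using T that unfolding SSHT_def by blast
      moreover have "\<not> is_marked (T (i, i))" if "(i, i) \<in> ?D" for i using T that unfolding SSHT_def by blast
      ultimately show ?thesis using that by (cases b) (auto simp: sgood_def)
    qed
    moreover have "skey b (T b) < skey b' (T b')" if b: "b \<in> ?D" "b' \<in> ?D" "before b b'" for b b'
    proof -
      obtain r c r' c' where e: "b = (r, c)" "b' = (r', c')" by (metis surj_pair)
      consider "r = r'" "c < c'" | "c = c'" "r < r'" using b(3) e by (auto simp: before_def)
      then show ?thesis
      proof cases
        case 1
        have "\<not> (is_marked (T b) \<and> T b = T b')" using m[of r c c' "num (T b)"] b e 1 is_marked_ex(1) by (metis less_irrefl)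
        then show ?thesis using skey_row[of r c c' "T b" "T b'"] row[of r c c'] le b e 1 by auto
      next
        case 2
        have "\<not> (\<not> is_marked (T b) \<and> T b = T b')" using u[of r c r' "num (T b)"] b e 2 is_marked_ex(2) by (metis less_irrefl)
        then show ?thesis using skey_col[of r r' c "T b" "T b'"] col[of r c r'] le b e 2 by auto
      qed
    qed
    moreover have "T \<in> extensional ?D" using T unfolding SSHT_def PiE_def by blast
    ultimately show "T \<in> fillings skey sgood ?D" unfolding fillings_def by blast
  next
    fix T assume T: "T \<in> fillings skey sgood ?D"
    have row: "T (r, c) \<le> T (r, c') \<and> \<not> (is_marked (T (r, c)) \<and> T (r, c) = T (r, c'))"
      if "(r, c) \<in> ?D" "(r, c') \<in> ?D" "c < c'" for r c c'
      using fillings_less[OF T that(1,2)] skey_row[OF le[OF that(1)] that(3)] that(3) by (simp add: before_def)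
    have col: "T (r, c) \<le> T (r', c) \<and> \<not> (\<not> is_marked (T (r, c)) \<and> T (r, c) = T (r', c))"
      if "(r, c) \<in> ?D" "(r', c) \<in> ?D" "r < r'" for r r' c
      using fillings_less[OF T that(1,2)] skey_col[OF that(3) le[OF that(2)]] that(3) by (simp add: before_def)
    have "card {r. (r, c) \<in> ?D \<and> T (r, c) = Unmarked i} \<le> 1" for i c
    proof -
      have "r = r'" if "(r, c) \<in> ?D \<and> T (r, c) = Unmarked i" "(r', c) \<in> ?D \<and> T (r', c) = Unmarked i" for r r'
        using col[of r c r'] col[of r' c r] that by (cases r r' rule: linorder_cases) auto
      then show ?thesis unfolding One_nat_def card_le_Suc0_iff_eq[OF f1] by blast
    qed
    moreover have "card {c. (r, c) \<in> ?D \<and> T (r, c) = Marked i} \<le> 1" for i r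
    proof -
      have "c = c'" if "(r, c) \<in> ?D \<and> T (r, c) = Marked i" "(r, c') \<in> ?D \<and> T (r, c') = Marked i" for c c'
        using row[of r c c'] row[of r c' c] that by (cases c c' rule: linorder_cases) auto
      then show ?thesis unfolding One_nat_def card_le_Suc0_iff_eq[OF f2] by blast
    qed
    moreover have g: "sgood b (T b)" if "b \<in> ?D" for b using T that by (simp add: fillings_def)
    moreover have "\<not> is_marked (T (i, i))" if "(i, i) \<in> ?D" for i using g[OF that] by (simp add: sgood_def)
    moreover have "T \<in> ?D \<rightarrow>\<^sub>E {x. 1 \<le> num x}"
      using T g by (auto simp: fillings_def sgood_def PiE_def)
    ultimately show "T \<in> SSHT g" unfolding SSHT_def using row col by blast
  qed
qed

lemma strict_part: "strict_partition g \<Longrightarrow> is_partition g" by (simp add: strict_partition_def)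

lemma strict_less:
  assumes "strict_partition g" "1 \<le> r" "r < s" "0 < g r" shows "g s < g r"
proof -
  have "g s \<le> g (Suc r)" using partition_antimono[OF strict_part[OF assms(1)], of "Suc r" s] assms by simp
  then show ?thesis using assms by (fastforce simp: strict_partition_def)
qed

lemma strict_eq:
  assumes "strict_partition g" "1 \<le> r" "1 \<le> s" "0 < g r" "g r = g s" shows "r = s"
  using strict_less[OF assms(1,2), of s] strict_less[OF assms(1,3), of r] assms by (cases r s rule: linorder_cases) auto

lemma shifted_closed:
  assumes g: "strict_partition g" and b: "(r', c) \<in> shifted_diagram g" and r: "1 \<le> r" "r \<le> r'"
  shows "(r, c) \<in> shifted_diagram g"
proof -
  have "g r' > 0 \<longrightarrow> r' + g r' \<le> r + g r"
    using r(2)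
  proof (induction rule: dec_induct)
    case (step k)
    show ?case
    proof
      assume k: "g (Suc k) > 0"
      then have "g k > 0" using partition_antimono[OF strict_part[OF g], of k "Suc k"] step(1) r by simp
      then show "Suc k + g (Suc k) \<le> r + g r" using strict_less[OF g, of k "Suc k"] step r by simp
    qed
  qed simp
  then show ?thesis using b r by (auto simp: shifted_diagram_def)
qed

text \<open>The Maya diagram of the double of g, the partition with Frobenius symbol (g_1, g_2, ...
  | g_1 - 1, g_2 - 1, ...): each part v puts a particle at v and a hole at - v, and position 0 is
  empty.\<close>

definition smaya :: "(nat \<Rightarrow> nat) \<Rightarrow> int set" where
  "smaya g = {z. 0 < z \<and> nat z \<in> g ` {1..} \<or> z < 0 \<and> nat (- z) \<notin> g ` {1..}}"

definition sstep :: "(nat \<Rightarrow> nat) \<Rightarrow> int \<Rightarrow> nat \<times> nat \<Rightarrow> (nat \<Rightarrow> nat) \<Rightarrow> bool" where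
  "sstep g' y b g \<longleftrightarrow> strict_partition g' \<and> strict_partition g \<and>
    (\<exists>r\<ge>1. g = g'(r := Suc (g' r)) \<and> b = (r, r + g' r) \<and>
      (y = int (g' r) \<or> y = - 1 - int (g' r) \<and> 0 < g' r))"

lemma smaya_simps:
  "0 < v \<Longrightarrow> int v \<in> smaya g \<longleftrightarrow> v \<in> g ` {1..}"
  "0 < v \<Longrightarrow> - int v \<in> smaya g \<longleftrightarrow> v \<notin> g ` {1..}"
  "0 \<notin> smaya g"
  by (simp_all add: smaya_def)

lemma smaya_inj:
  assumes g: "strict_partition g" and h: "strict_partition h" and e: "smaya g = smaya h"
  shows "g = h"
proof -
  have P: "0 < v \<Longrightarrow> v \<in> g ` {1..} \<longleftrightarrow> v \<in> h ` {1..}" for v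
    using smaya_simps(1)[of v g] smaya_simps(1)[of v h] e by simp
  have le: "a r \<le> b r"
    if r: "1 \<le> r" and IH: "\<And>s. s < r \<Longrightarrow> 1 \<le> s \<Longrightarrow> a s = b s" and P: "\<And>v. 0 < v \<Longrightarrow> v \<in> a ` {1..} \<Longrightarrow> v \<in> b ` {1..}"
      and a: "strict_partition a" and b: "strict_partition b" for a b :: "nat \<Rightarrow> nat" and r
  proof (cases "a r = 0")
    case False
    then obtain s where s: "1 \<le> s" "a r = b s" using P[of "a r"] r by auto
    have "\<not> s < r" using IH[of s] s strict_less[OF a s(1), of r] False by auto
    then show ?thesis using s partition_antimono[OF strict_part[OF b] r, of s] by simp
  qed simp
  have "g r = h r" if "1 \<le> r" for r
    using that
  proof (induction r rule: less_induct)
    case (less r)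
    have "g r \<le> h r" by (rule le[OF less.prems less.IH _ g h]) (use P in auto)
    moreover have "h r \<le> g r" by (rule le[OF less.prems _ _ h g]) (use P less.IH in auto)
    ultimately show ?case by simp
  qed
  moreover have "g 0 = h 0" using g h by (simp add: strict_partition_def is_partition_def)
  ultimately show ?thesis by (metis ext less_one linorder_not_le)
qed

lemma or_False_eq: "(P \<or> False) = P" by simp

lemma two_moves:
  assumes "p \<in> X" "p + 1 \<notin> X" "q \<in> X" "q + 1 \<notin> X" "p + 1 \<noteq> q" "q + 1 \<noteq> p" "p \<noteq> q"
  shows "ok X [p, q] \<and> fin X [p, q] = insert (p + 1) (insert (q + 1) (X - {p} - {q}))"
proof -
  have "q + 1 \<notin> mv p X" "q \<in> mv p X" using assms by (simp_all add: mv_def)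
  moreover have "mv q (mv p X) = insert (p + 1) (insert (q + 1) (X - {p} - {q}))"
    using assms(5-7) by (simp add: mv_def insert_Diff_if insert_commute)
  ultimately show ?thesis using assms by simp
qed

text \<open>When a part k grows to k + 1, the particle at k moves to k + 1 and the hole at - k moves
  to - k - 1. For k > 0 two different particles move, in either order. For k = 0 one particle goes
  from -1 through 0 to 1, and the order is fixed.\<close>

lemma sstep_move:
  assumes "sstep g' y b g"
  shows "ok (smaya g') [- 1 - y, y]" "fin (smaya g') [- 1 - y, y] = smaya g"
proof -
  obtain r where r: "1 \<le> r" "g = g'(r := Suc (g' r))" "y = int (g' r) \<or> y = - 1 - int (g' r) \<and> 0 < g' r"
    and s: "strict_partition g'" "strict_partition g" using assms by (auto simp: sstep_def)
  define k where "k = g' r"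
  have new: "Suc k \<notin> g' ` {1..}"
  proof
    assume "Suc k \<in> g' ` {1..}"
    then obtain s' where s': "1 \<le> s'" "g' s' = Suc k" by auto
    then have "s' \<noteq> r" by (auto simp: k_def)
    then have "g s' = Suc k" "g r = Suc k" using r s' by (simp_all add: k_def)
    then show False using strict_eq[OF s(2) s'(1) r(1)] \<open>s' \<noteq> r\<close> by simp
  qed
  have P: "v \<in> g ` {1..} \<longleftrightarrow> v = Suc k \<or> v \<in> g' ` {1..} \<and> v \<noteq> k" if v: "0 < v" for v
  proof
    assume "v \<in> g ` {1..}"
    then obtain t where t: "1 \<le> t" "v = g t" by auto
    show "v = Suc k \<or> v \<in> g' ` {1..} \<and> v \<noteq> k"
    proof (cases "t = r")
      case True
      then show ?thesis using t r by (simp add: k_def)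
    next
      case False
      then have "v = g' t" using t r by simp
      moreover have "v \<noteq> k" using strict_eq[OF s(1) t(1) r(1)] False v calculation by (auto simp: k_def)
      ultimately show ?thesis using t by auto
    qed
  next
    assume a: "v = Suc k \<or> v \<in> g' ` {1..} \<and> v \<noteq> k"
    show "v \<in> g ` {1..}"
    proof (cases "v = Suc k")
      case True
      then have "v = g r" using r by (simp add: k_def)
      then show ?thesis using r(1) by auto
    next
      case False
      then obtain t where t: "1 \<le> t" "v = g' t" "v \<noteq> k" using a by auto
      then have "v = g t" using r by (auto simp: k_def)
      then show ?thesis using t by auto
    qed
  qed
  have mem: "z \<in> smaya g \<longleftrightarrow> z = int (Suc k) \<or> z = - int k \<and> 0 < k \<or> z \<in> smaya g' \<and> z \<noteq> int k \<and> z \<noteq> - int (Suc k)" for z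
  proof -
    consider v where "0 < v" "z = int v" | v where "0 < v" "z = - int v" | "z = 0"
      by (metis int_cases nat_int of_nat_0_less_iff zero_less_Suc of_nat_0 neq0_conv)
    then show ?thesis
    proof cases
      case (1 v)
      then show ?thesis using P[OF 1(1)] smaya_simps(1)[OF 1(1)] by auto
    next
      case (2 v)
      have "k \<in> g' ` {1..}" using r(1) by (auto simp: k_def)
      then show ?thesis using 2 P[OF 2(1)] smaya_simps(2)[OF 2(1)] new by auto
    next
      case 3
      then show ?thesis using smaya_simps(3) by auto
    qed
  qed
  have k: "0 < k \<Longrightarrow> int k \<in> smaya g' \<and> - int k \<notin> smaya g'"
    using smaya_simps(1,2)[of k g'] r(1) by (auto simp: k_def)
  have k1: "- int (Suc k) \<in> smaya g'" "int (Suc k) \<notin> smaya g'"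
    using smaya_simps(1,2)[of "Suc k" g'] new by auto
  note z = smaya_simps(3)[of g']
  have a: "- int (Suc k) + 1 = - int k" "int k + 1 = int (Suc k)" by simp_all
  have "ok (smaya g') [- 1 - y, y] \<and> fin (smaya g') [- 1 - y, y] = smaya g"
  proof (cases "k = 0")
    case True
    then have y: "- 1 - y = -1" "y = 0" using r(3) by (auto simp: k_def)
    have f: "-1 \<in> smaya g'" "1 \<notin> smaya g'" using k1 True by simp_all
    have "smaya g = insert 1 (smaya g' - {-1})"
    proof (rule set_eqI)
      fix t show "t \<in> smaya g \<longleftrightarrow> t \<in> insert 1 (smaya g' - {-1})" using mem[of t] True z by auto
    qed
    moreover have "insert 1 (smaya g' - {-1}) = insert 1 (insert 0 (smaya g' - {-1}) - {0})" using z by blast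
    ultimately have S: "smaya g = insert 1 (insert 0 (smaya g' - {-1}) - {0})" by (rule trans)
    have m: "mv (-1) (smaya g') = insert 0 (smaya g' - {-1})"
      "mv 0 (insert 0 (smaya g' - {-1})) = insert 1 (insert 0 (smaya g' - {-1}) - {0})" unfolding mv_def by simp_all
    have "ok (smaya g') [-1, 0]" unfolding ok.simps m using f z by simp
    then show ?thesis unfolding y(2) diff_zero S fin.simps m by blast
  next
    case False
    then have ne: "- int (Suc k) + 1 \<noteq> int k" "int k + 1 \<noteq> - int (Suc k)" "- int (Suc k) \<noteq> int k" by simp_all
    have k0: "0 < k" using False by simp
    have f1: "int k \<in> smaya g'" by (rule conjunct1[OF k[OF k0]])
    have f2: "- int (Suc k) + 1 \<notin> smaya g'" unfolding a by (rule conjunct2[OF k[OF k0]])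
    have f3: "int k + 1 \<notin> smaya g'" unfolding a by (rule k1(2))
    note f = f1 f2 f3
    have S: "smaya g = insert (- int (Suc k) + 1) (insert (int k + 1) (smaya g' - {- int (Suc k)} - {int k}))"
    proof (rule set_eqI)
      have taut: "(A \<or> B \<and> True \<or> X \<and> \<not> C \<and> \<not> D) \<longleftrightarrow> (B \<or> A \<or> (X \<and> \<not> D) \<and> \<not> C)" for A B X C D by blast
      fix t show "t \<in> smaya g \<longleftrightarrow> t \<in> insert (- int (Suc k) + 1) (insert (int k + 1) (smaya g' - {- int (Suc k)} - {int k}))"
        unfolding a insert_iff Diff_iff empty_iff or_False_eq mem[of t] eqTrueI[OF k0] by (rule taut)
    qed
    have "- 1 - y = - int (Suc k) \<and> y = int k \<or> - 1 - y = int k \<and> y = - int (Suc k)" using r(3) by (auto simp: k_def)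
    then show ?thesis
    proof (elim disjE conjE)
      assume e: "- 1 - y = - int (Suc k)" "y = int k"
      have e': "- 1 - int k = - int (Suc k)" by simp
      show ?thesis unfolding e(2) e' S by (rule two_moves[OF k1(1) f(2) f(1) f(3) ne])
    next
      assume e: "- 1 - y = int k" "y = - int (Suc k)"
      have e': "- 1 - - int (Suc k) = int k" by simp
      have S': "smaya g = insert (int k + 1) (insert (- int (Suc k) + 1) (smaya g' - {int k} - {- int (Suc k)}))"
        unfolding S by blast
      show ?thesis unfolding e(2) e' S' by (rule two_moves[OF f(1) f(3) k1(1) f(2) ne(2,1) not_sym[OF ne(3)]])
    qed
  qed
  then show "ok (smaya g') [- 1 - y, y]" "fin (smaya g') [- 1 - y, y] = smaya g" by blast+
qed

text \<open>The first of the two moves alone says, by the symmetry of \<open>smaya\<close>, that k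
  is a part or 0 and that k + 1 is not a part; this is exactly the condition for a row of length k
  to be lengthened.\<close>

lemma sstep_exists:
  assumes s: "strict_partition g" and o: "ok (smaya g) [- 1 - y, y]"
  shows "\<exists>b g'. sstep g y b g'"
proof -
  note p = strict_part[OF s]
  have o1: "- 1 - y \<in> smaya g" "- y \<notin> smaya g" using o by auto
  obtain k where k: "k = 0 \<or> k \<in> g ` {1..}" "Suc k \<notin> g ` {1..}" "y = int k \<or> y = - 1 - int k \<and> 0 < k"
  proof (cases "0 \<le> y")
    case True
    have "Suc (nat y) \<notin> g ` {1..}" using o1(1) smaya_simps(2)[of "Suc (nat y)" g] True by simp
    moreover have "nat y = 0 \<or> nat y \<in> g ` {1..}"
    proof (cases "nat y = 0")
      case False
      then show ?thesis using o1(2) smaya_simps(2)[of "nat y" g] by simp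
    qed simp
    ultimately show ?thesis using that[of "nat y"] True by simp
  next
    case False
    have "- 1 - y \<noteq> 0" using o1(1) smaya_simps(3)[of g] by metis
    then have y: "0 < nat (- 1 - y)" using False by simp
    have "nat (- 1 - y) \<in> g ` {1..}" using o1(1) smaya_simps(1)[OF y] False by simp
    moreover have "Suc (nat (- 1 - y)) \<notin> g ` {1..}"
    proof -
      have "int (Suc (nat (- 1 - y))) = - y" using False by simp
      then show ?thesis using o1(2) smaya_simps(1)[of "Suc (nat (- 1 - y))" g] by (metis zero_less_Suc)
    qed
    moreover have "y = - 1 - int (nat (- 1 - y))" using False by simp
    ultimately show ?thesis using that y by blast
  qed
  \<comment> \<open>For k = 0 the row is the first empty one, which keeps the rows before it
    positive.\<close>
  obtain r where r: "1 \<le> r" "g r = k" "\<And>i. 1 \<le> i \<Longrightarrow> i < r \<Longrightarrow> k < g i"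
  proof (cases "k = 0")
    case True
    have "0 < g i" if "1 \<le> i" "i < Suc (num_parts g)" for i using partition_parts[OF p] that by auto
    then show ?thesis using that[of "Suc (num_parts g)"] num_parts_zero[OF p, of "Suc (num_parts g)"] True by simp
  next
    case False
    then obtain r where r: "1 \<le> r" "g r = k" using k(1) by auto
    have "k < g i" if "1 \<le> i" "i < r" for i
      using strict_less[OF s that] partition_antimono[OF p that(1), of r] that r False by simp
    then show ?thesis using that r by blast
  qed
  have big: "Suc k < g i" if "1 \<le> i" "Suc i = r" for i
  proof -
    have "g i \<noteq> Suc k" using k(2) that by (metis atLeast_iff imageI)
    then show ?thesis using r(3)[of i] that by simp
  qed
  have lt: "g (Suc r) \<le> k" using p r by (auto simp: is_partition_def)
  let ?h = "g(r := Suc k)"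
  have "finite {i. g i > 0}" using p by (simp add: is_partition_def)
  moreover have "{i. ?h i > 0} \<subseteq> insert r {i. g i > 0}" by auto
  ultimately have "finite {i. ?h i > 0}" using finite_subset by blast
  moreover have "?h (Suc i) \<le> ?h i \<and> (0 < ?h i \<longrightarrow> ?h (Suc i) < ?h i)" if "1 \<le> i" for i
  proof (cases "Suc i = r")
    case True
    then show ?thesis using big[OF that True] by auto
  next
    case False
    have "g (Suc i) \<le> g i" "0 < g i \<longrightarrow> g (Suc i) < g i" using s that by (auto simp: strict_partition_def is_partition_def)
    then show ?thesis using False lt by auto
  qed
  moreover have "?h 0 = 0" using p r by (simp add: is_partition_def)
  ultimately have "strict_partition ?h" by (simp add: strict_partition_def is_partition_def)
  then show ?thesis unfolding sstep_def using s r k(3) by blast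
qed

lemma smaya_zero: "smaya (\<lambda>_. 0) = {..<0}"
  by (auto simp: smaya_def)

lemma strict_zero: "strict_partition (\<lambda>_. 0)" by (simp add: strict_partition_def is_partition_def)

lemma reachable_smaya:
  assumes "ok {..<0} (dbl w)"
  shows "\<exists>g. strict_partition g \<and> fin {..<0} (dbl w) = smaya g"
  using assms
proof (induction w rule: rev_induct)
  case Nil
  then show ?case using strict_zero smaya_zero by auto
next
  case (snoc y w)
  have o: "ok {..<0} (dbl w)" "ok (fin {..<0} (dbl w)) [- 1 - y, y]" using snoc.prems by simp_all
  from snoc.IH[OF o(1)] obtain g where g: "strict_partition g" "fin {..<0} (dbl w) = smaya g" by blast
  from sstep_exists[OF g(1)] o(2) g(2) obtain b h where h: "sstep g y b h" by metis
  have "fin {..<0} (dbl (w @ [y])) = fin (smaya g) [- 1 - y, y]" using g(2) by simp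
  then have "fin {..<0} (dbl (w @ [y])) = smaya h" using sstep_move(2)[OF h] by simp
  moreover have "strict_partition h" using h by (simp add: sstep_def)
  ultimately show ?case by blast
qed

lemma shifted_removal:
  assumes g: "strict_partition g" and b: "b \<in> shifted_diagram g" and l: "sgood b l"
    and max: "\<And>b'. b' \<in> shifted_diagram g \<Longrightarrow> \<not> before b b'"
  shows "\<exists>g'. sstep g' (snd (skey b l)) b g"
proof -
  obtain r c where e: "b = (r, c)" by fastforce
  have rc: "1 \<le> r" "r \<le> c" "c < r + g r" using b e by (auto simp: shifted_diagram_def)
  have "(r, Suc c) \<notin> shifted_diagram g" using max[of "(r, Suc c)"] e by (auto simp: before_def)
  then have c: "c + 1 = r + g r" using rc by (auto simp: shifted_diagram_def)
  have "(Suc r, c) \<notin> shifted_diagram g" using max[of "(Suc r, c)"] e by (auto simp: before_def)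
  then have up: "g (Suc r) < g r - 1 \<or> g r = 1 \<and> g (Suc r) = 0"
    using rc c strict_less[OF g rc(1), of "Suc r"] by (auto simp: shifted_diagram_def)
  let ?h = "g(r := g r - 1)"
  note p = strict_part[OF g]
  have "finite {i. g i > 0}" using p by (simp add: is_partition_def)
  moreover have "{i. ?h i > 0} \<subseteq> {i. g i > 0}" by (auto split: if_splits)
  ultimately have "finite {i. ?h i > 0}" using finite_subset by blast
  moreover have "?h (Suc i) \<le> ?h i \<and> (0 < ?h i \<longrightarrow> ?h (Suc i) < ?h i)" if "1 \<le> i" for i
  proof (cases "i = r")
    case True
    then show ?thesis using up by auto
  next
    case False
    have "g (Suc i) \<le> g i" "0 < g i \<longrightarrow> g (Suc i) < g i" using g that by (auto simp: strict_partition_def is_partition_def)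
    then show ?thesis using False by auto
  qed
  moreover have "?h 0 = 0" using p rc by (simp add: is_partition_def)
  ultimately have h: "strict_partition ?h" by (simp add: strict_partition_def is_partition_def)
  have 1: "g = ?h(r := Suc (?h r))" using rc by auto
  have 2: "b = (r, r + ?h r)" using c e rc by simp
  have 3: "snd (skey b l) = int (?h r) \<or> snd (skey b l) = - 1 - int (?h r) \<and> 0 < ?h r"
    using l e c rc by (auto simp: skey_def sgood_def)
  have "sstep ?h (snd (skey b l)) b g" unfolding sstep_def
    by (intro conjI h g exI[of _ r] rc(1)) (rule 1 2 3)+
  then show ?thesis by blast
qed

text \<open>Marked letters are negative and unmarked ones are not, so equal keys put both boxes on
  one diagonal; the lower right corner of the rectangle they span lies between them in the
  order.\<close>

lemma shifted_separated:
  assumes g: "strict_partition g" and b: "b \<in> shifted_diagram g" "b' \<in> shifted_diagram g" and k: "skey b l = skey b' l'"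
  shows "b = b' \<or> (\<exists>d\<in>shifted_diagram g. before b d \<and> before d b' \<or> before b' d \<and> before d b)"
proof -
  obtain r c r' c' where e: "b = (r, c)" "b' = (r', c')" by (metis surj_pair)
  have rc: "1 \<le> r" "r \<le> c" "1 \<le> r'" "r' \<le> c'" using b e by (auto simp: shifted_diagram_def)
  have q: "int c - int r = int c' - int r'" using k e rc by (auto simp: skey_def split: if_splits)
  consider "r = r'" | "r < r'" | "r' < r" by linarith
  then show ?thesis
  proof cases
    case 2
    have "(r, c') \<in> shifted_diagram g" by (rule shifted_closed[OF g, of r']) (use b e 2 rc in auto)
    moreover have "before b (r, c')" "before (r, c') b'" using 2 q e by (auto simp: before_def)
    ultimately show ?thesis by blast
  next
    case 3
    have "(r', c) \<in> shifted_diagram g" by (rule shifted_closed[OF g, of r]) (use b e 3 rc in auto)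
    moreover have "before b' (r', c)" "before (r', c) b" using 3 q e by (auto simp: before_def)
    ultimately show ?thesis by blast
  qed (use q e in simp)
qed

lemma bij_shifted:
  assumes "strict_partition g"
  shows "bij_betw (keys skey (shifted_diagram g)) (SSHT g) (pair_words (shifted_words (smaya g)))"
  unfolding SSHT_fillings[OF assms]
proof (rule bij_keys[of strict_partition shifted_diagram sgood skey sstep "\<lambda>g. shifted_words (smaya g)"])
  show "finite (shifted_diagram g)" if "strict_partition g" for g by (rule finite_shifted_diagram[OF that])
  show "1 \<le> fst (skey b l)" if "sgood b l" for b l using that by (simp add: skey_def sgood_def)
  show "l = l'" if "skey b l = skey b l'" for b l l'
    using that by (cases l; cases l') (auto simp: skey_def, presburger+)
  show "b = b' \<or> (\<exists>d\<in>shifted_diagram g. before b d \<and> before d b' \<or> before b' d \<and> before d b)"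
    if g: "strict_partition g" and b: "b \<in> shifted_diagram g" "b' \<in> shifted_diagram g"
      and k: "skey b l = skey b' l'" for g b b' l l'
    by (rule shifted_separated[OF g b k])
  show "\<exists>g'. sstep g' (snd (skey b l)) b g"
    if "strict_partition g" "b \<in> shifted_diagram g" "sgood b l" "\<And>b'. b' \<in> shifted_diagram g \<Longrightarrow> \<not> before b b'" for g b l
    by (rule shifted_removal[OF that])
  show "strict_partition g' \<and> shifted_diagram g = insert b (shifted_diagram g') \<and> b \<notin> shifted_diagram g' \<and>
      (\<forall>b'\<in>shifted_diagram g. \<not> before b b')" if st: "sstep g' y b g" for g g' y b
  proof -
    obtain r where r: "1 \<le> r" "g = g'(r := Suc (g' r))" "b = (r, r + g' r)" and s: "strict_partition g'" "strict_partition g"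
      using st by (auto simp: sstep_def)
    have "shifted_diagram g = insert b (shifted_diagram g')"
      using r by (auto simp: shifted_diagram_def split: if_splits)
    moreover have "b \<notin> shifted_diagram g'" using r by (simp add: shifted_diagram_def)
    moreover have "\<not> before b b'" if b': "b' \<in> shifted_diagram g" for b'
    proof
      assume a: "before b b'"
      obtain r' c' where e: "b' = (r', c')" by fastforce
      show False
      proof (cases "r' = r")
        case True
        then show False using a e r b' by (auto simp: before_def shifted_diagram_def)
      next
        case False
        then have c: "c' = r + g' r" "r < r'" using a e r by (auto simp: before_def)
        \<comment> \<open>A box above b in its column would force the one directly above b into the
          diagram, and then rows r and r + 1 of g' would not decrease strictly.\<close>
        have "(Suc r, c') \<in> shifted_diagram g"
          by (rule shifted_closed[OF s(2)]) (use b' e c in auto)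
        then have "g' (Suc r) + Suc r > r + g' r" "0 < g' (Suc r)" using c r by (auto simp: shifted_diagram_def)
        moreover from this(2) have "0 < g' r" using partition_antimono[OF strict_part[OF s(1)] r(1), of "Suc r"] by simp
        ultimately show False using strict_less[OF s(1) r(1), of "Suc r"] by simp
      qed
    qed
    ultimately show ?thesis using s by blast
  qed
  show "g' = g'' \<and> b = b'" if st: "sstep g' y b g" "sstep g'' y b' g" for g g' g'' y b b'
  proof -
    obtain r where r: "1 \<le> r" "g = g'(r := Suc (g' r))" "b = (r, r + g' r)" "y = int (g' r) \<or> y = - 1 - int (g' r) \<and> 0 < g' r"
      and s: "strict_partition g" using st(1) by (auto simp: sstep_def)
    obtain r2 where r2: "1 \<le> r2" "g = g''(r2 := Suc (g'' r2))" "b' = (r2, r2 + g'' r2)" "y = int (g'' r2) \<or> y = - 1 - int (g'' r2) \<and> 0 < g'' r2"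
      using st(2) by (auto simp: sstep_def)
    have k: "g' r = g'' r2" using r(4) r2(4) by auto
    have gr: "g r = Suc (g' r)" "g r2 = Suc (g' r)" using fun_cong[OF r(2), of r] fun_cong[OF r2(2), of r2] k by simp_all
    then have "r = r2" using strict_eq[OF s r(1) r2(1)] by simp
    moreover have "g' x = g'' x" for x
      using fun_cong[OF r(2), of x] fun_cong[OF r2(2), of x] k \<open>r = r2\<close> by (cases "x = r") simp_all
    ultimately show ?thesis using r(3) r2(3) k by auto
  qed
  show "\<exists>l. sgood b l \<and> skey b l = (i, y)" if st: "sstep g' y b g" "1 \<le> i" for g g' y b i
  proof -
    obtain r where r: "b = (r, r + g' r)" "y = int (g' r) \<or> y = - 1 - int (g' r) \<and> 0 < g' r"
      using st(1) by (auto simp: sstep_def)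
    from r(2) show ?thesis
    proof
      assume "y = int (g' r)"
      then show ?thesis using r(1) st(2) by (intro exI[of _ "Unmarked i"]) (simp add: sgood_def skey_def)
    next
      assume "y = - 1 - int (g' r) \<and> 0 < g' r"
      then show ?thesis using r(1) st(2) by (intro exI[of _ "Marked i"]) (simp add: sgood_def skey_def)
    qed
  qed
  show "w @ [y] \<in> shifted_words (smaya g)" if "sstep g' y b g" "w \<in> shifted_words (smaya g')" for g g' y b w
    using sstep_move[OF that(1)] that(2) by (simp add: shifted_words_def)
  show "\<exists>g' b. sstep g' y b g \<and> w \<in> shifted_words (smaya g')"
    if g: "strict_partition g" and w: "w @ [y] \<in> shifted_words (smaya g)" for g y w
  proof -
    have o: "ok {..<0} (dbl w)" "ok (fin {..<0} (dbl w)) [- 1 - y, y]"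
      "fin (fin {..<0} (dbl w)) [- 1 - y, y] = smaya g" using w by (simp_all add: shifted_words_def)
    obtain g' where g': "strict_partition g'" "fin {..<0} (dbl w) = smaya g'" using reachable_smaya[OF o(1)] by blast
    from sstep_exists[OF g'(1)] o(2) g'(2) obtain b h where h: "sstep g' y b h" by metis
    have "smaya h = smaya g" using sstep_move(2)[OF h] o(3) g'(2) by metis
    then have "h = g" using smaya_inj h g by (auto simp: sstep_def)
    moreover have "w \<in> shifted_words (smaya g')" using g'(2) o(1) by (simp add: shifted_words_def)
    ultimately show ?thesis using h by blast
  qed
  show "[] \<in> shifted_words (smaya g) \<longleftrightarrow> shifted_diagram g = {}" if g: "strict_partition g" for g
  proof
    assume "[] \<in> shifted_words (smaya g)"
    then have "smaya g = smaya (\<lambda>_. 0)" by (simp add: shifted_words_def smaya_zero)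
    then have "g = (\<lambda>_. 0)" by (rule smaya_inj[OF g strict_zero])
    then show "shifted_diagram g = {}" by (auto simp: shifted_diagram_def)
  next
    assume e: "shifted_diagram g = {}"
    have "g r = 0" for r
    proof (cases "r = 0")
      case True
      then show ?thesis using strict_part[OF g] by (simp add: is_partition_def)
    next
      case False
      then have "(r, r) \<notin> shifted_diagram g" using e by simp
      then show ?thesis using False by (simp add: shifted_diagram_def)
    qed
    then have "g = (\<lambda>_. 0)" by blast
    then show "[] \<in> shifted_words (smaya g)" by (simp add: shifted_words_def smaya_zero)
  qed
qed (rule assms)

section \<open>Semistandard Young tableaux and words\<close>

definition ykey :: "nat \<times> nat \<Rightarrow> nat \<Rightarrow> nat \<times> int" where
  "ykey b x = (x, int (snd b) - int (fst b) - 1)"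

definition ystep :: "(nat \<Rightarrow> nat) \<Rightarrow> int \<Rightarrow> nat \<times> nat \<Rightarrow> (nat \<Rightarrow> nat) \<Rightarrow> bool" where
  "ystep p' y b p \<longleftrightarrow> is_partition p' \<and> is_partition p \<and>
    (\<exists>r\<ge>1. p = p'(r := Suc (p' r)) \<and> b = (r, Suc (p' r)) \<and> y = int (p' r) - int r)"

lemma ystep_move:
  assumes "ystep p' y b p" shows "y \<in> maya p'" "y + 1 \<notin> maya p'" "mv y (maya p') = maya p"
proof -
  obtain r where r: "1 \<le> r" "p = p'(r := Suc (p' r))" "y = int (p' r) - int r" and s: "is_partition p'" "is_partition p"
    using assms by (auto simp: ystep_def)
  show "y \<in> maya p'" using r by (auto simp: maya_def)
  show "mv y (maya p') = maya p" unfolding r(2,3) by (rule maya_mv[OF s(1) r(1)])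
  \<comment> \<open>A particle at y + 1 would belong to another row, ending at the same position as
    the lengthened row r.\<close>
  show "y + 1 \<notin> maya p'"
  proof
    assume "y + 1 \<in> maya p'"
    then obtain t where t: "1 \<le> t" "y + 1 = int (p' t) - int t" by (auto simp: maya_def)
    then have "t \<noteq> r" using r(3) by auto
    then have "int (p t) - int t = int (p r) - int r" using t r by simp
    then show False using maya_strict[OF s(2) t(1), of r] maya_strict[OF s(2) r(1), of t] \<open>t \<noteq> r\<close> by linarith
  qed
qed

lemma ystep_exists:
  assumes p: "is_partition p" and y: "y \<in> maya p" "y + 1 \<notin> maya p"
  shows "\<exists>b p'. ystep p y b p'"
proof -
  obtain r where r: "1 \<le> r" "y = int (p r) - int r" using y(1) by (auto simp: maya_def)
  then have "is_partition (p(r := Suc (p r)))" using is_partition_add[OF p r(1)] y(2) by simp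
  then show ?thesis using p r unfolding ystep_def by blast
qed

lemma young_removal:
  assumes p: "is_partition p" and b: "b \<in> young_diagram p" and max: "\<And>b'. b' \<in> young_diagram p \<Longrightarrow> \<not> before b b'"
  shows "\<exists>p'. ystep p' (snd (ykey b l)) b p"
proof -
  obtain r c where e: "b = (r, c)" by fastforce
  have rc: "1 \<le> r" "1 \<le> c" "c \<le> p r" using b e by (auto simp: young_diagram_def)
  have "(r, Suc c) \<notin> young_diagram p" using max[of "(r, Suc c)"] e by (auto simp: before_def)
  then have c: "c = p r" using rc by (auto simp: young_diagram_def)
  have "(Suc r, c) \<notin> young_diagram p" using max[of "(Suc r, c)"] e by (auto simp: before_def)
  then have up: "p (Suc r) < p r" using rc c by (auto simp: young_diagram_def)
  let ?h = "p(r := p r - 1)"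
  have "finite {i. p i > 0}" using p by (simp add: is_partition_def)
  moreover have "{i. ?h i > 0} \<subseteq> {i. p i > 0}" by (auto split: if_splits)
  ultimately have "finite {i. ?h i > 0}" using finite_subset by blast
  moreover have "?h (Suc i) \<le> ?h i" if "1 \<le> i" for i
  proof (cases "i = r")
    case True
    then show ?thesis using up by auto
  next
    case False
    have "p (Suc i) \<le> p i" using p that by (auto simp: is_partition_def)
    then show ?thesis using False by auto
  qed
  moreover have "?h 0 = 0" using p rc by (simp add: is_partition_def)
  ultimately have h: "is_partition ?h" by (simp add: is_partition_def)
  have 1: "p = ?h(r := Suc (?h r))" using rc c by auto
  have 2: "b = (r, Suc (?h r))" using c e rc by simp
  have 3: "snd (ykey b l) = int (?h r) - int r" using e c rc by (auto simp: ykey_def)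
  have "ystep ?h (snd (ykey b l)) b p" unfolding ystep_def
    by (intro conjI h p exI[of _ r] rc(1)) (rule 1 2 3)+
  then show ?thesis by blast
qed

lemma young_closed:
  assumes "is_partition p" "(r', c) \<in> young_diagram p" "1 \<le> r" "r \<le> r'"
  shows "(r, c) \<in> young_diagram p"
  using partition_antimono[OF assms(1,3,4)] assms by (auto simp: young_diagram_def)

lemma partition_zero: "is_partition (\<lambda>_. 0)" by (simp add: is_partition_def)

lemma young_separated:
  assumes g: "is_partition p" and b: "b \<in> young_diagram p" "b' \<in> young_diagram p" and k: "ykey b l = ykey b' l'"
  shows "b = b' \<or> (\<exists>d\<in>young_diagram p. before b d \<and> before d b' \<or> before b' d \<and> before d b)"
proof -
  obtain r c r' c' where e: "b = (r, c)" "b' = (r', c')" by (metis surj_pair)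
  have rc: "1 \<le> r" "1 \<le> r'" using b e by (auto simp: young_diagram_def)
  have q: "int c - int r = int c' - int r'" using k e rc by (simp add: ykey_def)
  consider "r = r'" | "r < r'" | "r' < r" by linarith
  then show ?thesis
  proof cases
    case 2
    have "(r, c') \<in> young_diagram p" by (rule young_closed[OF g, of r']) (use b e 2 rc in auto)
    moreover have "before b (r, c')" "before (r, c') b'" using 2 q e by (auto simp: before_def)
    ultimately show ?thesis by blast
  next
    case 3
    have "(r', c) \<in> young_diagram p" by (rule young_closed[OF g, of r]) (use b e 3 rc in auto)
    moreover have "before b' (r', c)" "before (r', c) b" using 3 q e by (auto simp: before_def)
    ultimately show ?thesis by blast
  qed (use q e in simp)
qed

lemma bij_young:
  assumes "is_partition p"
  shows "bij_betw (keys ykey (young_diagram p)) (fillings ykey (\<lambda>_ x. 1 \<le> x) (young_diagram p)) (pair_words (words (maya p)))"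
proof (rule bij_keys[of is_partition young_diagram "\<lambda>_ x. 1 \<le> x" ykey ystep "\<lambda>p. words (maya p)"])
  show "finite (young_diagram p)" if "is_partition p" for p by (rule finite_young_diagram[OF that])
  show "1 \<le> fst (ykey b l)" if "1 \<le> l" for b l using that by (simp add: ykey_def)
  show "l = l'" if "ykey b l = ykey b l'" for b l l' using that by (simp add: ykey_def)
  show "b = b' \<or> (\<exists>d\<in>young_diagram p. before b d \<and> before d b' \<or> before b' d \<and> before d b)"
    if g: "is_partition p" and b: "b \<in> young_diagram p" "b' \<in> young_diagram p"
      and k: "ykey b l = ykey b' l'" for p b b' l l'
    by (rule young_separated[OF g b k])
  show "\<exists>p'. ystep p' (snd (ykey b l)) b p"
    if "is_partition p" "b \<in> young_diagram p" "1 \<le> l" "\<And>b'. b' \<in> young_diagram p \<Longrightarrow> \<not> before b b'" for p b l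
    by (rule young_removal[OF that(1,2,4)])
  show "is_partition p' \<and> young_diagram p = insert b (young_diagram p') \<and> b \<notin> young_diagram p' \<and>
      (\<forall>b'\<in>young_diagram p. \<not> before b b')" if st: "ystep p' y b p" for p p' y b
  proof -
    obtain r where r: "1 \<le> r" "p = p'(r := Suc (p' r))" "b = (r, Suc (p' r))" and s: "is_partition p'" "is_partition p"
      using st by (auto simp: ystep_def)
    have "young_diagram p = insert b (young_diagram p')"
      using r by (auto simp: young_diagram_def split: if_splits)
    moreover have "b \<notin> young_diagram p'" using r by (simp add: young_diagram_def)
    moreover have "\<not> before b b'" if b': "b' \<in> young_diagram p" for b'
    proof
      assume a: "before b b'"
      obtain r' c' where e: "b' = (r', c')" by fastforce
      show False
      proof (cases "r' = r")
        case True
        then show False using a e r b' by (auto simp: before_def young_diagram_def)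
      next
        case False
        then have c: "c' = Suc (p' r)" "r < r'" using a e r by (auto simp: before_def)
        have "p' r' \<le> p' r" using partition_antimono[OF s(1) r(1), of r'] c by simp
        then show False using b' e c r False by (simp add: young_diagram_def)
      qed
    qed
    ultimately show ?thesis using s by blast
  qed
  show "p' = p'' \<and> b = b'" if st: "ystep p' y b p" "ystep p'' y b' p" for p p' p'' y b b'
  proof -
    obtain r where r: "1 \<le> r" "p = p'(r := Suc (p' r))" "b = (r, Suc (p' r))" "y = int (p' r) - int r"
      and s: "is_partition p" using st(1) by (auto simp: ystep_def)
    obtain r2 where r2: "1 \<le> r2" "p = p''(r2 := Suc (p'' r2))" "b' = (r2, Suc (p'' r2))" "y = int (p'' r2) - int r2"
      using st(2) by (auto simp: ystep_def)
    have gr: "p r = Suc (p' r)" "p r2 = Suc (p'' r2)" using fun_cong[OF r(2), of r] fun_cong[OF r2(2), of r2] by simp_all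
    then have "int (p r) - int r = int (p r2) - int r2" using r(4) r2(4) by simp
    then have "r = r2" using maya_strict[OF s r(1), of r2] maya_strict[OF s r2(1), of r] by (cases r r2 rule: linorder_cases) auto
    moreover have "p' x = p'' x" for x
      using fun_cong[OF r(2), of x] fun_cong[OF r2(2), of x] \<open>r = r2\<close> gr by (cases "x = r") simp_all
    ultimately show ?thesis using r(3) r2(3) by auto
  qed
  show "\<exists>l\<ge>1. ykey b l = (i, y)" if st: "ystep p' y b p" "1 \<le> i" for p p' y b i
    using st by (auto simp: ystep_def ykey_def)
  show "w @ [y] \<in> words (maya p)" if "ystep p' y b p" "w \<in> words (maya p')" for p p' y b w
    using ystep_move[OF that(1)] that(2) by (simp add: words_def)
  show "\<exists>p' b. ystep p' y b p \<and> w \<in> words (maya p')"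
    if g: "is_partition p" and w: "w @ [y] \<in> words (maya p)" for p y w
  proof -
    have o: "ok {..<0} w" "y \<in> fin {..<0} w" "y + 1 \<notin> fin {..<0} w" "mv y (fin {..<0} w) = maya p"
      using w by (simp_all add: words_def)
    obtain p' where p': "is_partition p'" "fin {..<0} w = maya p'" using reachable_maya[OF o(1)] by blast
    from ystep_exists[OF p'(1)] o(2,3) p'(2) obtain b h where h: "ystep p' y b h" by metis
    have "maya h = maya p" using ystep_move(3)[OF h] o(4) p'(2) by metis
    then have "h = p" using maya_inj h g by (auto simp: ystep_def)
    moreover have "w \<in> words (maya p')" using p'(2) o(1) by (simp add: words_def)
    ultimately show ?thesis using h by blast
  qed
  show "[] \<in> words (maya p) \<longleftrightarrow> young_diagram p = {}" if g: "is_partition p" for p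
  proof
    assume "[] \<in> words (maya p)"
    then have "maya p = maya (\<lambda>_. 0)" by (simp add: words_def maya_zero)
    then have "p = (\<lambda>_. 0)" by (rule maya_inj[OF g partition_zero])
    then show "young_diagram p = {}" by (auto simp: young_diagram_def)
  next
    assume e: "young_diagram p = {}"
    have "p r = 0" for r
    proof (cases "r = 0")
      case True
      then show ?thesis using g by (simp add: is_partition_def)
    next
      case False
      then have "(r, 1) \<notin> young_diagram p" using e by simp
      then show ?thesis using False by (simp add: young_diagram_def)
    qed
    then have "p = (\<lambda>_. 0)" by blast
    then show "[] \<in> words (maya p)" by (simp add: words_def maya_zero)
  qed
qed (rule assms)

lemma SSYT_fillings:
  assumes p: "is_partition p"
  shows "SSYT n p = {T \<in> fillings ykey (\<lambda>_ x. 1 \<le> x) (young_diagram p). \<forall>b\<in>young_diagram p. T b \<le> n}" (is "_ = ?R")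
proof (intro set_eqI iffI)
  fix T assume T: "T \<in> SSYT n p"
  have "ykey b (T b) < ykey b' (T b')" if b: "b \<in> young_diagram p" "b' \<in> young_diagram p" "before b b'" for b b'
  proof -
    obtain r c r' c' where e: "b = (r, c)" "b' = (r', c')" by (metis surj_pair)
    consider "r = r'" "c < c'" | "c = c'" "r < r'" using b(3) e by (auto simp: before_def)
    then show ?thesis
    proof cases
      case 1
      then have "T b \<le> T b'" using T b e unfolding SSYT_def by blast
      then show ?thesis using 1 e by (auto simp: ykey_def less_prod_def)
    next
      case 2
      then have "T b < T b'" using T b e unfolding SSYT_def by blast
      then show ?thesis by (simp add: ykey_def less_prod_def)
    qed
  qed
  then show "T \<in> ?R" using T by (auto simp: fillings_def SSYT_def PiE_def Pi_def)
next
  fix T assume T: "T \<in> ?R"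
  then have F: "T \<in> fillings ykey (\<lambda>_ x. 1 \<le> x) (young_diagram p)" by blast
  have "T (r, c) \<le> T (r, c')" if "(r, c) \<in> young_diagram p" "(r, c') \<in> young_diagram p" "c < c'" for r c c'
    using fillings_less[OF F that(1,2)] that(3) by (auto simp: before_def ykey_def less_prod_def)
  moreover have "T (r, c) < T (r', c)" if "(r, c) \<in> young_diagram p" "(r', c) \<in> young_diagram p" "r < r'" for r r' c
    using fillings_less[OF F that(1,2)] that(3) by (auto simp: before_def ykey_def less_prod_def)
  moreover have "T \<in> young_diagram p \<rightarrow>\<^sub>E {1..n}" using T by (auto simp: fillings_def PiE_def)
  ultimately show "T \<in> SSYT n p" unfolding SSYT_def by blast
qed

section \<open>The hook reading word against the reading by letters\<close>

lemma concat_sorted: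
  assumes "\<And>x. x \<in> set xs \<Longrightarrow> sorted_wrt R (f x)"
    and "sorted_wrt (\<lambda>x x'. \<forall>a\<in>set (f x). \<forall>b\<in>set (f x'). R a b) xs"
  shows "sorted_wrt R (concat (map f xs))"
  using assms by (induction xs) (auto simp: sorted_wrt_append)

lemma sorted_wrt_distinct:
  assumes "sorted_wrt R xs" "\<And>x. \<not> R x x" shows "distinct xs"
  using assms by (induction xs) auto

lemma num_mono: "x \<le> x' \<Longrightarrow> num x \<le> num x'"
  by (cases x; cases x') (auto simp: less_eq_letter_def)

lemma letter_between:
  assumes "i \<le> num x" "x \<le> v" "v \<le> x'" "num x' \<le> Suc i"
  shows "v = Marked i \<or> v = Unmarked i \<or> v = Marked (Suc i) \<or> v = Unmarked (Suc i)"
proof -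
  have "i \<le> num v" "num v \<le> Suc i" using num_mono[OF assms(2)] num_mono[OF assms(3)] assms by linarith+
  then have "num v = i \<or> num v = Suc i" by linarith
  then show ?thesis by (cases v) auto
qed

locale shifted_tableau =
  fixes g :: "nat \<Rightarrow> nat" and T :: "nat \<times> nat \<Rightarrow> letter"
  assumes g: "strict_partition g" and T: "T \<in> SSHT g"
begin

abbreviation "D \<equiv> shifted_diagram g"

definition yv :: "nat \<times> nat \<Rightarrow> int" where "yv b = snd (skey b (T b))"
text \<open>The stage of the hook reading word at which the box is read; larger values are read
  earlier.\<close>

definition hook :: "nat \<times> nat \<Rightarrow> nat" where "hook b = (if is_marked (T b) then snd b else fst b)"

lemma F: "T \<in> fillings skey sgood D" using T SSHT_fillings[OF g] by simp

lemma fD: "finite D" by (rule finite_shifted_diagram[OF g])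

lemma diag: "(r, c) \<in> D \<Longrightarrow> 1 \<le> r \<and> r \<le> c" by (simp add: shifted_diagram_def)

lemma inD: "(r', c') \<in> D \<Longrightarrow> 1 \<le> r \<Longrightarrow> r \<le> r' \<Longrightarrow> r \<le> c \<Longrightarrow> c \<le> c' \<Longrightarrow> (r, c) \<in> D"
  using shifted_closed[OF g, of r' c' r] by (auto simp: shifted_diagram_def)

lemma row: "(r, c) \<in> D \<Longrightarrow> (r, c') \<in> D \<Longrightarrow> c < c' \<Longrightarrow> T (r, c) \<le> T (r, c') \<and> \<not> (is_marked (T (r, c)) \<and> T (r, c) = T (r, c'))"
  using fillings_less[OF F, of "(r, c)" "(r, c')"] skey_row[of r c c'] diag[of r c] by (simp add: before_def)

lemma col: "(r, c) \<in> D \<Longrightarrow> (r', c) \<in> D \<Longrightarrow> r < r' \<Longrightarrow> T (r, c) \<le> T (r', c) \<and> \<not> (\<not> is_marked (T (r, c)) \<and> T (r, c) = T (r', c))"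
  using fillings_less[OF F, of "(r, c)" "(r', c)"] skey_col[of r r' c] diag[of r' c] by (simp add: before_def)

lemma mono: assumes "(r, c) \<in> D" "(r', c') \<in> D" "r \<le> r'" "c \<le> c'" shows "T (r, c) \<le> T (r', c')"
proof -
  have m: "(r, c') \<in> D" by (rule inD[OF assms(2)]) (use diag[OF assms(1)] assms in auto)
  have "T (r, c) \<le> T (r, c')" using row[OF assms(1) m] assms(4) by (cases "c = c'") auto
  also have "\<dots> \<le> T (r', c')" using col[OF m assms(2)] assms(3) by (cases "r = r'") auto
  finally show ?thesis .
qed

lemma noU: "(r, c) \<in> D \<Longrightarrow> (r', c) \<in> D \<Longrightarrow> r < r' \<Longrightarrow> T (r, c) = Unmarked k \<Longrightarrow> T (r', c) = Unmarked k \<Longrightarrow> False"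
  using col[of r c r'] by simp

lemma noM: "(r, c) \<in> D \<Longrightarrow> (r, c') \<in> D \<Longrightarrow> c < c' \<Longrightarrow> T (r, c) = Marked k \<Longrightarrow> T (r, c') = Marked k \<Longrightarrow> False"
  using row[of r c c'] by simp

lemma unm_diag: "(r, r) \<in> D \<Longrightarrow> \<not> is_marked (T (r, r))"
  using F by (auto simp: fillings_def sgood_def)

lemma letterE:
  assumes "num x = k" obtains "x = Marked k" "is_marked x" | "x = Unmarked k" "\<not> is_marked x"
  using assms that by (cases x) auto

text \<open>By monotonicity, b is not weakly below and to the left of a. Together with the
  comparison of letters, this forces a into a smaller hook, so a is read after b.\<close>

lemma C1:
  assumes "a \<in> D" "b \<in> D" "num (T a) < num (T b)" "yv b \<le> yv a" shows "hook a < hook b"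
proof -
  obtain r c r' c' where e: "a = (r, c)" "b = (r', c')" by (metis surj_pair)
  have n: "\<not> (r' \<le> r \<and> c' \<le> c)" using mono[of r' c' r c] num_mono assms e by (metis leD)
  have "r \<le> c" "r' \<le> c'" using diag assms e by auto
  then show ?thesis using n assms(4) unfolding yv_def hook_def skey_def e fst_conv snd_conv
    by (cases "is_marked (T (r, c))"; cases "is_marked (T (r', c'))"; simp; linarith)
qed

text \<open>Otherwise a lies strictly above and to the right of b, and a box between them repeats a
  letter: a marked one in the row of b or an unmarked one in the column of a. If b is marked and a
  is not, that box is found through the diagonal box (c, c), which cannot be marked.\<close>

lemma C2:
  assumes "a \<in> D" "b \<in> D" "num (T a) = k" "num (T b) = k" "yv b < yv a" shows "hook a \<le> hook b"
proof (rule ccontr)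
  obtain r c r' c' where e: "b = (r, c)" "a = (r', c')" by (metis surj_pair)
  have d: "1 \<le> r" "r \<le> c" "1 \<le> r'" "r' \<le> c'" using diag assms e by auto
  have D: "(r, c) \<in> D" "(r', c') \<in> D" using assms e by auto
  assume h: "\<not> hook a \<le> hook b"
  from assms(4) show False
  proof (cases rule: letterE)
    case b: 1
    from assms(3) show False
    proof (cases rule: letterE)
      case a: 1
      have lt: "c < c'" "r < r'" using h assms(5) a b e by (auto simp: hook_def yv_def skey_def)
      have m: "(r, c') \<in> D" by (rule inD[OF D(2)]) (use d lt in auto)
      have "T (r, c) \<le> T (r, c')" "T (r, c') \<le> T (r', c')" using mono D m lt by auto
      then have "T (r, c') = Marked k" using a b e by simp
      then show False using noM[OF D(1) m lt(1)] b e by simp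
    next
      case a: 2
      have lt: "c < r'" using h a b e by (simp add: hook_def)
      have m: "(c, c) \<in> D" "(c, c') \<in> D" using inD[OF D(2)] d lt by auto
      have le: "T (r, c) \<le> T (c, c)" "T (c, c) \<le> T (c, c')" "T (c, c') \<le> T (r', c')"
        using mono D m d lt by auto
      have "T (c, c) = Unmarked k" using unm_diag[OF m(1)] le a b e
        by (cases "T (c, c)") (auto simp: less_eq_letter_def)
      then have "T (c, c') = Unmarked k" using le a e by simp
      then show False using noU[OF m(2) D(2) lt] a e by simp
    qed
  next
    case b: 2
    from assms(3) show False
    proof (cases rule: letterE)
      case a: 1
      then show False using assms(5) b e d by (simp add: yv_def skey_def)
    next
      case a: 2
      have lt: "r < r'" "c < c'" using h assms(5) a b e by (auto simp: hook_def yv_def skey_def)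
      have m: "(r, c') \<in> D" by (rule inD[OF D(2)]) (use d lt in auto)
      have "T (r, c) \<le> T (r, c')" "T (r, c') \<le> T (r', c')" using mono D m lt by auto
      then have "T (r, c') = Unmarked k" using a b e by simp
      then show False using noU[OF m D(2) lt(1)] a e by simp
    qed
  qed
qed

text \<open>The box diagonally below b and to its left is sandwiched between a and b, so its label
  is i or i + 1. Either it carries label i with the same letter as b, which \<open>free\<close>
  forbids, or a mark on the diagonal, an unmarked letter twice in a column or a marked one twice in
  a row results, or the order is violated.\<close>

lemma C4:
  assumes a: "a \<in> D" "num (T a) = i" and b: "b \<in> D" "num (T b) = Suc i"
    and free: "\<And>d. d \<in> D \<Longrightarrow> num (T d) = i \<Longrightarrow> yv d \<noteq> yv b"
    and y: "yv a < yv b" and h: "hook a < hook b"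
  shows False
proof -
  obtain r c r1 c1 where e: "b = (r, c)" "a = (r1, c1)" by (metis surj_pair)
  have D: "(r, c) \<in> D" "(r1, c1) \<in> D" using a b e by auto
  have d: "1 \<le> r" "r \<le> c" "1 \<le> r1" "r1 \<le> c1" using diag D by auto
  let ?r = "r - 1" and ?c = "c - 1"
  have num_a: "i \<le> num (T (r1, c1))" and num_b: "num (T (r, c)) \<le> Suc i" using a(2) b(2) e by simp_all
  from b(2) show False
  proof (cases rule: letterE)
    case bU: 2
    have "r1 < r \<and> c1 < c \<and> 2 \<le> r"
    proof (cases "is_marked (T a)")
      case True
      have "c1 < r" using h True bU e by (simp add: hook_def)
      then show ?thesis using d by linarith
    next
      case False
      have "r1 < r" using h False bU e by (simp add: hook_def)
      moreover have "int c1 - int r1 < int c - int r" using y False bU e by (simp add: yv_def skey_def)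
      ultimately show ?thesis using d by linarith
    qed
    then have lt: "r1 \<le> ?r" "c1 \<le> ?c" "2 \<le> r" by linarith+
    have m: "(?r, ?c) \<in> D" "(?r, c) \<in> D" "(?r, ?r) \<in> D" using inD[OF D(1)] d lt by auto
    have le: "T (r1, c1) \<le> T (?r, ?c)" "T (?r, ?c) \<le> T (?r, c)" "T (?r, c) \<le> T (r, c)" "T (?r, ?r) \<le> T (?r, ?c)"
      using mono D m d lt by auto
    have le2: "T (?r, ?c) \<le> T (r, c)" by (rule order_trans[OF le(2,3)])
    consider "T (?r, ?c) = Marked i" | "T (?r, ?c) = Unmarked i" | "T (?r, ?c) = Marked (Suc i)" | "T (?r, ?c) = Unmarked (Suc i)"
      using letter_between[OF _ le(1) le2, of i] num_a num_b by auto
    then show False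
    proof cases
      \<comment> \<open>Then a is marked too, so it lies in a column before r and below the diagonal
        box (r - 1, r - 1), which is thereby squeezed between two equal marked entries.\<close>
      case 1
      have "T (r1, c1) = Marked i" using le(1) a(2) e 1 by (cases "T (r1, c1)") (auto simp: less_eq_letter_def)
      then have "c1 < r" using h bU e by (simp add: hook_def)
      then have "T (r1, c1) \<le> T (?r, ?r)" using mono[OF D(2) m(3)] lt by simp
      then have "T (?r, ?r) = Marked i" using le(4) 1 \<open>T (r1, c1) = Marked i\<close> by simp
      then show False using unm_diag[OF m(3)] by simp
    next
      case 2
      have "yv (?r, ?c) = yv b" using 2 bU e lt d by (simp add: yv_def skey_def)
      then show False using free[OF m(1)] 2 by simp
    next
      case 3
      have "T (?r, c) = Marked (Suc i) \<or> T (?r, c) = Unmarked (Suc i)"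
        using le(2,3) 3 bU e by (cases "T (?r, c)") (auto simp: less_eq_letter_def)
      then show False using noM[OF m(1,2) _ 3] noU[OF m(2) D(1)] bU e lt d by auto
    next
      case 4
      then have "T (?r, c) = Unmarked (Suc i)" using le(2,3) bU e by simp
      then show False using noU[OF m(2) D(1)] bU e lt by auto
    qed
  next
    case bM: 1
    have "r \<noteq> c" using unm_diag[of r] D(1) bM e by auto
    then have rc: "r < c" using d by simp
    have aM: "is_marked (T a)" using y bM e d rc by (cases "is_marked (T a)") (auto simp: yv_def skey_def)
    have "c1 < c" using h bM aM e by (simp add: hook_def)
    moreover have "int r1 - int c1 < int r - int c" using y bM aM e by (simp add: yv_def skey_def)
    ultimately have lt: "r1 < ?r" "c1 \<le> ?c" "3 \<le> r" using d by linarith+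
    have m: "(?r, ?c) \<in> D" "(?r, c) \<in> D" "(r, ?c) \<in> D" using inD[OF D(1)] d lt rc by auto
    have le: "T (r1, c1) \<le> T (?r, ?c)" "T (?r, ?c) \<le> T (?r, c)" "T (?r, c) \<le> T (r, c)"
      "T (?r, ?c) \<le> T (r, ?c)" "T (r, ?c) \<le> T (r, c)"
      using mono D m d lt by auto
    have le2: "T (?r, ?c) \<le> T (r, c)" by (rule order_trans[OF le(2,3)])
    consider "T (?r, ?c) = Marked i" | "T (?r, ?c) = Unmarked i" | "T (?r, ?c) = Marked (Suc i)" | "T (?r, ?c) = Unmarked (Suc i)"
      using letter_between[OF _ le(1) le2, of i] num_a num_b by auto
    then show False
    proof cases
      case 1
      have "yv (?r, ?c) = yv b" using 1 bM e lt d by (simp add: yv_def skey_def)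
      then show False using free[OF m(1)] 1 by simp
    next
      case 2
      have "T (r, ?c) = Unmarked i \<or> T (r, ?c) = Marked (Suc i)"
        using le(4,5) 2 bM e by (cases "T (r, ?c)") (auto simp: less_eq_letter_def)
      then show False using noU[OF m(1,3) _ 2] noM[OF m(3) D(1)] bM e lt rc by auto
    next
      case 3
      then have "T (?r, c) = Marked (Suc i)" using le(2,3) bM e by simp
      then show False using noM[OF m(1,2) _ 3] rc by auto
    next
      case 4
      then show False using le2 bM e by (auto simp: less_eq_letter_def)
    qed
  qed
qed

text \<open>The reading order: within one hook the letters increase, being negative on the marked
  column from bottom to top and nonnegative on the unmarked row from left to right.\<close>

definition pos :: "nat \<times> nat \<Rightarrow> nat \<times> nat \<Rightarrow> bool" where
  "pos b b' \<longleftrightarrow> hook b' < hook b \<or> hook b = hook b' \<and> yv b < yv b'"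

definition hook_row :: "nat \<Rightarrow> (nat \<times> nat) list" where
  "hook_row i = filter (\<lambda>b. is_marked (T b)) (map (\<lambda>r. (r, i)) (filter (\<lambda>r. (r, i) \<in> D) [1..<Suc (num_parts g)]))
    @ filter (\<lambda>b. \<not> is_marked (T b)) (map (\<lambda>c. (i, c)) [i..<i + g i])"

definition hook_cells :: "(nat \<times> nat) list" where
  "hook_cells = concat (map hook_row (rev [1..<Suc (max (g 1) (num_parts g))]))"

lemma map_hook_cells: "map T hook_cells = hook_word g T"
proof -
  have "map T (hook_row i) = marked_column g T i @ unmarked_row g T i" for i
    by (simp add: hook_row_def marked_column_def unmarked_row_def filter_map o_def del: upt_Suc)
  then show ?thesis by (simp add: hook_cells_def hook_word_def map_concat o_def del: upt_Suc)
qed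

lemma hook_row_hook: "b \<in> set (hook_row i) \<Longrightarrow> hook b = i"
  by (auto simp: hook_row_def hook_def simp del: upt_Suc)

lemma sorted_hook_row: "sorted_wrt pos (hook_row i)"
proof -
  have s: "sorted_wrt (<) [m..<n]" for m n :: nat by simp
  let ?M = "filter (\<lambda>b. is_marked (T b)) (map (\<lambda>r. (r, i)) (filter (\<lambda>r. (r, i) \<in> D) [1..<Suc (num_parts g)]))"
  let ?U = "filter (\<lambda>b. \<not> is_marked (T b)) (map (\<lambda>c. (i, c)) [i..<i + g i])"
  have "sorted_wrt (\<lambda>a b. fst a < fst b \<and> snd a = snd b) ?M"
    by (intro sorted_wrt_filter) (simp add: sorted_wrt_map sorted_wrt_filter s del: upt_Suc)
  then have "sorted_wrt pos ?M"
    by (rule sorted_wrt_mono_rel[rotated]) (auto simp: pos_def hook_def yv_def skey_def)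
  moreover have "sorted_wrt (\<lambda>a b. snd a < snd b \<and> fst a = fst b) ?U"
    by (intro sorted_wrt_filter) (simp add: sorted_wrt_map s)
  then have "sorted_wrt pos ?U"
    by (rule sorted_wrt_mono_rel[rotated]) (auto simp: pos_def hook_def yv_def skey_def)
  moreover have "pos a b" if "a \<in> set ?M" "b \<in> set ?U" for a b
    using that by (auto simp: pos_def hook_def yv_def skey_def shifted_diagram_def simp del: upt_Suc)
  ultimately show ?thesis unfolding hook_row_def sorted_wrt_append by blast
qed

lemma sorted_hook_cells: "sorted_wrt pos hook_cells"
  unfolding hook_cells_def
proof (rule concat_sorted[OF sorted_hook_row])
  have "sorted_wrt (\<lambda>x x'. x' < x) (rev [1..<Suc (max (g 1) (num_parts g))])"
    unfolding sorted_wrt_rev by (simp del: upt_Suc)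
  then show "sorted_wrt (\<lambda>x x'. \<forall>a\<in>set (hook_row x). \<forall>b\<in>set (hook_row x'). pos a b) (rev [1..<Suc (max (g 1) (num_parts g))])"
    by (rule sorted_wrt_mono_rel[rotated]) (auto simp: pos_def dest!: hook_row_hook)
qed

lemma distinct_hook_cells: "distinct hook_cells"
  by (rule sorted_wrt_distinct[OF sorted_hook_cells]) (simp add: pos_def)

lemma set_hook_cells: "set hook_cells = D"
proof (intro set_eqI iffI)
  fix b assume "b \<in> set hook_cells"
  then show "b \<in> D" by (auto simp: hook_cells_def hook_row_def shifted_diagram_def simp del: upt_Suc)
next
  fix b assume b: "b \<in> D"
  obtain r c where e: "b = (r, c)" by fastforce
  note B = shifted_diagram_bounds[OF g b[unfolded e]]
  have c: "c < r + g r" using b e by (simp add: shifted_diagram_def)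
  have "b \<in> set (hook_row (hook b))"
    using b B c e by (auto simp: hook_row_def hook_def simp del: upt_Suc intro!: imageI)
  moreover have "hook b \<in> set (rev [1..<Suc (max (g 1) (num_parts g))])"
    using B e by (auto simp: hook_def simp del: upt_Suc)
  ultimately show "b \<in> set hook_cells" unfolding hook_cells_def by auto
qed

lemma num_count_hook:
  "num_count j (drop r (hook_word g T)) = card {b \<in> set (drop r hook_cells). num (T b) = j}"
proof -
  have "num_count j (drop r (hook_word g T)) = length (filter (\<lambda>b. num (T b) = j) (drop r hook_cells))"
    by (simp add: num_count_def map_hook_cells[symmetric] drop_map filter_map o_def)
  also have "\<dots> = card (set (filter (\<lambda>b. num (T b) = j) (drop r hook_cells)))"
    using distinct_hook_cells by (intro distinct_card[symmetric]) simp
  finally show ?thesis by (simp add: set_filter)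
qed

abbreviation "letters_from j x \<equiv> {b \<in> D. num (T b) = j \<and> x \<le> yv b}"

lemma fin_letters_from: "finite (letters_from j x)" using fD by simp

lemma inj: "inj_on (\<lambda>b. skey b (T b)) D"
  by (rule key_inj_on[OF F shifted_separated[OF g]])

lemma yv_inj: "a \<in> D \<Longrightarrow> b \<in> D \<Longrightarrow> num (T a) = num (T b) \<Longrightarrow> yv a = yv b \<Longrightarrow> a = b"
proof -
  assume "a \<in> D" "b \<in> D" "num (T a) = num (T b)" "yv a = yv b"
  then show "a = b" using inj_onD[OF inj, of a b] by (simp add: prod_eq_iff yv_def) (simp add: skey_def)
qed

text \<open>Let b be the box of label i + 1 with the smallest letter in the suffix. All boxes of
  label i + 1 in the suffix are counted at the threshold \<open>yv b\<close>, and by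
  \<open>C1\<close> every box of label i counted there is read after b, hence belongs to the
  suffix.\<close>

lemma suffix_if_above:
  assumes l: "\<And>x. card (letters_from (Suc i) x) \<le> card (letters_from i x)"
  shows "num_count (Suc i) (drop r (hook_word g T)) \<le> num_count i (drop r (hook_word g T))"
proof -
  define S where "S = set (drop r hook_cells)"
  let ?J = "{b \<in> S. num (T b) = Suc i}"
  have SD: "S \<subseteq> D" using set_drop_subset[of r hook_cells] set_hook_cells by (simp add: S_def)
  have fS: "finite S" by (simp add: S_def)
  have "card ?J \<le> card {b \<in> S. num (T b) = i}"
  proof (cases "?J = {}")
    case True
    then show ?thesis by (metis card.empty le0)
  next
    case False
    define b where "b = arg_min_on yv ?J"
    have fJ: "finite ?J" using fS by simp
    have b: "b \<in> ?J" "\<not> (\<exists>x\<in>?J. yv x < yv b)" using arg_min_if_finite[OF fJ False, of yv] by (simp_all add: b_def)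
    have "?J \<subseteq> letters_from (Suc i) (yv b)"
    proof
      fix x assume x: "x \<in> ?J"
      then have "yv b \<le> yv x" using b(2) by (meson linorder_not_le)
      then show "x \<in> letters_from (Suc i) (yv b)" using x SD by auto
    qed
    then have "card ?J \<le> card (letters_from (Suc i) (yv b))" by (rule card_mono[OF fin_letters_from])
    also have "\<dots> \<le> card (letters_from i (yv b))" by (rule l)
    also have "\<dots> \<le> card {b \<in> S. num (T b) = i}"
    proof (rule card_mono)
      show "letters_from i (yv b) \<subseteq> {b \<in> S. num (T b) = i}"
      proof
        fix a assume a: "a \<in> letters_from i (yv b)"
        then have h: "hook a < hook b" using C1[of a b] b(1) SD by auto
        have "a \<notin> set (take r hook_cells)"
        proof
          assume "a \<in> set (take r hook_cells)"
          then have "pos a b" using sorted_hook_cells b(1) unfolding S_def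
            by (metis (no_types, lifting) append_take_drop_id mem_Collect_eq sorted_wrt_append)
          then show False using h by (auto simp: pos_def)
        qed
        moreover have "a \<in> set (take r hook_cells @ drop r hook_cells)"
          unfolding append_take_drop_id set_hook_cells using a by simp
        ultimately have "a \<in> S" unfolding S_def set_append by blast
        then show "a \<in> {b \<in> S. num (T b) = i}" using a by simp
      qed
    qed (use fS in simp)
    finally show ?thesis .
  qed
  then show ?thesis unfolding num_count_hook S_def .
qed

text \<open>Take the largest letter \<open>yv b\<close> of a box of label i + 1 at which the
  inequality fails. No box of label i has this letter, since otherwise it would fail further up too.
  In the suffix that starts at b, \<open>C2\<close> guarantees all boxes of label i + 1 with at
  least this letter, and \<open>C4\<close> rules out boxes of label i with a smaller one; so the
  suffix violates its inequality.\<close>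

lemma above_if_suffix:
  assumes l: "\<And>r. r \<le> length (hook_word g T) \<Longrightarrow>
      num_count (Suc i) (drop r (hook_word g T)) \<le> num_count i (drop r (hook_word g T))"
  shows "card (letters_from (Suc i) x) \<le> card (letters_from i x)"
proof (rule ccontr)
  define E where "E = {b \<in> D. num (T b) = Suc i \<and> card (letters_from i (yv b)) < card (letters_from (Suc i) (yv b))}"
  have Emem: "z \<in> E \<longleftrightarrow> z \<in> D \<and> num (T z) = Suc i \<and> card (letters_from i (yv z)) < card (letters_from (Suc i) (yv z))" for z
    unfolding E_def by (rule mem_Collect_eq)
  have Eex: "\<exists>b\<in>E. x \<le> yv b" if c: "card (letters_from i x) < card (letters_from (Suc i) x)" for x
  proof -
    have ne: "letters_from (Suc i) x \<noteq> {}" using c by (metis card.empty not_less0)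
    define b where "b = arg_min_on yv (letters_from (Suc i) x)"
    have b: "b \<in> letters_from (Suc i) x" "\<not> (\<exists>z\<in>letters_from (Suc i) x. yv z < yv b)"
      using arg_min_if_finite[OF fin_letters_from ne, of yv] by (simp_all add: b_def)
    have "letters_from (Suc i) x \<subseteq> letters_from (Suc i) (yv b)"
    proof
      fix z assume z: "z \<in> letters_from (Suc i) x"
      then have "yv b \<le> yv z" using b(2) by (meson linorder_not_le)
      then show "z \<in> letters_from (Suc i) (yv b)" using z by simp
    qed
    then have 1: "card (letters_from (Suc i) x) \<le> card (letters_from (Suc i) (yv b))" by (rule card_mono[OF fin_letters_from])
    have "letters_from i (yv b) \<subseteq> letters_from i x" using b(1) by auto
    then have "card (letters_from i (yv b)) \<le> card (letters_from i x)" by (rule card_mono[OF fin_letters_from])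
    then have "b \<in> E" using 1 c b(1) by (simp add: E_def)
    then show ?thesis using b(1) by blast
  qed
  assume "\<not> card (letters_from (Suc i) x) \<le> card (letters_from i x)"
  then have ne: "E \<noteq> {}" using Eex[of x] by auto
  have fE: "finite E" using fD by (simp add: E_def)
  have "Max (yv ` E) \<in> yv ` E" by (rule Max_in) (use fE ne in blast)+
  then obtain b where b: "b \<in> E" "Max (yv ` E) = yv b" by (elim imageE)
  have max: "yv z \<le> yv b" if "z \<in> E" for z
  proof -
    have "finite (yv ` E)" by (rule finite_imageI[OF fE])
    moreover have "yv z \<in> yv ` E" by (rule imageI[OF that])
    ultimately have "yv z \<le> Max (yv ` E)" by (rule Max_ge)
    then show ?thesis unfolding b(2) .
  qed
  have bE: "b \<in> D \<and> num (T b) = Suc i \<and> card (letters_from i (yv b)) < card (letters_from (Suc i) (yv b))"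
    by (rule iffD1[OF Emem b(1)])
  note bD = conjunct1[OF bE] conjunct1[OF conjunct2[OF bE]] conjunct2[OF conjunct2[OF bE]]
  \<comment> \<open>A box d of label i with this letter balances b, so the deficit persists at the
    threshold \<open>yv b + 1\<close>, against the maximality of b.\<close>
  have free: "yv d \<noteq> yv b" if d: "d \<in> D" "num (T d) = i" for d
  proof
    assume y: "yv d = yv b"
    have "letters_from (Suc i) (yv b) \<subseteq> insert b (letters_from (Suc i) (yv b + 1))"
    proof
      fix z assume z: "z \<in> letters_from (Suc i) (yv b)"
      show "z \<in> insert b (letters_from (Suc i) (yv b + 1))"
      proof (cases "yv z = yv b")
        case True
        have "z = b" by (rule yv_inj) (use z bD(1,2) True in simp_all)
        then show ?thesis by blast
      qed (use z in auto)
    qed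
    then have "card (letters_from (Suc i) (yv b)) \<le> card (insert b (letters_from (Suc i) (yv b + 1)))"
      by (rule card_mono[rotated]) (use fin_letters_from in simp)
    also have "\<dots> \<le> Suc (card (letters_from (Suc i) (yv b + 1)))" by (rule card_insert_le_m1) simp_all
    finally have 1: "card (letters_from (Suc i) (yv b)) \<le> Suc (card (letters_from (Suc i) (yv b + 1)))" .
    have "insert d (letters_from i (yv b + 1)) \<subseteq> letters_from i (yv b)" using d y by auto
    then have "card (insert d (letters_from i (yv b + 1))) \<le> card (letters_from i (yv b))" by (rule card_mono[OF fin_letters_from])
    moreover have dn: "d \<notin> letters_from i (yv b + 1)" using y by simp
    ultimately have "Suc (card (letters_from i (yv b + 1))) \<le> card (letters_from i (yv b))"
      unfolding card_insert_disjoint[OF fin_letters_from dn] by blast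
    then have "card (letters_from i (yv b + 1)) < card (letters_from (Suc i) (yv b + 1))" using 1 bD(3) by linarith
    from Eex[OF this] obtain z where z: "z \<in> E" "yv b + 1 \<le> yv z" by blast
    then show False using max[OF z(1)] by linarith
  qed
  obtain u v where uv: "hook_cells = u @ b # v" using split_list[OF bD(1)[folded set_hook_cells]] by blast
  have sp: "\<And>a. a \<in> set u \<Longrightarrow> pos a b" "\<And>a. a \<in> set v \<Longrightarrow> pos b a"
    using sorted_hook_cells unfolding uv sorted_wrt_append by auto
  have dr: "drop (length u) hook_cells = b # v" using uv by simp
  have "length u \<le> length (hook_word g T)" unfolding map_hook_cells[symmetric] uv by simp
  from l[OF this] have "card {a \<in> set (b # v). num (T a) = Suc i} \<le> card {a \<in> set (b # v). num (T a) = i}"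
    unfolding num_count_hook dr .
  moreover have "letters_from (Suc i) (yv b) \<subseteq> {a \<in> set (b # v). num (T a) = Suc i}"
  proof
    fix a assume a: "a \<in> letters_from (Suc i) (yv b)"
    have "a \<notin> set u"
    proof
      assume "a \<in> set u"
      then have p: "pos a b" by (rule sp(1))
      show False
      proof (cases "yv a = yv b")
        case True
        have "a = b" by (rule yv_inj) (use a bD(1,2) True in simp_all)
        then show False using p by (simp add: pos_def)
      next
        case False
        then have "yv b < yv a" using a by simp
        then have "hook a \<le> hook b" using C2[of a b "Suc i"] a bD(1,2) by blast
        then show False using p a False by (auto simp: pos_def)
      qed
    qed
    moreover have "a \<in> set (u @ b # v)" using a set_hook_cells uv by auto
    ultimately show "a \<in> {a \<in> set (b # v). num (T a) = Suc i}" using a by auto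
  qed
  then have "card (letters_from (Suc i) (yv b)) \<le> card {a \<in> set (b # v). num (T a) = Suc i}" by (rule card_mono[rotated]) simp
  moreover have "{a \<in> set (b # v). num (T a) = i} \<subseteq> letters_from i (yv b)"
  proof
    fix a assume a: "a \<in> {a \<in> set (b # v). num (T a) = i}"
    then have "a \<noteq> b" using bD(2) by auto
    then have "a \<in> set v" using a by simp
    then have p: "pos b a" by (rule sp(2))
    have aD: "a \<in> D" "num (T a) = i" using a set_hook_cells uv by auto
    have "yv b \<le> yv a"
    proof (rule ccontr)
      assume y: "\<not> yv b \<le> yv a"
      then have "hook a < hook b" using p by (auto simp: pos_def)
      then show False using C4[OF aD bD(1,2) free] y by simp
    qed
    then show "a \<in> letters_from i (yv b)" using aD by simp
  qed
  then have "card {a \<in> set (b # v). num (T a) = i} \<le> card (letters_from i (yv b))" by (rule card_mono[OF fin_letters_from])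
  ultimately show False using bD(3) by linarith
qed

lemma cnt_blk: "cnt x (blk j (keys skey D T)) = int (card (letters_from j x))"
proof -
  have "cnt x (blk j (keys skey D T)) = int (length (filter (\<lambda>q. fst q = j \<and> x \<le> snd q) (keys skey D T)))"
    by (simp add: cnt_def blk_def filter_map o_def conj_commute)
  also have "\<dots> = int (card {b \<in> D. fst (skey b (T b)) = j \<and> x \<le> snd (skey b (T b))})"
    using length_filter_keys[where key = skey and T = T and D = D, OF fD inj] by simp
  also have "{b \<in> D. fst (skey b (T b)) = j \<and> x \<le> snd (skey b (T b))} = letters_from j x"
    by (auto simp: yv_def) (auto simp: skey_def)
  finally show ?thesis .
qed

text \<open>This replaces the hook reading word, which depends on the geometry of boxes, by the
  order of letters, which \<open>full\<close> can follow.\<close>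

lemma Yam_iff: "T \<in> Yam g \<longleftrightarrow> (\<forall>i\<ge>1. lattice (blk i (keys skey D T)) (blk (Suc i) (keys skey D T)))"
proof -
  have "(\<forall>r\<le>length (hook_word g T). num_count (Suc i) (drop r (hook_word g T)) \<le> num_count i (drop r (hook_word g T)))
    \<longleftrightarrow> lattice (blk i (keys skey D T)) (blk (Suc i) (keys skey D T))" for i
    unfolding lattice_def cnt_blk of_nat_le_iff using above_if_suffix[of i] suffix_if_above[of i] by blast
  then show ?thesis using T by (simp add: Yam_def)
qed

lemma wt_keys: "wt g T i = length (filter (\<lambda>q. fst q = i) (keys skey D T))"
proof -
  show ?thesis using length_filter_keys[where key = skey and T = T and D = D, OF fD inj] by (simp add: wt_def skey_def)
qed

end

section \<open>Expansion in fundamental quasisymmetric polynomials\<close>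

definition compatible :: "nat \<Rightarrow> int list \<Rightarrow> nat list set" where
  "compatible n ys = {is. length is = length ys \<and> set is \<subseteq> {1..n} \<and> sorted_wrt (<) (zip is ys)}"

definition letter_monomial :: "nat \<Rightarrow> nat list \<Rightarrow> mpolynomial" where
  "letter_monomial n is = monomial_pow n (\<lambda>i. length (filter (\<lambda>j. j = i) is))"

text \<open>Gessel's fundamental quasisymmetric polynomial: labels increase weakly, and strictly
  where the letters fail to increase, so it depends only on the length and descents of ys.\<close>

definition fundamental :: "nat \<Rightarrow> int list \<Rightarrow> mpolynomial" where
  "fundamental n ys = (\<Sum>is\<in>compatible n ys. letter_monomial n is)"

lemma finite_compatible: "finite (compatible n ys)"
proof (rule finite_subset)
  show "compatible n ys \<subseteq> {is. set is \<subseteq> {1..n} \<and> length is = length ys}" by (auto simp: compatible_def)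
qed (rule finite_lists_length_eq, simp)

lemma fundamental_full:
  assumes "ok X (dbl ys)" shows "fundamental n (fst (full ys)) = fundamental n ys"
proof -
  have "compatible n (fst (full ys)) = compatible n ys"
    unfolding compatible_def using compatible_full[OF assms] length_full by auto
  then show ?thesis by (simp add: fundamental_def)
qed

lemma sum_pair_words:
  assumes W: "finite W"
  shows "(\<Sum>ps\<in>{ps \<in> pair_words W. \<forall>q\<in>set ps. fst q \<le> n}. letter_monomial n (map fst ps)) = (\<Sum>ys\<in>W. fundamental n ys)"
proof -
  have "(\<Sum>ys\<in>W. fundamental n ys) = (\<Sum>(ys, is)\<in>Sigma W (compatible n). letter_monomial n is)"
    unfolding fundamental_def by (rule sum.Sigma) (use W finite_compatible in auto)
  also have "\<dots> = (\<Sum>ps\<in>{ps \<in> pair_words W. \<forall>q\<in>set ps. fst q \<le> n}. letter_monomial n (map fst ps))"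
  proof (rule sum.reindex_bij_witness[where j = "\<lambda>(ys, is). zip is ys" and i = "\<lambda>ps. (map snd ps, map fst ps)"])
    fix a assume a: "a \<in> Sigma W (compatible n)"
    obtain ys "is" where e: "a = (ys, is)" by fastforce
    have c: "ys \<in> W" "length is = length ys" "set is \<subseteq> {1..n}" "sorted_wrt (<) (zip is ys)"
      using a e by (auto simp: compatible_def)
    show "(\<lambda>ps. (map snd ps, map fst ps)) ((\<lambda>(ys, is). zip is ys) a) = a" using c e by simp
    have "fst q \<in> {1..n}" if "q \<in> set (zip is ys)" for q
      using set_zip_leftD[of "fst q" "snd q" "is" ys] that c(3) by auto
    then show "(\<lambda>(ys, is). zip is ys) a \<in> {ps \<in> pair_words W. \<forall>q\<in>set ps. fst q \<le> n}"
      using c e by (auto simp: pair_words_def)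
    show "letter_monomial n (map fst ((\<lambda>(ys, is). zip is ys) a)) = (\<lambda>(ys, is). letter_monomial n is) a" using c e by simp
  next
    fix ps assume p: "ps \<in> {ps \<in> pair_words W. \<forall>q\<in>set ps. fst q \<le> n}"
    show "(\<lambda>(ys, is). zip is ys) (map snd ps, map fst ps) = ps" by (simp add: zip_map_fst_snd)
    have "sorted_wrt (<) (zip (map fst ps) (map snd ps))" using p by (simp add: zip_map_fst_snd pair_words_def)
    moreover have "fst q \<in> {1..n}" if "q \<in> set ps" for q using p that by (simp add: pair_words_def)
    then have "set (map fst ps) \<subseteq> {1..n}" by auto
    moreover have "map snd ps \<in> W" using p by (simp add: pair_words_def)
    ultimately show "(map snd ps, map fst ps) \<in> Sigma W (compatible n)" by (simp add: compatible_def)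
  qed
  finally show ?thesis by simp
qed

lemma filter_map_fst: "length (filter (\<lambda>j. j = i) (map fst ps)) = length (filter (\<lambda>q. fst q = i) ps)"
  by (simp add: filter_map o_def)

lemma sum_fillings:
  assumes fD: "finite D" and W: "finite W"
    and bij: "bij_betw (keys key D) (fillings key good D) (pair_words W)"
    and inj: "\<And>T. T \<in> fillings key good D \<Longrightarrow> inj_on (\<lambda>b. key b (T b)) D"
  shows "(\<Sum>T\<in>{T \<in> fillings key good D. \<forall>b\<in>D. fst (key b (T b)) \<le> n}. monomial_pow n (\<lambda>i. card {b \<in> D. fst (key b (T b)) = i}))
    = (\<Sum>ys\<in>W. fundamental n ys)" (is "sum _ ?S = _")
proof -
  let ?P = "{ps \<in> pair_words W. \<forall>q\<in>set ps. fst q \<le> n}"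
  have img: "keys key D ` ?S = ?P"
  proof (intro set_eqI iffI)
    fix ps assume "ps \<in> keys key D ` ?S"
    then obtain T where T: "T \<in> fillings key good D" "\<forall>b\<in>D. fst (key b (T b)) \<le> n" "ps = keys key D T" by blast
    have "\<forall>q\<in>set (keys key D T). fst q \<le> n" unfolding set_keys[OF fD] using T(2) by blast
    then show "ps \<in> ?P" using bij_betw_apply[OF bij T(1)] T(3) by blast
  next
    fix ps assume p: "ps \<in> ?P"
    then obtain T where T: "T \<in> fillings key good D" "ps = keys key D T"
      using bij_betw_imp_surj_on[OF bij] by blast
    have "\<forall>q\<in>set (keys key D T). fst q \<le> n" using p T(2) by blast
    then have "T \<in> ?S" unfolding set_keys[OF fD] using T(1) by blast
    then show "ps \<in> keys key D ` ?S" using T by blast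
  qed
  have inj2: "inj_on (keys key D) ?S" by (rule inj_on_subset[OF bij_betw_imp_inj_on[OF bij]]) auto
  have "(\<Sum>ys\<in>W. fundamental n ys) = (\<Sum>ps\<in>keys key D ` ?S. letter_monomial n (map fst ps))"
    using sum_pair_words[OF W] img by simp
  also have "\<dots> = (\<Sum>T\<in>?S. letter_monomial n (map fst (keys key D T)))"
    using sum.reindex[OF inj2] by (simp add: o_def)
  also have "\<dots> = (\<Sum>T\<in>?S. monomial_pow n (\<lambda>i. card {b \<in> D. fst (key b (T b)) = i}))"
  proof (rule sum.cong[OF refl])
    fix T assume "T \<in> ?S"
    then have "inj_on (\<lambda>b. key b (T b)) D" using inj by simp
    then show "letter_monomial n (map fst (keys key D T)) = monomial_pow n (\<lambda>i. card {b \<in> D. fst (key b (T b)) = i})"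
      unfolding letter_monomial_def filter_map_fst
      by (simp add: length_filter_keys[where key = key and T = T and D = D, OF fD])
  qed
  finally show ?thesis by simp
qed

lemma schur_fundamental:
  assumes p: "is_partition p"
  shows "schur n p = (\<Sum>U\<in>words (maya p). fundamental n U)"
proof -
  let ?F = "fillings ykey (\<lambda>_ x. 1 \<le> x) (young_diagram p)"
  have fst: "fst (ykey b x) = x" for b x by (simp add: ykey_def)
  have "inj_on (\<lambda>b. ykey b (T b)) (young_diagram p)" if T: "T \<in> ?F" for T
  proof (rule key_inj_on[OF T])
    fix b b' and l l' :: nat
    assume b: "b \<in> young_diagram p" "b' \<in> young_diagram p" and k: "ykey b l = ykey b' l'"
    show "b = b' \<or> (\<exists>d\<in>young_diagram p. before b d \<and> before d b' \<or> before b' d \<and> before d b)"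
      by (rule young_separated[OF p b k])
  qed
  from sum_fillings[OF finite_young_diagram[OF p] finite_words bij_young[OF p] this, of n]
  show ?thesis unfolding schur_def SSYT_fillings[OF p] fst by simp
qed

lemma schurP_fundamental:
  assumes g: "strict_partition g"
  shows "schurP n g = (\<Sum>ys\<in>shifted_words (smaya g). fundamental n ys)"
proof -
  let ?D = "shifted_diagram g"
  have fst: "fst (skey b x) = num x" for b x by (simp add: skey_def)
  have S: "SSHT_upto n g = {T \<in> fillings skey sgood ?D. \<forall>b\<in>?D. fst (skey b (T b)) \<le> n}"
    unfolding fst SSHT_upto_def SSHT_fillings[OF g] ..
  have "inj_on (\<lambda>b. skey b (T b)) ?D" if T: "T \<in> fillings skey sgood ?D" for T
  proof (rule key_inj_on[OF T])
    fix b b' l l'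
    assume b: "b \<in> ?D" "b' \<in> ?D" and k: "skey b l = skey b' l'"
    show "b = b' \<or> (\<exists>d\<in>?D. before b d \<and> before d b' \<or> before b' d \<and> before d b)"
      by (rule shifted_separated[OF g b k])
  qed
  from sum_fillings[OF finite_shifted_diagram[OF g] finite_shifted_words bij_shifted[OF g, unfolded SSHT_fillings[OF g]] this, of n]
  show ?thesis unfolding schurP_def S wt_def[abs_def] fst by simp
qed

text \<open>Existence comes from \<open>reachable_maya\<close> and uniqueness from
  \<open>maya_inj\<close>, so on shifted words the choice is determined.\<close>

definition shape_of :: "int list \<Rightarrow> nat \<Rightarrow> nat" where
  "shape_of ys = (SOME p. is_partition p \<and> fst (full ys) \<in> words (maya p))"

lemma shape_of:
  assumes "ys \<in> shifted_words Y"
  shows "is_partition (shape_of ys) \<and> fst (full ys) \<in> words (maya (shape_of ys))"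
proof -
  have "ok {..<0} (dbl ys)" using assms by (simp add: shifted_words_def)
  from full_ok[OF this] have o: "ok {..<0} (fst (full ys))" by simp
  from reachable_maya[OF this] obtain p where "is_partition p" "fin {..<0} (fst (full ys)) = maya p" by blast
  then have "is_partition p \<and> fst (full ys) \<in> words (maya p)" using o by (simp add: words_def)
  then show ?thesis unfolding shape_of_def
    by (rule someI[where P = "\<lambda>p. is_partition p \<and> fst (full ys) \<in> words (maya p)"])
qed

lemma shape_of_eq:
  assumes "ys \<in> shifted_words Y" "is_partition p" "fst (full ys) \<in> words (maya p)"
  shows "shape_of ys = p"
  using shape_of[OF assms(1)] assms maya_inj[of "shape_of ys" p] by (auto simp: words_def)

text \<open>Shifted words are grouped by the shape p of their image and then by the image U itself.
  The number of preimages is the same for all U of shape p, so it factors out and the remaining sum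
  over U is the Schur polynomial.\<close>

lemma schurP_expansion:
  assumes g: "strict_partition g"
  defines "Y \<equiv> smaya g"
  shows "schurP n g = (\<Sum>p\<in>shape_of ` shifted_words Y. of_nat (card (fibre Y (superstandard p))) * schur n p)"
proof -
  let ?W = "shifted_words Y"
  have "schurP n g = (\<Sum>ys\<in>?W. fundamental n (fst (full ys)))"
    unfolding schurP_fundamental[OF g] Y_def
    by (rule sum.cong[OF refl]) (simp add: fundamental_full[of "{..<0}"] shifted_words_def)
  also have "\<dots> = (\<Sum>p\<in>shape_of ` ?W. \<Sum>ys | ys \<in> ?W \<and> shape_of ys = p. fundamental n (fst (full ys)))"
    by (rule sum.image_gen[OF finite_shifted_words])
  also have "\<dots> = (\<Sum>p\<in>shape_of ` ?W. of_nat (card (fibre Y (superstandard p))) * schur n p)"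
  proof (rule sum.cong[OF refl])
    fix p assume "p \<in> shape_of ` ?W"
    then have p: "is_partition p" using shape_of by blast
    let ?S = "{ys. ys \<in> ?W \<and> shape_of ys = p}"
    have "(\<lambda>ys. fst (full ys)) ` ?S \<subseteq> words (maya p)" using shape_of by blast
    from sum.group[OF finite_subset[OF _ finite_shifted_words[of Y], of ?S] finite_words this, of "\<lambda>ys. fundamental n (fst (full ys))"]
    have "(\<Sum>ys\<in>?S. fundamental n (fst (full ys))) =
        (\<Sum>U\<in>words (maya p). \<Sum>ys\<in>{ys \<in> ?S. fst (full ys) = U}. fundamental n (fst (full ys)))" by force
    also have "\<dots> = (\<Sum>U\<in>words (maya p). of_nat (card (fibre Y (superstandard p))) * fundamental n U)"
    proof (rule sum.cong[OF refl])
      fix U assume U: "U \<in> words (maya p)"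
      have e: "{ys \<in> ?S. fst (full ys) = U} = fibre Y U"
        using shape_of_eq[OF _ p] U by (auto simp: fibre_def)
      have "(\<Sum>ys\<in>fibre Y U. fundamental n (fst (full ys))) = (\<Sum>ys\<in>fibre Y U. fundamental n U)"
        by (rule sum.cong[OF refl]) (simp add: fibre_def)
      also have "\<dots> = of_nat (card (fibre Y (superstandard p))) * fundamental n U"
        using card_fibre_const[OF U superstandard_words[OF p], of Y] by simp
      finally show "(\<Sum>ys\<in>{ys \<in> ?S. fst (full ys) = U}. fundamental n (fst (full ys))) =
        of_nat (card (fibre Y (superstandard p))) * fundamental n U" unfolding e .
    qed
    finally show "(\<Sum>ys | ys \<in> ?W \<and> shape_of ys = p. fundamental n (fst (full ys))) =
        of_nat (card (fibre Y (superstandard p))) * schur n p"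
      by (simp add: schur_fundamental[OF p] sum_distrib_left)
  qed
  finally show ?thesis .
qed

section \<open>Yamanouchi tableaux as preimages of superstandard words\<close>

text \<open>The blocks of T have the lattice property by \<open>Yam_iff\<close>, those of its image
  by \<open>lattice_blocks_full\<close>, and \<open>yamanouchi_pairs\<close> leaves only the
  superstandard filling. Its row lengths count the labels, which \<open>full\<close> does not touch,
  so the shape is the weight of T.\<close>

lemma Yam_shape:
  assumes g: "strict_partition g" and Yam: "T \<in> Yam g"
  defines "ps \<equiv> keys skey (shifted_diagram g) T"
  shows "map snd ps \<in> shifted_words (smaya g)" "wt g T = shape_of (map snd ps)"
    "fst (full (map snd ps)) = superstandard (wt g T)" "map fst ps = map fst (superstandard_pairs (wt g T))"
proof -
  have TS: "T \<in> SSHT g" using Yam by (simp add: Yam_def)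
  interpret shifted_tableau g T by unfold_locales (rule g TS)+
  have pw: "ps \<in> pair_words (shifted_words (smaya g))" unfolding ps_def by (rule bij_betw_apply[OF bij_shifted[OF g] TS])
  let ?ys = "map snd ps"
  show ys: "?ys \<in> shifted_words (smaya g)" using pw by (simp add: pair_words_def)
  then have o: "ok {..<0} (dbl ?ys)" by (simp add: shifted_words_def)
  have s: "sorted_wrt (<) ps" using pw by (simp add: pair_words_def)
  define qs where "qs = zip (map fst ps) (fst (full ?ys))"
  have len: "length (fst (full ?ys)) = length (map fst ps)" by simp
  have mq: "map fst qs = map fst ps" "map snd qs = fst (full ?ys)" using len by (simp_all add: qs_def)
  have lat: "lattice (blk i qs) (blk (Suc i) qs)" if "1 \<le> i" for i
    using Yam_iff Yam that lattice_blocks_full[OF _ o s, of i] unfolding qs_def ps_def by simp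
  have sq: "sorted_wrt (<) qs"
    using compatible_full[OF o, of "map fst ps"] s by (simp add: zip_map_fst_snd qs_def)
  have pq: "1 \<le> fst q" if "q \<in> set qs" for q
  proof -
    have "fst q \<in> set (map fst ps)" using that mq(1) by (metis image_eqI list.set_map)
    then show ?thesis using pw by (auto simp: pair_words_def)
  qed
  have oq: "ok {..<0} (map snd qs)" unfolding mq using full_ok[OF o] by simp
  have w: "(\<lambda>i. length (blk i qs)) = wt g T"
  proof
    fix i
    have "length (blk i qs) = length (filter (\<lambda>j. j = i) (map fst qs))" unfolding filter_map_fst by (simp add: blk_def)
    also have "\<dots> = wt g T i" unfolding mq filter_map_fst wt_keys ps_def ..
    finally show "length (blk i qs) = wt g T i" .
  qed
  have part: "is_partition (wt g T)" and eq: "qs = superstandard_pairs (wt g T)"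
    using yamanouchi_pairs[OF sq pq oq lat] unfolding w by auto
  show f: "fst (full ?ys) = superstandard (wt g T)"
    using mq(2) eq map_snd_superstandard_pairs by metis
  show "map fst ps = map fst (superstandard_pairs (wt g T))" using mq(1) eq by metis
  show "wt g T = shape_of ?ys"
    using shape_of_eq[OF ys part] superstandard_words[OF part] f by simp
qed

text \<open>Labels need not be recorded in the word: they are those of the superstandard filling of
  \<open>shape_of ys\<close>. Conversely, these labels are compatible with ys because
  \<open>full\<close> keeps descents, and the lattice property holds because it holds for the rows
  of a partition.\<close>

lemma bij_Yam:
  assumes g: "strict_partition g"
  shows "bij_betw (\<lambda>T. map snd (keys skey (shifted_diagram g) T)) (Yam g)
    {ys \<in> shifted_words (smaya g). fst (full ys) = superstandard (shape_of ys)}"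
proof (rule bij_betwI')
  note bij = bij_shifted[OF g]
  let ?k = "keys skey (shifted_diagram g)"
  fix T1 T2 assume T: "T1 \<in> Yam g" "T2 \<in> Yam g"
  have S: "T1 \<in> SSHT g" "T2 \<in> SSHT g" using T by (simp_all add: Yam_def)
  show "map snd (?k T1) = map snd (?k T2) \<longleftrightarrow> T1 = T2"
  proof
    assume e: "map snd (?k T1) = map snd (?k T2)"
    then have "wt g T1 = wt g T2" using Yam_shape(2)[OF g T(1)] Yam_shape(2)[OF g T(2)] by simp
    then have "map fst (?k T1) = map fst (?k T2)" using Yam_shape(4)[OF g T(1)] Yam_shape(4)[OF g T(2)] by simp
    then have "?k T1 = ?k T2" using e by (metis zip_map_fst_snd)
    then show "T1 = T2" using inj_onD[OF bij_betw_imp_inj_on[OF bij]] S by blast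
  qed simp
next
  fix T assume T: "T \<in> Yam g"
  show "map snd (keys skey (shifted_diagram g) T) \<in> {ys \<in> shifted_words (smaya g). fst (full ys) = superstandard (shape_of ys)}"
    using Yam_shape(1-3)[OF g T] by simp
next
  fix ys assume ys: "ys \<in> {ys \<in> shifted_words (smaya g). fst (full ys) = superstandard (shape_of ys)}"
  define p where "p = shape_of ys"
  have W: "ys \<in> shifted_words (smaya g)" and f: "fst (full ys) = superstandard p" using ys by (simp_all add: p_def)
  have p: "is_partition p" using shape_of[OF W] by (simp add: p_def)
  have o: "ok {..<0} (dbl ys)" using W by (simp add: shifted_words_def)
  define "is" where "is = map fst (superstandard_pairs p)"
  have len: "length is = length ys"
    using f length_full(1)[of ys] map_snd_superstandard_pairs[of p] by (metis is_def length_map)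
  have z: "zip is (fst (full ys)) = superstandard_pairs p"
    unfolding f map_snd_superstandard_pairs[symmetric] is_def by (rule zip_map_fst_snd)
  define ps where "ps = zip is ys"
  have m: "map fst ps = is" "map snd ps = ys" using len by (simp_all add: ps_def)
  have s: "sorted_wrt (<) ps" unfolding ps_def compatible_full[OF o len] z by (rule sorted_superstandard_pairs)
  have pos: "1 \<le> fst q" if "q \<in> set ps" for q
  proof -
    have "fst q \<in> set is" using that m(1) by (metis image_eqI list.set_map)
    then show ?thesis using superstandard_pairs_pos by (auto simp: is_def)
  qed
  have "ps \<in> pair_words (shifted_words (smaya g))" using s pos m W by (simp add: pair_words_def)
  then obtain T where SSHT: "T \<in> SSHT g" "ps = keys skey (shifted_diagram g) T"
    using bij_betw_imp_surj_on[OF bij_shifted[OF g]] by blast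
  interpret shifted_tableau g T by unfold_locales (rule g SSHT(1))+
  have "lattice (blk i ps) (blk (Suc i) ps)" if i: "1 \<le> i" for i
  proof -
    have "lattice (row_word p i) (row_word p (Suc i))"
      by (rule lattice_rows) (use p i in \<open>simp add: is_partition_def\<close>)
    then show ?thesis using lattice_blocks_full[of "{..<0}" ps i] o s i
      by (simp add: m z blk_superstandard_pairs[OF p])
  qed
  then have "T \<in> Yam g" using Yam_iff SSHT(2) by simp
  then show "\<exists>T\<in>Yam g. ys = map snd (keys skey (shifted_diagram g) T)" using m(2) SSHT(2) by metis
qed

theorem corollary12:
  fixes \<gamma> :: "nat \<Rightarrow> nat" and n :: nat
  assumes "strict_partition \<gamma>" and "n \<ge> 1"
  shows "schurP n \<gamma> = (\<Sum>T\<in>Yam \<gamma>. schur n (wt \<gamma> T)) \<and> schur_positive n (schurP n \<gamma>)"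
proof
  note g = assms(1)
  let ?Y = "smaya \<gamma>"
  let ?W = "shifted_words ?Y"
  let ?V = "{ys \<in> ?W. fst (full ys) = superstandard (shape_of ys)}"
  let ?k = "\<lambda>T. map snd (keys skey (shifted_diagram \<gamma>) T)"
  have part: "is_partition p" if "p \<in> shape_of ` ?W" for p using that shape_of by blast
  have "(\<Sum>T\<in>Yam \<gamma>. schur n (wt \<gamma> T)) = (\<Sum>T\<in>Yam \<gamma>. schur n (shape_of (?k T)))"
    by (rule sum.cong[OF refl]) (simp add: Yam_shape(2)[OF g])
  also have "\<dots> = (\<Sum>ys\<in>?V. schur n (shape_of ys))"
    by (rule sum.reindex_bij_betw[OF bij_Yam[OF g]])
  also have "\<dots> = (\<Sum>p\<in>shape_of ` ?W. \<Sum>ys\<in>{ys \<in> ?V. shape_of ys = p}. schur n (shape_of ys))"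
    by (rule sum.group[symmetric]) (auto simp: finite_shifted_words)
  also have "\<dots> = (\<Sum>p\<in>shape_of ` ?W. of_nat (card (fibre ?Y (superstandard p))) * schur n p)"
  proof (rule sum.cong[OF refl])
    fix p assume "p \<in> shape_of ` ?W"
    then have p: "is_partition p" by (rule part)
    \<comment> \<open>The image determines the shape, so all words with superstandard image of shape
      p form a single fibre.\<close>
    have "{ys \<in> ?V. shape_of ys = p} = fibre ?Y (superstandard p)"
      using shape_of_eq[OF _ p] superstandard_words[OF p] by (auto simp: fibre_def)
    moreover have "(\<Sum>ys\<in>{ys \<in> ?V. shape_of ys = p}. schur n (shape_of ys)) =
        (\<Sum>ys\<in>{ys \<in> ?V. shape_of ys = p}. schur n p)" by (rule sum.cong[OF refl]) simp
    ultimately show "(\<Sum>ys\<in>{ys \<in> ?V. shape_of ys = p}. schur n (shape_of ys)) =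
        of_nat (card (fibre ?Y (superstandard p))) * schur n p" by simp
  qed
  finally show "schurP n \<gamma> = (\<Sum>T\<in>Yam \<gamma>. schur n (wt \<gamma> T))" using schurP_expansion[OF g] by simp
  show "schur_positive n (schurP n \<gamma>)"
    unfolding schur_positive_def schurP_expansion[OF g]
    using part finite_shifted_words by (intro exI[of _ "shape_of ` ?W"] exI[of _ "\<lambda>p. card (fibre ?Y (superstandard p))"]) auto
qed

end
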